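(* Let $n\ge 2$. For all $1\le r\le n-1$, $\mathcal{TO}_{n,r}$ is a normal subgroup of $\mathcal{TO}_n$, and $\mathcal O_{n,r}$ is a normal subgroup of $\mathcal O_n$.
   Context: Notation. Maps act on the right. $X_n=\{0,\ldots,n-1\}$; $X_n^*$ (resp. $X_n^k$) is the set of finite words (words of length $k$) over $X_n$; $\epsilon$ is the empty word; for $1\le r\le n-1$, $\dot{\mathbf r}=\{\dot 0,\ldots,\dot{(r-1)}\}$ is a further ordered alphabet; $X_{n,r}^+=\{\dot a w:\dot a\in\dot{\mathbf r},\,w\in X_n^*\}$, $X_{n,r}^*=X_{n,r}^+\cup\{\epsilon\}$. $\mathfrak C_n=X_n^\omega$ and $\mathfrak C_{n,r}=\{\dot a x:\dot a\in\dot{\mathbf r},\,x\in\mathfrak C_n\}$ are Cantor spaces. The relation $\simeq$ on $\mathfrak C_{n,r}$: $x\simeq y$ iff $x=y$, or $\{x,y\}=\{w\,i\,000\ldots,\;w\,(i-1)(n-1)(n-1)\ldots\}$ with $w\in X_{n,r}^+$ and $0<i\le n-1$, or $\{x,y\}=\{\dot a\,00\ldots,\;\dot{(a-1)}(n-1)(n-1)\ldots\}$ with $0<a\le r-1$, or $\{x,y\}=\{\dot 0\,00\ldots,\;\dot{(r-1)}(n-1)(n-1)\ldots\}$. Transducers over $X_n$. A transducer $\langle X_n,Q,\pi,\lambda\rangle$ has transition function $\pi:X_n\times Q\to Q$ and output function $\lambda:X_n\times Q\to X_n^*$, extended to words by $\pi(wi,q)=\pi(i,\pi(w,q))$, $\lambda(wi,q)=\lambda(w,q)\lambda(i,\pi(w,q))$,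 such that infinite inputs give infinite outputs; $h_q:\mathfrak C_n\to\mathfrak C_n$ is the continuous map $\delta\mapsto\lambda(\delta,q)$. Fixing an initial state $q_0$ gives an initial transducer, representing $h_{q_0}$; it is minimal if all states are reachable from $q_0$, $h_q\neq h_p$ for distinct states $q,p$, and for every state $q$ and letter $i$, $\lambda(i,q)$ is the greatest common prefix of $\{(i\delta)h_q:\delta\in\mathfrak C_n\}$. A transducer is synchronizing at level $k$ if for each $\Gamma\in X_n^k$ the state $\pi(\Gamma,q)$ does not depend on $q$ (the state forced by $\Gamma$); its core is the sub-transducer on the states forced by words of $X_n^k$. Transducers over $\mathfrak C_{n,r}$. An initial transducer $A_{q_0}$ over $\mathfrak C_{n,r}$ has state set $Q=R\sqcup S$ with $R$ finite, $q_0\in R$, and functions $\pi,\lambda$ defined on $(\dot{\mathbf r}\times\{q_0\})\sqcup(X_n\times(Q\setminus\{q_0\}))$, $\pi$ with values in $Q\setminus\{q_0\}$ and $\lambda$ with values in $X_{n,r}^*\sqcup X_n^*$, such that: a transition from a state of $R$ outputs $\epsilon$ if it ends in $R$ and a word of $X_{n,r}^+$ if it ends in $S$; transitions from $S$ end in $S$ with output in $X_n^*$; infinite words read from states of $S$ give infinite output; no state of $R$ lies on a cycle. It represents the map $h_{q_0}:\mathfrak C_{n,r}\to\mathfrak C_{n,r}$. It is minimal if all its states are reachable from $q_0$, distinct states $q,p$ induce distinct maps $\delta\mapsto\lambda(\delta,q)$, $\delta\mapsto\lambda(\delta,p)$ on infinite words, and for every state $q$ and every letter $i$ readable from $q$,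 $\lambda(i,q)$ is the greatest common prefix of $\{\lambda(i\delta,q):\delta\in\mathfrak C_n\}$; every homeomorphism of $\mathfrak C_{n,r}$ is represented by a unique minimal transducer. It is synchronizing if for some $k$ the state reached by reading a word of length $k$ from any state from which it can be read depends only on the word; its core is then the transducer over $X_n$ formed by the states forced by words of $X_n^k$. Groups. $\mathcal B_{n,r}$ is the group of homeomorphisms $h$ of $\mathfrak C_{n,r}$ such that the minimal transducers of $h$ and $h^{-1}$ are finite and synchronizing; $\mathcal{TB}_{n,r}$ is the subgroup of those $h\in\mathcal B_{n,r}$ preserving $\simeq$. For $h\in\mathcal B_{n,r}$ let $\mathrm{Core}(h)$ be the core of its minimal transducer (a transducer over $X_n$, up to renaming states). $\mathcal O_{n,r}=\{\mathrm{Core}(h):h\in\mathcal B_{n,r}\}$, $\mathcal{TO}_{n,r}=\{\mathrm{Core}(h):h\in\mathcal{TB}_{n,r}\}$, $\mathcal O_n=\bigcup_{1\le r\le n-1}\mathcal O_{n,r}$ (which equals $\mathcal O_{n,n-1}$), $\mathcal{TO}_n=\mathcal{TO}_{n,n-1}$. The product of $g,h\in\mathcal O_n$ is the core of the minimal transducer representing $h_{q_1}$ followed by $h_{q_2}$, for any states $q_1$ of $g$ and $q_2$ of $h$ (independent of the choice). With this product $\mathcal O_n$ is a group, each $\mathcal O_{n,r}$ and $\mathcal{TO}_{n,r}$ is a subgroup, $\mathcal O_{n,r}\cong\mathrm{Out}(G_{n,r})$ and $\mathcal{TO}_{n,r}\cong\mathrm{Out}(T_{n,r})$ for the Higman–Thompson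 groups $G_{n,r}$ and $T_{n,r}$. *)

theory Defs
  imports "HOL-Analysis.Function_Topology" "HOL-Algebra.Coset" "HOL-Library.Omega_Words_Fun"
begin

subsection \<open>Words and Cantor space\<close>

text \<open>\<open>Ltr i\<close> is the letter \<open>i\<close> of \<open>X\<^sub>n\<close>; \<open>Dot a\<close> is the dotted letter \<open>a\<close>.
  Infinite words and the operations \<open>\<frown>\<close> and \<^const>\<open>subsequence\<close> (with \<open>prefix k x\<close> the prefix
  of length \<open>k\<close>) are those of \<^theory>\<open>HOL-Library.Omega_Words_Fun\<close>.\<close>

datatype letter = Ltr nat | Dot nat

definition Xn :: "nat \<Rightarrow> letter set" where
  "Xn n = Ltr ` {..<n}"

definition dots :: "nat \<Rightarrow> letter set" where
  "dots r = Dot ` {..<r}"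

definition Xr_plus :: "nat \<Rightarrow> nat \<Rightarrow> letter list set" where
  "Xr_plus n r = {d # w | d w. d \<in> dots r \<and> w \<in> lists (Xn n)}"

definition cantor_r :: "nat \<Rightarrow> nat \<Rightarrow> letter word topology" where
  "cantor_r n r = product_topology (\<lambda>k. discrete_topology (if k = 0 then dots r else Xn n)) UNIV"

definition circ_rel :: "nat \<Rightarrow> nat \<Rightarrow> letter word \<Rightarrow> letter word \<Rightarrow> bool" where
  "circ_rel n r x y \<longleftrightarrow> x \<in> topspace (cantor_r n r) \<and> y \<in> topspace (cantor_r n r) \<and>
     (let zeros = (\<lambda>_. Ltr 0); tops = (\<lambda>_. Ltr (n - 1)) in
       x = y
     \<or> (\<exists>w \<in> Xr_plus n r. \<exists>i. 0 < i \<and> i \<le> n - 1 \<and>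
          {x, y} = {(w @ [Ltr i]) \<frown> zeros, (w @ [Ltr (i - 1)]) \<frown> tops})
     \<or> (\<exists>a. 0 < a \<and> a \<le> r - 1 \<and> {x, y} = {[Dot a] \<frown> zeros, [Dot (a - 1)] \<frown> tops})
     \<or> {x, y} = {[Dot 0] \<frown> zeros, [Dot (r - 1)] \<frown> tops})"

definition is_prefix :: "letter list \<Rightarrow> letter word \<Rightarrow> bool" where
  "is_prefix w x \<longleftrightarrow> prefix (length w) x = w"

text \<open>Nothing is a greatest common prefix of a singleton, whose common prefixes have unbounded
  length.\<close>

definition greatest_common_prefix :: "letter list \<Rightarrow> letter word set \<Rightarrow> bool" where
  "greatest_common_prefix w S \<longleftrightarrow>
     (\<forall>x\<in>S. is_prefix w x) \<and> (\<forall>v. (\<forall>x\<in>S. is_prefix v x) \<longrightarrow> length v \<le> length w)"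

subsection \<open>Transducers\<close>

text \<open>\<open>step\<close> is \<open>\<pi>\<close> and \<open>out\<close> is \<open>\<lambda>\<close>. Both are partial: at a state \<open>q\<close> they are
  defined on the letters in \<open>reads q\<close>; values elsewhere carry no meaning.\<close>

record 'q transducer =
  states :: "'q set"
  reads :: "'q \<Rightarrow> letter set"
  step :: "letter \<Rightarrow> 'q \<Rightarrow> 'q"
  out :: "letter \<Rightarrow> 'q \<Rightarrow> letter list"

definition step_word :: "'q transducer \<Rightarrow> letter list \<Rightarrow> 'q \<Rightarrow> 'q" where
  "step_word T = fold (step T)"

primrec out_word :: "'q transducer \<Rightarrow> letter list \<Rightarrow> 'q \<Rightarrow> letter list" where
  "out_word T [] q = []"
| "out_word T (i # w) q = out T i q @ out_word T w (step T i q)"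

primrec readable :: "'q transducer \<Rightarrow> 'q \<Rightarrow> letter list \<Rightarrow> bool" where
  "readable T q [] \<longleftrightarrow> True"
| "readable T q (i # w) \<longleftrightarrow> i \<in> reads T q \<and> readable T (step T i q) w"

definition inputs :: "'q transducer \<Rightarrow> 'q \<Rightarrow> letter word set" where
  "inputs T q = {x. \<forall>k. readable T q (prefix k x)}"

definition productive :: "'q transducer \<Rightarrow> 'q \<Rightarrow> bool" where
  "productive T q \<longleftrightarrow> (\<forall>x \<in> inputs T q. \<forall>m. \<exists>k. m < length (out_word T (prefix k x) q))"

text \<open>The map \<open>h\<^sub>q\<close>: the infinite word having all \<open>out_word T (prefix k x) q\<close> as prefixes,
  meaningful when \<open>productive T q\<close> and \<open>x \<in> inputs T q\<close>.\<close>

definition local_map :: "'q transducer \<Rightarrow> 'q \<Rightarrow> letter word \<Rightarrow> letter word" where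
  "local_map T q x =
     (\<lambda>m. out_word T (prefix (LEAST k. m < length (out_word T (prefix k x) q)) x) q ! m)"

definition represents :: "'q transducer \<Rightarrow> 'q \<Rightarrow> (letter word \<Rightarrow> letter word) \<Rightarrow> bool" where
  "represents T q h \<longleftrightarrow> (\<forall>x \<in> inputs T q. local_map T q x = h x)"

text \<open>Partial maps are distinct also when their domains differ, hence the comparison of
  \<^const>\<open>inputs\<close>.\<close>

definition minimal :: "'q transducer \<Rightarrow> 'q \<Rightarrow> bool" where
  "minimal T q0 \<longleftrightarrow>
     (\<forall>q \<in> states T. \<exists>w. readable T q0 w \<and> step_word T w q0 = q) \<and>
     (\<forall>p \<in> states T. \<forall>q \<in> states T.
        inputs T p = inputs T q \<and> (\<forall>x \<in> inputs T p. local_map T p x = local_map T q x) \<longrightarrow> p = q) \<and>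
     (\<forall>q \<in> states T. \<forall>i \<in> reads T q.
        greatest_common_prefix (out T i q)
          {local_map T q ([i] \<frown> x) | x. [i] \<frown> x \<in> inputs T q})"

definition synchronizing_at :: "'q transducer \<Rightarrow> nat \<Rightarrow> bool" where
  "synchronizing_at T k \<longleftrightarrow>
     (\<forall>w. length w = k \<longrightarrow> (\<forall>p \<in> states T. \<forall>q \<in> states T.
        readable T p w \<and> readable T q w \<longrightarrow> step_word T w p = step_word T w q))"

definition synchronizing :: "'q transducer \<Rightarrow> bool" where
  "synchronizing T \<longleftrightarrow> (\<exists>k. synchronizing_at T k)"

text \<open>The states forced by words of \<open>X\<^sub>n\<^sup>k\<close> are the same for every level \<open>k\<close> at which the
  transducer is synchronizing.\<close>

definition core :: "nat \<Rightarrow> 'q transducer \<Rightarrow> 'q transducer" where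
  "core n T = T\<lparr>states := {step_word T w q | k w q. synchronizing_at T k \<and>
     w \<in> lists (Xn n) \<and> length w = k \<and> q \<in> states T \<and> readable T q w}\<rparr>"

definition transducer_iso :: "'q transducer \<Rightarrow> 'p transducer \<Rightarrow> bool" where
  "transducer_iso S T \<longleftrightarrow> (\<exists>f. bij_betw f (states S) (states T) \<and>
     (\<forall>q \<in> states S. reads T (f q) = reads S q \<and>
        (\<forall>i \<in> reads S q. step T i (f q) = f (step S i q) \<and> out T i (f q) = out S i q)))"

definition transducer_over :: "nat \<Rightarrow> 'q transducer \<Rightarrow> bool" where
  "transducer_over n T \<longleftrightarrow>
     (\<forall>q \<in> states T. reads T q = Xn n \<and> productive T q \<and>
        (\<forall>i \<in> Xn n. step T i q \<in> states T \<and> out T i q \<in> lists (Xn n)))"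

definition initial_transducer_over_r :: "nat \<Rightarrow> nat \<Rightarrow> 'q transducer \<Rightarrow> 'q \<Rightarrow> bool" where
  "initial_transducer_over_r n r A q0 \<longleftrightarrow>
     (\<exists>R S. states A = R \<union> S \<and> R \<inter> S = {} \<and> finite R \<and> q0 \<in> R \<and>
        reads A q0 = dots r \<and>
        (\<forall>q \<in> states A - {q0}. reads A q = Xn n) \<and>
        (\<forall>q \<in> states A. \<forall>i \<in> reads A q. step A i q \<in> states A - {q0}) \<and>
        (\<forall>q \<in> R. \<forall>i \<in> reads A q.
           (step A i q \<in> R \<longrightarrow> out A i q = []) \<and> (step A i q \<in> S \<longrightarrow> out A i q \<in> Xr_plus n r)) \<and>
        (\<forall>q \<in> S. \<forall>i \<in> reads A q. step A i q \<in> S \<and> out A i q \<in> lists (Xn n)) \<and>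
        (\<forall>q \<in> S. productive A q) \<and>
        (\<forall>q \<in> R. \<forall>w. w \<noteq> [] \<and> readable A q w \<longrightarrow> step_word A w q \<noteq> q))"

subsection \<open>The groups\<close>

text \<open>A minimal transducer has countably many states, so natural numbers suffice as states. The
  minimal transducer of a homeomorphism is only determined up to renaming of states; \<open>A\<close>, \<open>q0\<close>
  below is any copy of it.\<close>

definition minimal_transducer_of ::
    "nat \<Rightarrow> nat \<Rightarrow> (letter word \<Rightarrow> letter word) \<Rightarrow> nat transducer \<Rightarrow> nat \<Rightarrow> bool" where
  "minimal_transducer_of n r h A q0 \<longleftrightarrow>
     initial_transducer_over_r n r A q0 \<and> minimal A q0 \<and> represents A q0 h"

definition finite_sync :: "nat \<Rightarrow> nat \<Rightarrow> (letter word \<Rightarrow> letter word) \<Rightarrow> bool" where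
  "finite_sync n r h \<longleftrightarrow>
     (\<exists>A q0. minimal_transducer_of n r h A q0 \<and> finite (states A) \<and> synchronizing A)"

definition B_set :: "nat \<Rightarrow> nat \<Rightarrow> (letter word \<Rightarrow> letter word) set" where
  "B_set n r = {h \<in> extensional (topspace (cantor_r n r)).
     homeomorphic_map (cantor_r n r) (cantor_r n r) h \<and>
     finite_sync n r h \<and> finite_sync n r (inv_into (topspace (cantor_r n r)) h)}"

definition TB_set :: "nat \<Rightarrow> nat \<Rightarrow> (letter word \<Rightarrow> letter word) set" where
  "TB_set n r = {h \<in> B_set n r. \<forall>x y. circ_rel n r x y \<longrightarrow> circ_rel n r (h x) (h y)}"

text \<open>A transducer up to renaming of states is represented by its isomorphism class, the set of all
  isomorphic transducers with states in \<^typ>\<open>nat\<close>.\<close>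

definition iso_class :: "'q transducer \<Rightarrow> nat transducer set" where
  "iso_class T = {T'. transducer_iso T T'}"

text \<open>By uniqueness of the minimal transducer, the union is over copies of one transducer and hence
  is a single isomorphism class.\<close>

definition Core :: "nat \<Rightarrow> nat \<Rightarrow> (letter word \<Rightarrow> letter word) \<Rightarrow> nat transducer set" where
  "Core n r h = \<Union> {iso_class (core n A) | A q0. minimal_transducer_of n r h A q0}"

definition O_set :: "nat \<Rightarrow> nat \<Rightarrow> nat transducer set set" where
  "O_set n r = Core n r ` B_set n r"

definition TO_set :: "nat \<Rightarrow> nat \<Rightarrow> nat transducer set set" where
  "TO_set n r = Core n r ` TB_set n r"

text \<open>As maps act on the right, \<open>h\<^bsub>q1\<^esub>\<close> is applied first. The resulting core does not depend on the
  choices of \<open>T1\<close>, \<open>T2\<close>, \<open>q1\<close>, \<open>q2\<close> and of the copy of the minimal transducer, so for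
  \<open>g\<close> and \<open>h\<close> in \<open>O_n\<close> the union is a single isomorphism class.\<close>

definition core_mult :: "nat \<Rightarrow> nat transducer set \<Rightarrow> nat transducer set \<Rightarrow> nat transducer set" where
  "core_mult n g h = \<Union> {iso_class (core n A) | (A :: nat transducer) q0 T1 T2 q1 q2.
     T1 \<in> g \<and> T2 \<in> h \<and> q1 \<in> states T1 \<and> q2 \<in> states T2 \<and>
     transducer_over n A \<and> q0 \<in> states A \<and> minimal A q0 \<and>
     represents A q0 (local_map T2 q2 \<circ> local_map T1 q1)}"

definition id_transducer :: "nat \<Rightarrow> nat transducer" where
  "id_transducer n = \<lparr>states = {0}, reads = (\<lambda>_. Xn n), step = (\<lambda>_ q. q), out = (\<lambda>i _. [i])\<rparr>"

definition O_group :: "nat \<Rightarrow> nat transducer set monoid" where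
  "O_group n = \<lparr>carrier = (\<Union>r\<in>{1..n - 1}. O_set n r),
     mult = core_mult n, one = iso_class (id_transducer n)\<rparr>"

definition TO_group :: "nat \<Rightarrow> nat transducer set monoid" where
  "TO_group n = (O_group n)\<lparr>carrier := TO_set n (n - 1)\<rparr>"

end

theory Submission
  imports Defs "HOL-Number_Theory.Cong" "HOL-Analysis.T1_Spaces"
begin

text \<open>Every map induced by a state of a core determines the core, so \<open>\<O>\<^sub>n\<close> is identified with the group of
  invertible synchronizing maps of \<open>X\<^sub>n\<^sup>\<omega>\<close>, where two maps are equivalent if their local actions at all
  sufficiently long words coincide. The image of such a map \<open>f\<close> is a disjoint union of cones, whose number
  modulo \<open>n - 1\<close> depends only on the class of \<open>f\<close>, because by synchronization each local action contributes
  equally. This number is multiplicative, and counting the cones of \<open>\<CC>\<^bsub>n,r\<^esub>\<close> shows that \<open>f\<close> comes from a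
  homeomorphism of \<open>\<CC>\<^bsub>n,r\<^esub>\<close> if and only if \<open>r m \<equiv> r\<close> modulo \<open>n - 1\<close>, where \<open>m\<close> is the number of \<open>f\<close>. So
  membership in \<open>\<O>\<^bsub>n,r\<^esub>\<close> is a condition on the image under a homomorphism to an abelian group.
  The homeomorphism can be chosen to preserve \<open>\<simeq>\<close> if and only if \<open>f\<close> is equivalent to a monotone map, by a
  discrete intermediate value argument.\<close>

text \<open>Cutting a cone one letter further down replaces it by \<open>n\<close> cones, so the
  cones of a clopen set can be counted only modulo \<open>n - 1\<close>; this is the origin of the
  modulus. The map of a core state is in general not onto \<open>C\<close>: stripping the common
  prefix from a homeomorphism on a cone leaves an injection with clopen images (\<open>emb\<close>).
  Hence inverses exist only up to \<open>sim\<close>, and the group laws are checked for maps modulo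
  \<open>sim\<close> and carried over by \<open>Cl\<close>. That \<open>sim\<close> is a congruence
  has two sides. In the outer factor of a composite it holds because long inputs of the inner map
  give long outputs. In the inner factor, equivalent maps may first emit different words, and it is
  synchronization that lets the outer map forget them. For transducers a canonical model is used
  whose states are the local actions themselves, so minimality and independence of choices become
  statements about maps. Finally \<open>UTO r\<close> is the intersection of
  \<open>UTO (n - 1)\<close> with \<open>UO r\<close>; its stability under conjugation follows from
  that of \<open>UO r\<close> once the classes of monotone maps are known to be a subgroup.\<close>

subsection \<open>Words and local actions\<close>

\<comment> \<open>These rules would rewrite \<open>[i] \<frown> y\<close> to \<open>i ## y\<close>.\<close>
declare build_cons [simp del] build_append [simp del]

abbreviation (input) on_cone :: "(letter word \<Rightarrow> letter word) \<Rightarrow> letter list \<Rightarrow> letter word \<Rightarrow> letter word"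
    (infix "\<star>" 90) where
  "f \<star> w \<equiv> \<lambda>y. f (w \<frown> y)"

lemma prefix_conc_drop:
  "k \<le> length w \<Longrightarrow> prefix k (w \<frown> x) = take k w"
  by (rule nth_equalityI) auto

lemma conc_inject:
  assumes "u \<frown> x = v \<frown> y" "length u = length v"
  shows "u = v \<and> x = y"
  by (metis assms prefix_conc_length suffix_conc_length)

lemma prefix_eq_take:
  "k \<le> m \<Longrightarrow> prefix k x = take k (prefix m x)"
  by (simp add: min_def)

lemma prefix_eq_mono:
  assumes "prefix m x = prefix m y" "k \<le> m"
  shows "prefix k x = prefix k y"
  using assms prefix_eq_take by metis

lemma is_prefix_conc_iff:
  "is_prefix w x \<longleftrightarrow> x = w \<frown> suffix (length w) x"
  unfolding is_prefix_def by (metis prefix_conc_length prefix_suffix)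

lemma is_prefix_conc [simp]: "is_prefix w (w \<frown> x)"
  by (simp add: is_prefix_def)

lemma is_prefix_conc_append: "is_prefix (u @ v) (u \<frown> x) \<longleftrightarrow> is_prefix v x"
  by (simp add: is_prefix_def)

lemma is_prefix_cases:
  assumes "is_prefix u x" "is_prefix v x" "length u \<le> length v"
  obtains d where "v = u @ d"
proof -
  have "u = take (length u) v"
    using assms unfolding is_prefix_def by (metis prefix_eq_take)
  then show ?thesis using that by (metis append_take_drop_id)
qed

lemma is_prefix_same_length:
  assumes "is_prefix u x" "is_prefix v x" "length u = length v"
  shows "u = v"
  using assms by (simp add: is_prefix_def)

lemma words_eq_if_prefixes:
  assumes "\<And>k. prefix k x = prefix k y"
  shows "x = y"
proof
  fix j
  have "prefix (Suc j) x ! j = prefix (Suc j) y ! j" using assms by simp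
  then show "x j = y j" by (simp del: subseq_to_Suc)
qed

lemma greatest_common_prefix_unique:
  assumes "greatest_common_prefix u S" "greatest_common_prefix v S" "S \<noteq> {}"
  shows "u = v"
proof -
  obtain x where "x \<in> S" using assms by auto
  then show ?thesis
    using assms unfolding greatest_common_prefix_def
    by (metis is_prefix_same_length le_antisym)
qed

lemma greatest_common_prefix_ex:
  assumes "x \<in> S" "y \<in> S" "x \<noteq> y"
  shows "\<exists>w. greatest_common_prefix w S"
proof -
  obtain j where j: "x j \<noteq> y j" using assms by auto
  define P where "P m \<longleftrightarrow> (\<exists>v. length v = m \<and> (\<forall>z\<in>S. is_prefix v z))" for m
  have "P 0" by (auto simp: P_def is_prefix_def)
  moreover have "m \<le> j" if Pm: "P m" for m
  proof (rule ccontr)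
    assume "\<not> m \<le> j"
    obtain v where "length v = m" "\<forall>z\<in>S. is_prefix v z"
      using Pm unfolding P_def by blast
    then have "prefix m x = prefix m y" using assms by (simp add: is_prefix_def)
    then have "prefix (Suc j) x = prefix (Suc j) y"
      using \<open>\<not> m \<le> j\<close> prefix_eq_mono by (metis Suc_leI not_le)
    then show False using j by simp
  qed
  ultimately obtain m where "P m" "\<And>m'. P m' \<Longrightarrow> m' \<le> m"
    using Greatest_le_nat[of P] GreatestI_nat[of P] by blast
  then show ?thesis unfolding P_def greatest_common_prefix_def by metis
qed

lemma prefix_Suc_Cons: "prefix (Suc k) x = x 0 # prefix k (suffix 1 x)"
  by (rule nth_equalityI) (auto simp: nth_Cons simp del: subseq_to_Suc split: nat.splits)

section \<open>The alphabet, its words and its spaces of infinite words\<close>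

locale alphabet =
  fixes n :: nat
  assumes two_le: "2 \<le> n"
begin

abbreviation "X \<equiv> Xn n"
abbreviation "Xs \<equiv> lists (Xn n)"

definition C :: "letter word set" where
  "C = {x. \<forall>k. x k \<in> X}"

lemma finite_X [simp]: "finite X"
  by (simp add: Xn_def)

lemma card_X [simp]: "card X = n"
  by (simp add: Xn_def card_image inj_on_def)

lemma Ltr_in_X [simp]: "Ltr i \<in> X \<longleftrightarrow> i < n"
  by (auto simp: Xn_def)

lemma X_nonempty: "Ltr 0 \<in> X" "Ltr 1 \<in> X" "X \<noteq> {}"
  using two_le by (auto simp: Xn_def lessThan_empty_iff)

lemma C_conc_iff [simp]: "w \<frown> x \<in> C \<longleftrightarrow> w \<in> Xs \<and> x \<in> C"
proof
  assume *: "w \<frown> x \<in> C"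
  have "w ! k \<in> X" if "k < length w" for k
    using * that by (simp add: C_def) (metis conc_fst)
  moreover have "x k \<in> X" for k
    using * by (auto simp: C_def dest!: spec[of _ "length w + k"])
  ultimately show "w \<in> Xs \<and> x \<in> C"
    by (auto simp: C_def in_set_conv_nth)
next
  assume "w \<in> Xs \<and> x \<in> C"
  then show "w \<frown> x \<in> C"
    unfolding C_def conc_def by (auto simp: lists_eq_set subset_code(1))
qed

lemma const_in_C: "a \<in> X \<Longrightarrow> (\<lambda>_. a) \<in> C"
  by (simp add: C_def)

lemma C_nonempty: "C \<noteq> {}"
  using const_in_C X_nonempty by auto

lemma prefix_in_Xs [simp]: "x \<in> C \<Longrightarrow> prefix k x \<in> Xs"
  by (auto simp: C_def in_set_conv_nth)

lemma subsequence_in_Xs [simp]: "x \<in> C \<Longrightarrow> subsequence x j k \<in> Xs"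
  by (auto simp: C_def in_set_conv_nth)

lemma suffix_in_C [simp]: "x \<in> C \<Longrightarrow> suffix k x \<in> C"
  by (auto simp: C_def)

lemma finite_Xs_length: "finite {w \<in> Xs. length w = k}"
  using finite_lists_length_eq[OF finite_X, of k] by (simp add: lists_eq_set)

lemma Xs_length_ex: "\<exists>w \<in> Xs. length w = k"
  using X_nonempty by (intro bexI[of _ "replicate k (Ltr 0)"]) auto

text \<open>\<open>D I\<close> consists of the infinite words with first letter in \<open>I\<close> and all other letters in \<open>X\<close>, and
  \<open>W I\<close> of their finite prefixes: \<open>I = X\<close> gives \<open>C\<close>, and \<open>I = dots r\<close> the space \<open>cantor_r n r\<close>.\<close>

definition D :: "letter set \<Rightarrow> letter word set" where
  "D I = {x. x 0 \<in> I \<and> suffix 1 x \<in> C}"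

definition W :: "letter set \<Rightarrow> letter list set" where
  "W I = insert [] {i # w | i w. i \<in> I \<and> w \<in> Xs}"

abbreviation "Cr r \<equiv> D (dots r)"

lemma Cons_in_W [simp]: "i # w \<in> W I \<longleftrightarrow> i \<in> I \<and> w \<in> Xs"
  by (auto simp: W_def)

lemma Nil_in_W [simp]: "[] \<in> W I"
  by (simp add: W_def)

lemma append_in_W: "u \<noteq> [] \<Longrightarrow> u @ v \<in> W I \<longleftrightarrow> u \<in> W I \<and> v \<in> Xs"
  by (cases u) auto

lemma W_X [simp]: "W X = Xs"
  by (auto simp: W_def neq_Nil_conv)

lemma Cons_conc: "(i # w) \<frown> y = [i] \<frown> (w \<frown> y)"
  by simp

lemma D_Cons [simp]: "(i # w) \<frown> y \<in> D I \<longleftrightarrow> i \<in> I \<and> w \<in> Xs \<and> y \<in> C"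
proof -
  have "suffix 1 ((i # w) \<frown> y) = w \<frown> y"
    unfolding Cons_conc[of i w y] using suffix_conc_length[of "[i]" "w \<frown> y"]
        by (simp only: length_Cons list.size One_nat_def)
  moreover have "((i # w) \<frown> y) 0 = i" by simp
  ultimately show ?thesis unfolding D_def by (simp only: mem_Collect_eq C_conc_iff)
qed

lemma D_conc_iff: "w \<noteq> [] \<Longrightarrow> w \<frown> y \<in> D I \<longleftrightarrow> w \<in> W I \<and> y \<in> C"
  by (cases w) auto

lemma first_letter_conc: "[x 0] \<frown> suffix 1 x = x"
proof -
  have "prefix 1 x \<frown> suffix 1 x = x" by (rule prefix_suffix[symmetric])
  moreover have "prefix 1 x = [x 0]" by simp
  ultimately show ?thesis by (simp only:)
qed

lemma D_cases:
  assumes "x \<in> D I" obtains i y where "i \<in> I" "y \<in> C" "x = [i] \<frown> y"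
  using assms that first_letter_conc[of x] unfolding D_def by auto

lemma D_X [simp]: "D X = C"
proof -
  have "x \<in> C \<longleftrightarrow> x 0 \<in> X \<and> suffix 1 x \<in> C" for x
    using C_conc_iff[of "[x 0]" "suffix 1 x"] unfolding first_letter_conc by simp
  then show ?thesis unfolding D_def by blast
qed

lemma prefix_in_W: "x \<in> D I \<Longrightarrow> prefix k x \<in> W I"
proof (cases k)
  case (Suc j)
  assume "x \<in> D I"
  then have "x 0 \<in> I" "prefix j (suffix 1 x) \<in> Xs"
    unfolding D_def by (auto simp del: subsequence_shift)
  then show ?thesis unfolding Suc prefix_Suc_Cons by (simp only: Cons_in_W simp_thms)
qed simp

lemma suffix_D_in_C: "x \<in> D I \<Longrightarrow> 0 < k \<Longrightarrow> suffix k x \<in> C"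
  using suffix_in_C[of "suffix 1 x" "k - 1"] by (simp add: D_def)

lemma first_letters_D: "(\<lambda>x. x 0) ` D I = I"
proof -
  obtain y where "y \<in> C" using C_nonempty by auto
  then have "i \<in> I \<Longrightarrow> i \<in> (\<lambda>x. x 0) ` D I" for i
    by (intro image_eqI[of _ _ "[i] \<frown> y"]) auto
  then show ?thesis by (auto simp: D_def)
qed

lemma finite_W_length: "finite I \<Longrightarrow> finite {w \<in> W I. length w \<le> k}"
proof -
  assume "finite I"
  then have "finite {w. set w \<subseteq> I \<union> X \<and> length w \<le> k}" by (intro finite_lists_length_le) simp
  then show ?thesis by (rule rev_finite_subset) (auto simp: W_def)
qed

lemma inj_on_D_conc: "inj_on g (D I) \<Longrightarrow> w \<in> W I \<Longrightarrow> w \<noteq> [] \<Longrightarrow> inj_on (g \<star> w) C"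
proof (rule inj_onI)
  fix x y assume *: "inj_on g (D I)" "w \<in> W I" "w \<noteq> []" "x \<in> C" "y \<in> C" "g (w \<frown> x) = g (w \<frown> y)"
  then have "w \<frown> x = w \<frown> y"
    using inj_on_eq_iff[OF *(1), of "w \<frown> x" "w \<frown> y"] by (simp add: D_conc_iff)
  then show "x = y" by simp
qed

text \<open>Non-constancy on \<open>C\<close> is what gives the image a greatest common prefix,
  since a singleton has none.\<close>

definition nc :: "(letter word \<Rightarrow> letter word) \<Rightarrow> bool" where
  "nc g \<longleftrightarrow> (\<exists>x\<in>C. \<exists>y\<in>C. g x \<noteq> g y)"

text \<open>\<open>nrm (f \<star> w)\<close> is the local action of \<open>f\<close> at \<open>w\<close>: the map of the state that the minimal
  transducer of \<open>f\<close> reaches on reading \<open>w\<close>.\<close>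

definition pre :: "(letter word \<Rightarrow> letter word) \<Rightarrow> letter list" where
  "pre g = (SOME w. greatest_common_prefix w (g ` C))"

definition nrm :: "(letter word \<Rightarrow> letter word) \<Rightarrow> letter word \<Rightarrow> letter word" where
  "nrm g = restrict (\<lambda>x. suffix (length (pre g)) (g x)) C"

lemma inj_on_nc: "inj_on g C \<Longrightarrow> nc g"
proof -
  assume inj: "inj_on g C"
  have "(\<lambda>_::nat. Ltr 0) \<noteq> (\<lambda>_. Ltr 1)" by (auto dest: fun_cong)
  then show "nc g"
    unfolding nc_def using inj const_in_C X_nonempty by (metis inj_on_eq_iff)
qed

lemma pre_gcp: "nc g \<Longrightarrow> greatest_common_prefix (pre g) (g ` C)"
  unfolding pre_def nc_def by (rule someI_ex) (auto intro: greatest_common_prefix_ex)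

lemma pre_eqI:
  assumes "greatest_common_prefix w (g ` C)" shows "pre g = w"
proof -
  have "greatest_common_prefix (pre g) (g ` C)"
    unfolding pre_def using assms by (rule someI)
  then show ?thesis
    using assms C_nonempty by (intro greatest_common_prefix_unique[of _ "g ` C"]) auto
qed

lemma pre_nrm: "nc g \<Longrightarrow> y \<in> C \<Longrightarrow> g y = pre g \<frown> nrm g y"
  using pre_gcp unfolding greatest_common_prefix_def nrm_def
  by (metis imageI is_prefix_conc_iff restrict_apply')

lemma pre_cong: "(\<And>y. y \<in> C \<Longrightarrow> f y = g y) \<Longrightarrow> pre f = pre g"
  unfolding pre_def by (metis image_cong)

lemma nrm_cong: "(\<And>y. y \<in> C \<Longrightarrow> f y = g y) \<Longrightarrow> nrm f = nrm g"
  unfolding nrm_def using pre_cong[of f g] by (auto simp: restrict_def)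

lemma nrm_ext [simp]: "nrm g \<in> extensional C"
  by (simp add: nrm_def)

text \<open>A word put in front of all values is absorbed by the greatest common prefix, so the
  normalized map does not see it.\<close>

lemma pre_nrm_shift:
  assumes t: "nc t" and g: "\<And>y. y \<in> C \<Longrightarrow> g y = a \<frown> t y"
  shows pre_shift: "pre g = a @ pre t" and nrm_shift: "nrm g = nrm t"
proof -
  have gcp: "greatest_common_prefix (pre t) (t ` C)" using pre_gcp t by auto
  show pre: "pre g = a @ pre t"
  proof (rule pre_eqI, unfold greatest_common_prefix_def, intro conjI ballI allI impI)
    fix x assume "x \<in> g ` C"
    then show "is_prefix (a @ pre t) x"
      using gcp g by (auto simp: greatest_common_prefix_def is_prefix_conc_append)
  next
    fix v assume v: "\<forall>x\<in>g ` C. is_prefix v x"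
    show "length v \<le> length (a @ pre t)"
    \<comment> \<open>A common prefix longer than \<open>a\<close> extends \<open>a\<close>, and its
      remainder is a common prefix of the values of \<open>t\<close>.\<close>
    proof (cases "length v \<le> length a")
      case False
      obtain y where y: "y \<in> C" using C_nonempty by auto
      have "is_prefix v (a \<frown> t y)" using v y g by force
      then obtain d where d: "v = a @ d"
        using False is_prefix_cases[of a "a \<frown> t y" v] by auto
      have "is_prefix d (t z)" if "z \<in> C" for z
        using v that g d by (metis imageI is_prefix_conc_append)
      then show ?thesis using gcp d by (auto simp: greatest_common_prefix_def)
    qed auto
  qed
  show "nrm g = nrm t"
    unfolding nrm_def pre by (intro restrict_ext) (simp add: g flip: suffix_suffix)
qed

text \<open>The usual way below to identify two local actions: exhibit one non-constant tail
  \<open>t\<close> that both maps share up to fixed words.\<close>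

lemma nrm_eqI:
  assumes "nc t" "\<And>y. y \<in> C \<Longrightarrow> f y = a \<frown> t y" "\<And>y. y \<in> C \<Longrightarrow> g y = b \<frown> t y"
  shows "nrm f = nrm g"
  using nrm_shift[of t f a] nrm_shift[of t g b] assms by metis

lemma pre_nrm_Nil: "nc g \<Longrightarrow> pre (nrm g) = []" and nc_nrm: "nc g \<Longrightarrow> nc (nrm g)"
proof -
  assume g: "nc g"
  show t: "nc (nrm g)" using g unfolding nc_def by (metis g pre_nrm)
  show "pre (nrm g) = []"
    using pre_shift[OF t, of g "pre g"] pre_nrm[OF g] by auto
qed

text \<open>Stripping the prefix of \<open>g\<close> first changes \<open>g \<star> w\<close> only
  by a fixed word. In terms of transducers: reading on from a state leads to the state of the longer
  word, and the outputs concatenate.\<close>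

lemma nrm_conc:
  assumes "nc g" "nc (g \<star> w)" "w \<in> Xs"
  shows "nrm (\<lambda>y. nrm g (w \<frown> y)) = nrm (g \<star> w)"
    and "pre (g \<star> w) = pre g @ pre (\<lambda>y. nrm g (w \<frown> y))"
    and "nc (\<lambda>y. nrm g (w \<frown> y))"
proof -
  have *: "g (w \<frown> y) = pre g \<frown> nrm g (w \<frown> y)" if "y \<in> C" for y
    using assms that pre_nrm by auto
  show t: "nc (\<lambda>y. nrm g (w \<frown> y))"
    using assms(2) * unfolding nc_def by metis
  show "nrm (\<lambda>y. nrm g (w \<frown> y)) = nrm (g \<star> w)"
    and "pre (g \<star> w) = pre g @ pre (\<lambda>y. nrm g (w \<frown> y))"
    using pre_nrm_shift[OF t *] by auto
qed

lemma inj_on_conc: "inj_on g C \<Longrightarrow> w \<in> Xs \<Longrightarrow> inj_on (g \<star> w) C"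
  unfolding inj_on_def by (metis C_conc_iff same_concat_eq)

lemma inj_on_nrm: "inj_on g C \<Longrightarrow> inj_on (nrm g) C"
  using pre_nrm[OF inj_on_nc] unfolding inj_on_def by metis

text \<open>For synchronizing maps this means that their minimal transducers have the same core.\<close>

definition sim :: "(letter word \<Rightarrow> letter word) \<Rightarrow> (letter word \<Rightarrow> letter word) \<Rightarrow> bool" where
  "sim f g \<longleftrightarrow> (\<exists>K. \<forall>w\<in>Xs. K \<le> length w \<longrightarrow> nrm (f \<star> w) = nrm (g \<star> w))"

lemma sim_refl [simp]: "sim f f"
  by (auto simp: sim_def)

lemma sim_sym: "sim f g \<Longrightarrow> sim g f"
  unfolding sim_def by metis

lemma sim_trans [trans]:
  assumes "sim f g" "sim g h" shows "sim f h"
proof -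
  obtain K K' where
    "\<And>w. w \<in> Xs \<Longrightarrow> K \<le> length w \<Longrightarrow> nrm (f \<star> w) = nrm (g \<star> w)"
    "\<And>w. w \<in> Xs \<Longrightarrow> K' \<le> length w \<Longrightarrow> nrm (g \<star> w) = nrm (h \<star> w)"
    using assms unfolding sim_def by metis
  then show ?thesis unfolding sim_def by (metis max.bounded_iff)
qed

lemma sim_cong_on:
  assumes "\<And>y. y \<in> C \<Longrightarrow> f y = g y" shows "sim f g"
  unfolding sim_def by (intro exI[of _ 0] ballI impI nrm_cong assms) auto

lemma sim_shift:
  assumes "inj_on f C" "\<And>y. y \<in> C \<Longrightarrow> g y = a \<frown> f y" shows "sim g f"
  unfolding sim_def
proof (intro exI[of _ 0] ballI impI)
  fix w assume "w \<in> Xs"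
  then show "nrm (g \<star> w) = nrm (f \<star> w)"
    using assms by (intro nrm_shift[of _ _ a] inj_on_nc inj_on_conc) auto
qed

lemma sim_nrm: "inj_on f C \<Longrightarrow> sim (nrm f) f"
  using sim_shift[of "nrm f" f "pre f"] inj_on_nrm pre_nrm inj_on_nc sim_sym by metis

end

subsection \<open>Equivalence of maps with the same local actions\<close>

text \<open>Continuity in the uniform form, which yields one bound on word lengths for all points;
  \<open>continuous_map_ucont\<close> relates it to the topology by compactness.\<close>

definition ucont :: "letter word set \<Rightarrow> (letter word \<Rightarrow> letter word) \<Rightarrow> bool" where
  "ucont D f \<longleftrightarrow>
     (\<forall>m. \<exists>k. \<forall>x\<in>D. \<forall>y\<in>D. prefix k x = prefix k y \<longrightarrow> prefix m (f x) = prefix m (f y))"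

lemma ucontD:
  assumes "ucont D f"
  obtains k where "\<And>x y. x \<in> D \<Longrightarrow> y \<in> D \<Longrightarrow> prefix k x = prefix k y \<Longrightarrow> prefix m (f x) = prefix m (f y)"
  using assms unfolding ucont_def by metis

lemma ucont_cong: "(\<And>x. x \<in> D \<Longrightarrow> f x = g x) \<Longrightarrow> ucont D f \<longleftrightarrow> ucont D g"
  unfolding ucont_def by simp

lemma ucont_comp:
  assumes "ucont D f" "ucont D' g" "f \<in> D \<rightarrow> D'" shows "ucont D (g \<circ> f)"
  unfolding ucont_def
proof
  fix m
  obtain k where k: "\<And>x y. x \<in> D' \<Longrightarrow> y \<in> D' \<Longrightarrow> prefix k x = prefix k y \<Longrightarrow> prefix m (g x) = prefix m (g y)"
    using ucontD[OF assms(2)] by metis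
  obtain j where j: "\<And>x y. x \<in> D \<Longrightarrow> y \<in> D \<Longrightarrow> prefix j x = prefix j y \<Longrightarrow> prefix k (f x) = prefix k (f y)"
    using ucontD[OF assms(1)] by metis
  show "\<exists>k. \<forall>x\<in>D. \<forall>y\<in>D. prefix k x = prefix k y \<longrightarrow> prefix m ((g \<circ> f) x) = prefix m ((g \<circ> f) y)"
    unfolding comp_def using assms(3) by (intro exI[of _ j] ballI impI k j) auto
qed

lemma ucont_conc: "ucont D (\<lambda>y. w \<frown> y)"
  unfolding ucont_def
proof
  fix m
  have "prefix m (w \<frown> x) = prefix m (w \<frown> y)" if "prefix m x = prefix m y" for x y
  proof (rule prefix_eq_mono)
    show "prefix (length w + m) (w \<frown> x) = prefix (length w + m) (w \<frown> y)"
      using that by (simp add: prefix_conc_snd)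
  qed simp
  then show "\<exists>k. \<forall>x\<in>D. \<forall>y\<in>D. prefix k x = prefix k y \<longrightarrow> prefix m (w \<frown> x) = prefix m (w \<frown> y)"
    by metis
qed

context alphabet
begin

text \<open>All points of the cone of a long word agree on \<open>k\<close> letters, hence their
  values share \<open>m\<close> letters, and the greatest common prefix is at least that
  long.\<close>

lemma ucont_pre_long_D:
  assumes "ucont (D I) f" "inj_on f (D I)"
  obtains k where "0 < k"
    "\<And>w. w \<in> W I \<Longrightarrow> k \<le> length w \<Longrightarrow> m \<le> length (pre (f \<star> w))"
proof -
  obtain k where k: "\<And>x y. x \<in> D I \<Longrightarrow> y \<in> D I \<Longrightarrow> prefix k x = prefix k y \<Longrightarrow> prefix m (f x) = prefix m (f y)"
    using ucontD[OF assms(1)] by metis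
  \<comment> \<open>One letter more than \<open>k\<close>, so that \<open>w\<close> is nonempty and
    its first letter is forced into \<open>I\<close>.\<close>
  have "m \<le> length (pre (f \<star> w))" if w: "w \<in> W I" "Suc k \<le> length w" for w
  proof -
    have wne: "w \<noteq> []" using w by auto
    obtain z where z: "z \<in> C" using C_nonempty by auto
    have "is_prefix (prefix m (f (w \<frown> z))) (f (w \<frown> y))" if "y \<in> C" for y
    proof -
      have "prefix m (f (w \<frown> z)) = prefix m (f (w \<frown> y))"
        using w z that wne by (intro k) (simp_all add: prefix_conc_drop D_conc_iff)
      then show ?thesis by (simp add: is_prefix_def)
    qed
    moreover have "greatest_common_prefix (pre (f \<star> w)) ((f \<star> w) ` C)"
      by (intro pre_gcp inj_on_nc inj_on_D_conc[OF assms(2) w(1) wne])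
    ultimately have "length (prefix m (f (w \<frown> z))) \<le> length (pre (f \<star> w))"
      unfolding greatest_common_prefix_def by blast
    then show ?thesis by simp
  qed
  then show ?thesis using that[of "Suc k"] by blast
qed

lemma ucont_pre_long:
  assumes "ucont C f" "inj_on f C"
  obtains k where "\<And>w. w \<in> Xs \<Longrightarrow> k \<le> length w \<Longrightarrow> m \<le> length (pre (f \<star> w))"
proof (rule ucont_pre_long_D[of X f m])
  fix k assume "\<And>w. w \<in> W X \<Longrightarrow> k \<le> length w \<Longrightarrow> m \<le> length (pre (f \<star> w))"
  then show thesis using that[of k] by simp
qed (use assms in simp_all)

lemma nrm_in_C:
  assumes "nc g" "\<And>y. y \<in> C \<Longrightarrow> g y \<in> C"
  shows "pre g \<in> Xs" "nrm g \<in> C \<rightarrow> C"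
proof -
  have *: "pre g \<frown> nrm g y \<in> C" if "y \<in> C" for y
    using pre_nrm[OF assms(1) that] assms(2)[OF that] by simp
  show "pre g \<in> Xs" using * C_nonempty C_conc_iff by blast
  show "nrm g \<in> C \<rightarrow> C" using * C_conc_iff by blast
qed

text \<open>On a long word the inner map \<open>h\<close> has already emitted a long word
  \<open>v\<close>, and at \<open>v\<close> the maps \<open>f\<close> and \<open>g\<close> have the
  same local action.\<close>

lemma sim_comp_right:
  assumes "sim f g" "inj_on f C" "inj_on g C" "h \<in> C \<rightarrow> C" "inj_on h C" "ucont C h"
  shows "sim (f \<circ> h) (g \<circ> h)"
proof -
  obtain K where K: "\<And>w. w \<in> Xs \<Longrightarrow> K \<le> length w \<Longrightarrow> nrm (f \<star> w) = nrm (g \<star> w)"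
    using assms unfolding sim_def by metis
  obtain k where k: "\<And>w. w \<in> Xs \<Longrightarrow> k \<le> length w \<Longrightarrow> K \<le> length (pre (h \<star> w))"
    using ucont_pre_long assms by metis
  show ?thesis unfolding sim_def comp_def
  proof (intro exI[of _ k] ballI impI)
    fix w assume w: "w \<in> Xs" "k \<le> length w"
    define v where "v = pre (h \<star> w)"
    define s where "s = nrm (h \<star> w)"
    have inj: "inj_on (h \<star> w) C" using assms w by (intro inj_on_conc)
    have h: "h (w \<frown> y) = v \<frown> s y" if "y \<in> C" for y
      using pre_nrm[OF inj_on_nc[OF inj] that] by (simp add: v_def s_def)
    have v: "v \<in> Xs" and s: "s \<in> C \<rightarrow> C"
      unfolding v_def s_def using assms w by (intro nrm_in_C inj_on_nc inj; simp add: Pi_iff)+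
    have sinj: "inj_on s C" unfolding s_def using inj by (rule inj_on_nrm)
    have fi: "inj_on (f \<star> v) C" and gi: "inj_on (g \<star> v) C"
      using assms v by (auto intro: inj_on_conc)
    have eq: "nrm (f \<star> v) = nrm (g \<star> v)"
      using K[OF v] k[OF w] by (simp add: v_def)
    show "nrm (\<lambda>x. f (h (w \<frown> x))) = nrm (\<lambda>x. g (h (w \<frown> x)))"
    proof (rule nrm_eqI)
      show "nc (\<lambda>y. nrm (f \<star> v) (s y))"
        using comp_inj_on[OF sinj inj_on_subset[OF inj_on_nrm[OF fi]]] s
        by (intro inj_on_nc) (auto simp: comp_def)
      show "f (h (w \<frown> y)) = pre (f \<star> v) \<frown> nrm (f \<star> v) (s y)" if "y \<in> C" for y
        using pre_nrm[OF inj_on_nc[OF fi]] s that by (auto simp: h)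
      show "g (h (w \<frown> y)) = pre (g \<star> v) \<frown> nrm (f \<star> v) (s y)" if "y \<in> C" for y
        unfolding eq using pre_nrm[OF inj_on_nc[OF gi]] s that by (auto simp: h)
    qed
  qed
qed

text \<open>The local actions of \<open>f\<close> at long words depend only on a bounded suffix of the word: this is
  the synchronization property, phrased without transducers.\<close>

definition syn :: "(letter word \<Rightarrow> letter word) \<Rightarrow> bool" where
  "syn f \<longleftrightarrow> (\<exists>K. \<forall>v\<in>Xs. \<forall>w\<in>Xs. K \<le> length w \<longrightarrow>
     nrm (f \<star> (v @ w)) = nrm (f \<star> w))"

lemma syn_sim_conc: "syn f \<Longrightarrow> v \<in> Xs \<Longrightarrow> sim (f \<star> v) f"
  unfolding syn_def sim_def conc_conc by blast

lemma syn_sim: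
  assumes "syn f" "sim f g" shows "syn g"
proof -
  obtain K K' where K:
    "\<And>v w. v \<in> Xs \<Longrightarrow> w \<in> Xs \<Longrightarrow> K \<le> length w \<Longrightarrow> nrm (f \<star> (v @ w)) = nrm (f \<star> w)"
    "\<And>w. w \<in> Xs \<Longrightarrow> K' \<le> length w \<Longrightarrow> nrm (f \<star> w) = nrm (g \<star> w)"
    using assms unfolding sim_def syn_def by metis
  show ?thesis unfolding syn_def
  proof (intro exI[of _ "max K K'"] ballI impI)
    fix v w assume "v \<in> Xs" "w \<in> Xs" "max K K' \<le> length w"
    then show "nrm (g \<star> (v @ w)) = nrm (g \<star> w)"
      using K(1)[of v w] K(2)[of w] K(2)[of "v @ w"] by auto
  qed
qed

text \<open>The letters in front of \<open>w\<close> are removed one at a time; as the alphabet is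
  finite, one bound serves for all letters.\<close>

lemma synI:
  assumes "\<And>i. i \<in> X \<Longrightarrow> sim (f \<star> [i]) f" shows "syn f"
proof -
  have "\<forall>i\<in>X. \<exists>K. \<forall>w\<in>Xs. K \<le> length w \<longrightarrow> nrm (\<lambda>y. f ([i] \<frown> w \<frown> y)) = nrm (f \<star> w)"
    using assms unfolding sim_def by auto
  then obtain k where k: "\<And>i w. i \<in> X \<Longrightarrow> w \<in> Xs \<Longrightarrow> k i \<le> length w \<Longrightarrow>
      nrm (\<lambda>y. f ([i] \<frown> w \<frown> y)) = nrm (f \<star> w)"
    by metis
  show ?thesis unfolding syn_def
  proof (intro exI[of _ "Max (k ` X)"] ballI impI)
    fix v w assume v: "v \<in> Xs" and w: "w \<in> Xs" "Max (k ` X) \<le> length w"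
    from v show "nrm (f \<star> (v @ w)) = nrm (f \<star> w)"
    proof (induction v)
      case (Cons i v)
      have "k i \<le> Max (k ` X)" using Cons by (intro Max_ge) auto
      then have "k i \<le> length (v @ w)" using w by simp
      then show ?case using k[of i "v @ w"] Cons w by simp
    qed simp
  qed
qed

text \<open>After \<open>K1\<close> letters \<open>f\<close> and \<open>g\<close> continue with the
  same map \<open>t\<close>, but may have emitted different words \<open>a\<close> and
  \<open>b\<close>. Once \<open>t\<close> has emitted \<open>v\<close> with at least
  \<open>K\<close> letters, the local actions of \<open>h\<close> at \<open>a @ v\<close> and
  \<open>b @ v\<close> agree by synchronization.\<close>

lemma sim_comp_left:
  assumes "sim f g" "f \<in> C \<rightarrow> C" "inj_on f C" "ucont C f" "g \<in> C \<rightarrow> C" "inj_on g C"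
    and h: "inj_on h C" "syn h"
  shows "sim (h \<circ> f) (h \<circ> g)"
proof -
  obtain K1 where K1: "\<And>w. w \<in> Xs \<Longrightarrow> K1 \<le> length w \<Longrightarrow> nrm (f \<star> w) = nrm (g \<star> w)"
    using assms unfolding sim_def by metis
  obtain K where K: "\<And>v w. v \<in> Xs \<Longrightarrow> w \<in> Xs \<Longrightarrow> K \<le> length w \<Longrightarrow> nrm (h \<star> (v @ w)) = nrm (h \<star> w)"
    using h unfolding syn_def by metis
  \<comment> \<open>\<open>A\<close> bounds the output of \<open>f\<close> on the first
    \<open>K1\<close> letters. Asking for \<open>A + K\<close> letters in total therefore leaves at
    least \<open>K\<close> letters for \<open>v\<close>.\<close>
  define A where "A = Max ((\<lambda>w. length (pre (f \<star> w))) ` {w \<in> Xs. length w = K1})"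
  obtain k where k: "\<And>w. w \<in> Xs \<Longrightarrow> k \<le> length w \<Longrightarrow> A + K \<le> length (pre (f \<star> w))"
    using ucont_pre_long assms by metis
  show ?thesis unfolding sim_def comp_def
  proof (intro exI[of _ "max K1 k"] ballI impI)
    fix w assume w: "w \<in> Xs" "max K1 k \<le> length w"
    define w1 w2 where "w1 = take K1 w" and "w2 = drop K1 w"
    have w12: "w = w1 @ w2" "w1 \<in> Xs" "w2 \<in> Xs" "length w1 = K1"
      using w by (auto simp: w1_def w2_def min_def dest: in_set_takeD in_set_dropD)
    define t where "t = nrm (f \<star> w1)"
    have fi: "inj_on (f \<star> w1) C" and gi: "inj_on (g \<star> w1) C"
      using assms w12 by (auto intro: inj_on_conc)
    have gt: "nrm (g \<star> w1) = t" using K1 w12 by (simp add: t_def)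
    define a b where "a = pre (f \<star> w1)" and "b = pre (g \<star> w1)"
    have f_eq: "f (w1 \<frown> y) = a \<frown> t y" and g_eq: "g (w1 \<frown> y) = b \<frown> t y" if "y \<in> C" for y
      using that pre_nrm[OF inj_on_nc[OF fi]] pre_nrm[OF inj_on_nc[OF gi]]
          by (auto simp: t_def a_def b_def gt)
    have ab: "a \<in> Xs" "b \<in> Xs" "t \<in> C \<rightarrow> C"
      unfolding a_def b_def t_def using assms w12 by (intro nrm_in_C inj_on_nc fi gi; simp add: Pi_iff)+
    have tinj: "inj_on (t \<star> w2) C"
      unfolding t_def by (rule inj_on_conc[OF inj_on_nrm[OF fi] w12(3)])
    define v t' where "v = pre (t \<star> w2)" and "t' = nrm (t \<star> w2)"
    have t_eq: "t (w2 \<frown> y) = v \<frown> t' y" if "y \<in> C" for y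
      using that pre_nrm[OF inj_on_nc[OF tinj]] by (auto simp: v_def t'_def)
    have v: "v \<in> Xs" "t' \<in> C \<rightarrow> C"
      unfolding v_def t'_def using w12 ab by (intro nrm_in_C inj_on_nc tinj; simp add: Pi_iff)+
    have "pre (f \<star> w) = a @ v"
      unfolding v_def w12(1)
    proof (rule pre_shift)
      show "nc (t \<star> w2)" using tinj by (rule inj_on_nc)
      show "f ((w1 @ w2) \<frown> y) = a \<frown> t (w2 \<frown> y)" if "y \<in> C" for y
        using f_eq[of "w2 \<frown> y"] that w12 by simp
    qed
    moreover have "length a \<le> A" unfolding A_def a_def
      using finite_Xs_length w12 by (intro Max_ge) auto
    ultimately have lv: "K \<le> length v" using k[of w] w by auto
    define q where "q = nrm (h \<star> v)"
    have ha: "inj_on (h \<star> (a @ v)) C" and hb: "inj_on (h \<star> (b @ v)) C"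
      using h v ab by (auto intro!: inj_on_conc)
    have hv: "inj_on (h \<star> v) C" using h v by (auto intro!: inj_on_conc)
    have q: "nrm (h \<star> (a @ v)) = q" "nrm (h \<star> (b @ v)) = q"
      using K[OF _ v(1) lv] ab by (auto simp: q_def)
    have t'i: "inj_on t' C" unfolding t'_def using tinj by (rule inj_on_nrm)
    show "nrm (\<lambda>x. h (f (w \<frown> x))) = nrm (\<lambda>x. h (g (w \<frown> x)))"
    proof (rule nrm_eqI)
      show "nc (\<lambda>y. q (t' y))"
        using comp_inj_on[OF t'i inj_on_subset[OF inj_on_nrm[OF hv]]] v
        by (intro inj_on_nc) (auto simp: comp_def q_def)
      show "h (f (w \<frown> y)) = pre (h \<star> (a @ v)) \<frown> q (t' y)" if "y \<in> C" for y
        using pre_nrm[OF inj_on_nc[OF ha], of "t' y"] v(2) that f_eq[of "w2 \<frown> y"] t_eq[of y] w12 q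
        by (auto simp: Pi_iff)
      show "h (g (w \<frown> y)) = pre (h \<star> (b @ v)) \<frown> q (t' y)" if "y \<in> C" for y
        using pre_nrm[OF inj_on_nc[OF hb], of "t' y"] v(2) that g_eq[of "w2 \<frown> y"] t_eq[of y] w12 q
        by (auto simp: Pi_iff)
    qed
  qed
qed

section \<open>Clopen sets and embeddings with clopen images\<close>

text \<open>\<open>lev k A\<close>: the set \<open>A\<close> is a union of cones \<open>u \<frown> C\<close> with \<open>length u = k\<close>.\<close>

definition lev :: "nat \<Rightarrow> letter word set \<Rightarrow> bool" where
  "lev k A \<longleftrightarrow> (\<forall>x\<in>A. suffix k x \<in> C \<and> (\<forall>y\<in>C. prefix k x \<frown> y \<in> A))"

text \<open>For subsets of \<open>C\<close> these are the clopen sets; the level is recorded because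
  the cones are to be counted.\<close>

definition clp :: "letter word set \<Rightarrow> bool" where
  "clp A \<longleftrightarrow> (\<exists>k. lev k A)"

lemma lev_mono:
  assumes "lev k A" "k \<le> j" shows "lev j A"
  unfolding lev_def
proof (intro ballI conjI)
  fix x assume x: "x \<in> A"
  have "suffix k x \<in> C" using assms x unfolding lev_def by blast
  then show "suffix j x \<in> C" using suffix_in_C[of "suffix k x" "j - k"] assms by simp
  fix y assume y: "y \<in> C"
  have "subsequence x k j \<frown> y \<in> C"
    using subsequence_in_Xs[OF \<open>suffix k x \<in> C\<close>, of 0 "j - k"] assms y by simp
  then have "prefix k x \<frown> (subsequence x k j \<frown> y) \<in> A"
    using assms x unfolding lev_def by blast
  moreover have "prefix j x = prefix k x @ subsequence x k j"
    using assms subsequence_append[of x k "j - k"] by simp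
  ultimately show "prefix j x \<frown> y \<in> A" by simp
qed

lemma lev_UN: "(\<And>i. i \<in> I \<Longrightarrow> lev k (A i)) \<Longrightarrow> lev k (\<Union>i\<in>I. A i)"
  unfolding lev_def by blast

lemma clp_common_level:
  assumes "finite I" "\<And>i. i \<in> I \<Longrightarrow> clp (A i)"
  obtains k where "\<And>i. i \<in> I \<Longrightarrow> lev k (A i)" "k \<ge> m"
proof -
  obtain l where l: "\<And>i. i \<in> I \<Longrightarrow> lev (l i) (A i)" using assms unfolding clp_def by metis
  have "lev (max m (Max (l ` I))) (A i)" if "i \<in> I" for i
    using l[OF that] by (rule lev_mono) (simp add: assms that le_max_iff_disj)
  then show ?thesis using that max.cobounded1 by blast
qed

lemma clp_UN:
  assumes "finite I" "\<And>i. i \<in> I \<Longrightarrow> clp (A i)"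
  shows "clp (\<Union>i\<in>I. A i)"
proof -
  obtain k where "\<And>i. i \<in> I \<Longrightarrow> lev k (A i)" using clp_common_level[of I A 0] assms by metis
  then show ?thesis using lev_UN unfolding clp_def by blast
qed

lemma lev_conc: "lev (length w + k) ((\<lambda>y. w \<frown> y) ` A) \<longleftrightarrow> lev k A"
  unfolding lev_def
  by (auto simp: image_iff simp flip: conc_conc)

lemma clp_conc: "clp ((\<lambda>y. w \<frown> y) ` A) \<longleftrightarrow> clp A"
  unfolding clp_def by (metis lev_conc lev_mono le_add2)

lemma lev_C: "lev 0 C"
  by (auto simp: lev_def)

lemma lev_decomp: "lev k A \<Longrightarrow> A = (\<Union>u\<in>prefix k ` A. (\<lambda>y. u \<frown> y) ` C)"
  unfolding lev_def
proof safe
  fix x assume *: "\<forall>x\<in>A. suffix k x \<in> C \<and> (\<forall>y\<in>C. prefix k x \<frown> y \<in> A)" "x \<in> A"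
  have "x \<in> (\<lambda>y. prefix k x \<frown> y) ` C"
    using * prefix_suffix[of x k] by (intro image_eqI[of _ _ "suffix k x"]) auto
  then show "x \<in> (\<Union>u\<in>prefix k ` A. (\<frown>) u ` C)" using * by blast
qed auto

lemma C_decomp: "C = (\<Union>u\<in>{w \<in> Xs. length w = k}. (\<lambda>y. u \<frown> y) ` C)"
proof safe
  fix x assume "x \<in> C"
  then have "x \<in> (\<lambda>y. prefix k x \<frown> y) ` C"
    using prefix_suffix[of x k] by (intro image_eqI[of _ _ "suffix k x"]) auto
  moreover have "prefix k x \<in> {w \<in> Xs. length w = k}" using \<open>x \<in> C\<close> by simp
  ultimately show "x \<in> (\<Union>u\<in>{w \<in> Xs. length w = k}. (\<frown>) u ` C)" by blast
qed auto

text \<open>What survives of a homeomorphism after restriction to a cone and removal of a prefix: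
  surjectivity may be lost, but images of cones can still be counted.\<close>

definition emb :: "(letter word \<Rightarrow> letter word) \<Rightarrow> bool" where
  "emb f \<longleftrightarrow> inj_on f C \<and> ucont C f \<and> (\<forall>w\<in>Xs. clp ((f \<star> w) ` C))"

lemma embD:
  assumes "emb f"
  shows "inj_on f C" "ucont C f" "nc f" "w \<in> Xs \<Longrightarrow> clp ((f \<star> w) ` C)" "clp (f ` C)"
  using assms inj_on_nc unfolding emb_def by (auto dest: bspec[of _ _ "[]"])

lemma emb_conc:
  assumes "emb f" "w \<in> Xs" shows "emb (f \<star> w)"
proof -
  have "ucont C (f \<circ> (\<lambda>y. w \<frown> y))"
    using assms by (intro ucont_comp[where D' = C] ucont_conc) (auto simp: emb_def)
  then show ?thesis
    using assms inj_on_conc[of f w] unfolding emb_def comp_def by simp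
qed

lemma ucont_unshift:
  assumes g: "ucont C g" and eq: "\<And>y. y \<in> C \<Longrightarrow> g y = a \<frown> f y"
  shows "ucont C f"
  unfolding ucont_def
proof
  fix m
  obtain k where k: "\<And>x y. x \<in> C \<Longrightarrow> y \<in> C \<Longrightarrow> prefix k x = prefix k y \<Longrightarrow>
      prefix (length a + m) (g x) = prefix (length a + m) (g y)"
    using ucontD g by metis
  show "\<exists>k. \<forall>x\<in>C. \<forall>y\<in>C. prefix k x = prefix k y \<longrightarrow> prefix m (f x) = prefix m (f y)"
  proof (intro exI[of _ k] ballI impI)
    fix x y assume "x \<in> C" "y \<in> C" "prefix k x = prefix k y"
    then have "drop (length a) (prefix (length a + m) (a \<frown> f x)) = drop (length a) (prefix
        (length a + m) (a \<frown> f y))"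
      using k eq by metis
    then show "prefix m (f x) = prefix m (f y)" by simp
  qed
qed

lemma emb_unshift:
  assumes g: "emb g" and eq: "\<And>y. y \<in> C \<Longrightarrow> g y = a \<frown> f y" shows "emb f"
  unfolding emb_def
proof (intro conjI ballI)
  show "inj_on f C" using embD(1)[OF g] eq unfolding inj_on_def by metis
  show "ucont C f" using ucont_unshift[OF embD(2)[OF g] eq] .
  fix w assume w: "w \<in> Xs"
  have "(g \<star> w) ` C = (\<lambda>y. a \<frown> y) ` (f \<star> w) ` C"
    using w eq by (auto simp: image_image)
  then show "clp ((f \<star> w) ` C)" using embD(4)[OF g w] clp_conc by metis
qed

lemma emb_nrm: "emb f \<Longrightarrow> emb (nrm f)"
  by (rule emb_unshift[of f "pre f"]) (auto simp only: intro: pre_nrm embD(3))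

text \<open>\<open>f\<close> maps a cone onto finitely many cones, and \<open>g\<close> maps each of
  these onto a clopen set.\<close>

lemma emb_comp:
  assumes "emb f" "emb g" "f \<in> C \<rightarrow> C" shows "emb (g \<circ> f)"
  unfolding emb_def
proof (intro conjI ballI)
  show "inj_on (g \<circ> f) C"
    by (rule comp_inj_on[OF embD(1)[OF assms(1)] inj_on_subset[OF embD(1)[OF assms(2)]]])
        (use assms in auto)
  show "ucont C (g \<circ> f)"
    using assms by (intro ucont_comp[where D' = C]) (auto simp: emb_def)
  fix w assume w: "w \<in> Xs"
  define A where "A = (f \<star> w) ` C"
  obtain k where k: "lev k A" using embD(4)[OF assms(1) w] by (auto simp: A_def clp_def)
  have AC: "A \<subseteq> C" using assms w by (auto simp: A_def)
  have "(\<lambda>y. (g \<circ> f) (w \<frown> y)) ` C = g ` A" by (auto simp: A_def)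
  also have "\<dots> = (\<Union>u\<in>prefix k ` A. (g \<star> u) ` C)"
    by (subst lev_decomp[OF k]) (auto simp: image_UN image_image)
  also have "clp \<dots>"
  proof (rule clp_UN)
    have P: "prefix k ` A \<subseteq> {u \<in> Xs. length u = k}" using AC prefix_in_Xs by fastforce
    then show "finite (prefix k ` A)" using finite_Xs_length finite_subset by blast
    show "clp ((g \<star> u) ` C)" if "u \<in> prefix k ` A" for u
      using that AC assms prefix_in_Xs by (intro embD(4)) blast+
  qed
  finally show "clp ((\<lambda>y. (g \<circ> f) (w \<frown> y)) ` C)" .
qed

text \<open>These maps form a monoid (\<open>N_comp\<close>) on which \<open>sim\<close> is a
  congruence (\<open>N_comp_sim\<close>); \<open>U\<close> below selects the elements that are
  invertible modulo \<open>sim\<close>.\<close>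

definition N :: "(letter word \<Rightarrow> letter word) \<Rightarrow> bool" where
  "N f \<longleftrightarrow> f \<in> C \<rightarrow> C \<and> emb f \<and> syn f"

lemma ND:
  assumes "N f"
  shows "f \<in> C \<rightarrow> C" "emb f" "syn f" "inj_on f C" "ucont C f" "nc f"
  using assms embD unfolding N_def by blast+

lemma N_comp_sim_left: "N f \<Longrightarrow> N g \<Longrightarrow> N h \<Longrightarrow> sim f g \<Longrightarrow> sim (h \<circ> f) (h \<circ> g)"
  by (rule sim_comp_left) (simp_all add: ND)

lemma N_comp_sim_right: "N f \<Longrightarrow> N g \<Longrightarrow> N h \<Longrightarrow> sim f g \<Longrightarrow> sim (f \<circ> h) (g \<circ> h)"
  by (rule sim_comp_right) (simp_all add: ND)

lemma N_conc: "N f \<Longrightarrow> w \<in> Xs \<Longrightarrow> N (f \<star> w)"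
  unfolding N_def
  by (auto simp: Pi_iff intro: emb_conc syn_sim[OF _ sim_sym[OF syn_sim_conc]])

lemma N_nrm: "N f \<Longrightarrow> N (nrm f)"
  unfolding N_def using emb_nrm sim_nrm syn_sim sim_sym embD(1,3) nrm_in_C(2) by (metis Pi_iff)

text \<open>Synchronization of the composite is an instance of the congruence property:
  \<open>f \<star> [i]\<close> is equivalent to \<open>f\<close>, and this stays true after applying
  \<open>g\<close>.\<close>

lemma N_comp: "N f \<Longrightarrow> N g \<Longrightarrow> N (g \<circ> f)"
proof -
  assume f: "N f" and g: "N g"
  have "syn (g \<circ> f)"
  proof (rule synI)
    fix i assume i: "i \<in> X"
    have "sim (g \<circ> (f \<star> [i])) (g \<circ> f)"
      using i f g by (intro N_comp_sim_left N_conc syn_sim_conc ND) auto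
    then show "sim (\<lambda>y. (g \<circ> f) ([i] \<frown> y)) (g \<circ> f)" by (simp add: comp_def)
  qed
  then show ?thesis using f g emb_comp unfolding N_def by (auto simp: Pi_iff)
qed

lemma N_comp_sim:
  assumes "N f" "N f'" "N g" "N g'" "sim f f'" "sim g g'"
  shows "sim (g \<circ> f) (g' \<circ> f')"
  using N_comp_sim_left[of f f' g] N_comp_sim_right[of g g' f'] sim_trans assms by blast

lemma N_id: "N id"
proof -
  have "ucont C id" by (auto simp: ucont_def)
  moreover have "clp ((\<lambda>y. w \<frown> y) ` C)" for w using clp_conc lev_C clp_def by blast
  moreover have "syn id"
    by (rule synI) (simp add: sim_shift[of _ _ "[_]"])
  ultimately show ?thesis by (auto simp: N_def emb_def)
qed

definition U :: "(letter word \<Rightarrow> letter word) \<Rightarrow> bool" where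
  "U f \<longleftrightarrow> N f \<and> (\<exists>g. N g \<and> sim (f \<circ> g) id \<and> sim (g \<circ> f) id)"

lemma U_id: "U id"
  unfolding U_def using N_id by (metis comp_id sim_refl)

lemma U_comp: assumes "U f" "U g" shows "U (g \<circ> f)"
proof -
  obtain f' where f: "N f" "N f'" "sim (f \<circ> f') id" "sim (f' \<circ> f) id" using assms by (auto simp: U_def)
  obtain g' where g: "N g" "N g'" "sim (g \<circ> g') id" "sim (g' \<circ> g) id" using assms by (auto simp: U_def)
  have "sim (g \<circ> (f \<circ> f') \<circ> g') (g \<circ> id \<circ> g')"
    using f g by (intro N_comp_sim_right N_comp_sim_left N_comp N_id) auto
  moreover have "sim (f' \<circ> (g' \<circ> g) \<circ> f) (f' \<circ> id \<circ> f)"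
    using f g by (intro N_comp_sim_right N_comp_sim_left N_comp N_id) auto
  ultimately have "sim ((g \<circ> f) \<circ> (f' \<circ> g')) id" "sim ((f' \<circ> g') \<circ> (g \<circ> f)) id"
    using f g sim_trans by (auto simp: comp_assoc)
  then show ?thesis unfolding U_def using f g N_comp by blast
qed

lemma U_inverse: "U f \<Longrightarrow> \<exists>g. U g \<and> sim (f \<circ> g) id \<and> sim (g \<circ> f) id"
  unfolding U_def by blast

subsection \<open>Masses of clopen sets\<close>

lemma Xs_split:
  assumes "w \<in> Xs" "K \<le> length w"
  obtains u v where "w = u @ v" "u \<in> Xs" "v \<in> Xs" "length v = K"
proof
  show "w = take (length w - K) w @ drop (length w - K) w" by simp
  show "take (length w - K) w \<in> Xs" "drop (length w - K) w \<in> Xs"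
    using assms by (auto dest: in_set_takeD in_set_dropD)
  show "length (drop (length w - K) w) = K" using assms by simp
qed

lemma cones_disjoint:
  assumes "inj_on f C" "v \<in> Xs" "w \<in> Xs" "length v = length w" "v \<noteq> w"
  shows "(f \<star> v) ` C \<inter> (f \<star> w) ` C = {}"
proof -
  have False if xy: "x \<in> C" "y \<in> C" and eq: "f (v \<frown> x) = f (w \<frown> y)" for x y
  proof -
    have "v \<frown> x = w \<frown> y"
      using inj_on_eq_iff[OF assms(1), of "v \<frown> x" "w \<frown> y"] eq xy assms by simp
    then show False using assms conc_inject by blast
  qed
  then show ?thesis by blast
qed

text \<open>Each cone of length \<open>k\<close> inside \<open>A\<close> splits into its
  \<open>n\<close> subcones.\<close>

lemma card_prefix_step:
  assumes "lev k A"
  shows "card (prefix (Suc k) ` A) = n * card (prefix k ` A)"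
proof -
  have "bij_betw (\<lambda>(u, i). u @ [i]) (prefix k ` A \<times> X) (prefix (Suc k) ` A)"
  proof (intro bij_betwI' ballI)
    fix p assume "p \<in> prefix k ` A \<times> X"
    then obtain x i where p: "p = (prefix k x, i)" "x \<in> A" "i \<in> X" by auto
    obtain y where y: "y \<in> C" using C_nonempty by auto
    have "prefix k x \<frown> ([i] \<frown> y) \<in> A"
      using assms p y C_conc_iff[of "[i]" y] unfolding lev_def
      by (metis Cons_in_lists_iff lists.Nil)
    moreover have "prefix (Suc k) (prefix k x \<frown> ([i] \<frown> y)) = prefix k x @ [i]"
      using prefix_conc_length[of "prefix k x @ [i]" y] by (simp del: subseq_to_Suc)
    ultimately show "(case p of (u, i) \<Rightarrow> u @ [i]) \<in> prefix (Suc k) ` A"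
      unfolding p prod.case by (intro image_eqI[OF sym])
  next
    fix v assume "v \<in> prefix (Suc k) ` A"
    then obtain x where x: "x \<in> A" "v = prefix (Suc k) x" by auto
    then have "suffix k x \<in> C" using assms by (simp add: lev_def)
    then have "x k \<in> X" by (auto simp: C_def dest: spec[of _ 0])
    then show "\<exists>p\<in>prefix k ` A \<times> X. v = (case p of (u, i) \<Rightarrow> u @ [i])"
      using x by (intro bexI[of _ "(prefix k x, x k)"]) auto
  qed (auto split: prod.splits)
  from bij_betw_same_card[OF this] show ?thesis
    by (simp add: card_cartesian_product mult.commute del: subseq_to_Suc)
qed

lemma n_cong_1: "[n = 1] (mod (n - 1))"
  using two_le by (metis cong_add_rcancel_0_nat cong_def le_add_diff_inverse2 mod_add_self1
      one_le_numeral order_trans)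

lemma cong_card_prefix:
  assumes "lev k A" "k \<le> j"
  shows "[card (prefix j ` A) = card (prefix k ` A)] (mod (n - 1))"
  using assms(2)
proof (induction j rule: dec_induct)
  case (step j)
  have "card (prefix (Suc j) ` A) = n * card (prefix j ` A)"
    using step assms lev_mono by (intro card_prefix_step) auto
  also have "[n * card (prefix j ` A) = 1 * card (prefix j ` A)] (mod (n - 1))"
    using n_cong_1 by (rule cong_scalar_right)
  finally show ?case using step.IH cong_trans by simp
qed simp

text \<open>The choice of the least level is only a convention: by \<open>mass_cong\<close> every
  level of \<open>A\<close> gives the same residue.\<close>

definition mass :: "letter word set \<Rightarrow> nat" where
  "mass A = card (prefix (LEAST k. lev k A) ` A) mod (n - 1)"

lemma mass_cong: "lev k A \<Longrightarrow> [mass A = card (prefix k ` A)] (mod (n - 1))"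
  using cong_card_prefix[of "LEAST k. lev k A" A k] LeastI[of "\<lambda>k. lev k A" k] Least_le[of "\<lambda>k. lev k
      A" k]
  unfolding mass_def by (simp add: cong_def)

lemma mass_conc:
  assumes "clp A" shows "[mass ((\<lambda>y. w \<frown> y) ` A) = mass A] (mod (n - 1))"
proof -
  obtain k where k: "lev k A" using assms by (auto simp: clp_def)
  have "prefix (length w + k) ` (\<lambda>y. w \<frown> y) ` A = (\<lambda>u. w @ u) ` prefix k ` A"
    by (auto simp: image_image)
  then have "card (prefix (length w + k) ` (\<lambda>y. w \<frown> y) ` A) = card (prefix k ` A)"
    by (simp add: card_image inj_on_def)
  moreover have "lev (length w + k) ((\<lambda>y. w \<frown> y) ` A)" using k lev_conc by simp
  ultimately have "[mass ((\<lambda>y. w \<frown> y) ` A) = card (prefix k ` A)] (mod (n - 1))"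
    using mass_cong by fastforce
  then show ?thesis using mass_cong[OF k] by (rule cong_trans[OF _ cong_sym])
qed

text \<open>At a common level disjoint sets have disjoint sets of prefixes, because a shared prefix
  would put a whole cone into both. Finiteness of the prefix sets is a separate hypothesis, as the
  sets may contain dotted words and so need not lie in \<open>C\<close>.\<close>

lemma mass_UN:
  assumes "finite I" "\<And>i. i \<in> I \<Longrightarrow> clp (A i)" "\<And>i j. i \<in> I \<Longrightarrow> j \<in> I \<Longrightarrow> i \<noteq> j \<Longrightarrow> A i \<inter> A j = {}"
    and fin: "\<And>i k. i \<in> I \<Longrightarrow> finite (prefix k ` A i)"
  shows "[mass (\<Union>i\<in>I. A i) = (\<Sum>i\<in>I. mass (A i))] (mod (n - 1))"
proof -
  obtain k where k: "\<And>i. i \<in> I \<Longrightarrow> lev k (A i)" using clp_common_level[of I A 0] assms by metis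
  have disj: "prefix k ` A i \<inter> prefix k ` A j = {}" if ij: "i \<in> I" "j \<in> I" "i \<noteq> j" for i j
  proof (rule ccontr)
    assume "prefix k ` A i \<inter> prefix k ` A j \<noteq> {}"
    then obtain x y where xy: "x \<in> A i" "y \<in> A j" "prefix k x = prefix k y" by auto
    have "suffix k y \<in> C" using k[OF ij(2)] xy(2) by (simp add: lev_def)
    then have "prefix k x \<frown> suffix k y \<in> A i" using k[OF ij(1)] xy(1) unfolding lev_def by blast
    then have "prefix k y \<frown> suffix k y \<in> A i" unfolding xy(3) .
    then have "y \<in> A i" by simp
    then show False using xy assms(3)[OF ij] by auto
  qed
  have "[mass (\<Union>i\<in>I. A i) = card (prefix k ` (\<Union>i\<in>I. A i))] (mod (n - 1))"
    using k by (intro mass_cong lev_UN)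
  also have "card (prefix k ` (\<Union>i\<in>I. A i)) = (\<Sum>i\<in>I. card (prefix k ` A i))"
    unfolding image_UN using assms disj fin by (intro card_UN_disjoint) auto
  also have "[(\<Sum>i\<in>I. card (prefix k ` A i)) = (\<Sum>i\<in>I. mass (A i))] (mod (n - 1))"
    using k by (intro cong_sum cong_sym[OF mass_cong])
  finally show ?thesis .
qed

lemma finite_prefix_image: "A \<subseteq> C \<Longrightarrow> finite (prefix k ` A)"
proof -
  assume "A \<subseteq> C"
  then have "prefix k ` A \<subseteq> {u \<in> Xs. length u = k}" using prefix_in_Xs by fastforce
  then show ?thesis using finite_Xs_length finite_subset by blast
qed

text \<open>By uniform continuity the prefix of a value depends only on a prefix of bounded length
  of the argument, and of those there are finitely many.\<close>

lemma finite_prefix_emb: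
  assumes "emb f" shows "finite (prefix k ` f ` C)"
proof -
  obtain j where j: "\<And>x y. x \<in> C \<Longrightarrow> y \<in> C \<Longrightarrow> prefix j x = prefix j y \<Longrightarrow> prefix k (f x) = prefix k (f y)"
    using ucontD embD(2)[OF assms] by metis
  obtain z where z: "z \<in> C" using C_nonempty by auto
  have "prefix k ` f ` C \<subseteq> (\<lambda>u. prefix k (f (u \<frown> z))) ` prefix j ` C"
  proof
    fix u assume "u \<in> prefix k ` f ` C"
    then obtain x where u: "u = prefix k (f x)" and x: "x \<in> C" by blast
    have "prefix k (f x) = prefix k (f (prefix j x \<frown> z))"
      using x z by (intro j) (auto simp: prefix_conc_drop)
    then show "u \<in> (\<lambda>u. prefix k (f (u \<frown> z))) ` prefix j ` C"
      unfolding u using x by (intro image_eqI[of _ _ "prefix j x"] imageI)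
  qed
  then show ?thesis by (rule finite_subset) (intro finite_imageI finite_prefix_image order_refl)
qed

lemma mass_split:
  assumes "emb f"
  shows "[mass (f ` C) = (\<Sum>w\<in>{w \<in> Xs. length w = k}. mass ((f \<star> w) ` C))] (mod (n - 1))"
proof -
  have "f ` C = (\<Union>w\<in>{w \<in> Xs. length w = k}. (f \<star> w) ` C)"
    by (subst C_decomp[of k]) (auto simp: image_UN image_image)
  moreover have "[mass (\<Union>w\<in>{w \<in> Xs. length w = k}. (f \<star> w) ` C) =
      (\<Sum>w\<in>{w \<in> Xs. length w = k}. mass ((f \<star> w) ` C))] (mod (n - 1))"
  proof (rule mass_UN[OF finite_Xs_length])
    show "clp ((f \<star> w) ` C)" if "w \<in> {w \<in> Xs. length w = k}" for w
      using embD(4)[OF assms] that by blast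
    show "finite (prefix j ` (f \<star> w) ` C)" if "w \<in> {w \<in> Xs. length w = k}" for w j
      using emb_conc[OF assms] finite_prefix_emb that by blast
    fix v w assume vw: "v \<in> {w \<in> Xs. length w = k}" "w \<in> {w \<in> Xs. length w = k}" "v \<noteq> w"
    from vw show "(f \<star> v) ` C \<inter> (f \<star> w) ` C = {}"
      by (intro cones_disjoint embD(1)[OF assms]) simp_all
  qed
  ultimately show ?thesis by simp
qed

lemma mass_nrm:
  assumes "emb f" shows "[mass (f ` C) = mass (nrm f ` C)] (mod (n - 1))"
proof -
  have "f ` C = (\<lambda>y. pre f \<frown> y) ` nrm f ` C"
    unfolding image_image by (intro image_cong refl pre_nrm embD(3)[OF assms])
  then show ?thesis using mass_conc[of "nrm f ` C" "pre f"] embD(5)[OF emb_nrm[OF assms]] by simp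
qed

text \<open>Cut \<open>C\<close> into the cones of length \<open>K\<close>. On each of them
  \<open>f\<close> and \<open>g\<close> have images that differ only by a fixed word in front, which
  \<open>mass_conc\<close> ignores.\<close>

lemma mass_sim:
  assumes "emb f" "emb g" "sim f g" shows "[mass (f ` C) = mass (g ` C)] (mod (n - 1))"
proof -
  obtain K where K: "\<And>w. w \<in> Xs \<Longrightarrow> K \<le> length w \<Longrightarrow> nrm (f \<star> w) = nrm (g \<star> w)"
    using assms unfolding sim_def by metis
  have eq: "[mass ((f \<star> w) ` C) = mass ((g \<star> w) ` C)] (mod (n - 1))"
    if "w \<in> {w \<in> Xs. length w = K}" for w
  proof -
    have w: "w \<in> Xs" "nrm (f \<star> w) = nrm (g \<star> w)" using that K[of w] by auto
    have "[mass ((f \<star> w) ` C) = mass (nrm (g \<star> w) ` C)] (mod (n - 1))"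
      using mass_nrm[OF emb_conc[OF assms(1) w(1)]] w(2) by simp
    moreover have "[mass ((g \<star> w) ` C) = mass (nrm (g \<star> w) ` C)] (mod (n - 1))"
      using emb_conc[OF assms(2) w(1)] by (rule mass_nrm)
    ultimately show ?thesis by (rule cong_trans[OF _ cong_sym])
  qed
  note mass_split[OF assms(1), of K]
  also have "[(\<Sum>w\<in>{w \<in> Xs. length w = K}. mass ((f \<star> w) ` C)) =
      (\<Sum>w\<in>{w \<in> Xs. length w = K}. mass ((g \<star> w) ` C))] (mod (n - 1))"
    using eq by (rule cong_sum)
  also have "[(\<Sum>w\<in>{w \<in> Xs. length w = K}. mass ((g \<star> w) ` C)) = mass (g ` C)] (mod (n - 1))"
    using mass_split[OF assms(2), of K] by (rule cong_sym)
  finally show ?thesis .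
qed

definition mult_const :: "(letter word \<Rightarrow> letter word) \<Rightarrow> nat" where
  "mult_const f = mass (f ` C)"

lemma mult_const_sim: "N f \<Longrightarrow> N g \<Longrightarrow> sim f g \<Longrightarrow> [mult_const f = mult_const g] (mod (n - 1))"
  unfolding mult_const_def by (rule mass_sim) (simp_all add: ND)

lemma mult_const_id: "[mult_const id = 1] (mod (n - 1))"
  using mass_cong[OF lev_C] C_nonempty by (simp add: mult_const_def image_constant_conv)

text \<open>A clopen set made of \<open>p\<close> cones is mapped by \<open>g\<close> onto \<open>p\<close> sets whose masses all equal that of
  \<open>g ` C\<close>, because the restrictions of \<open>g\<close> to cones are all equivalent to \<open>g\<close>.\<close>

lemma mult_const_comp:
  assumes f: "N f" and g: "N g"
  shows "[mult_const (g \<circ> f) = mult_const f * mult_const g] (mod (n - 1))"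
proof -
  define A where "A = f ` C"
  obtain k where k: "lev k A" using embD(5)[OF ND(2)[OF f]] by (auto simp: A_def clp_def)
  have AC: "A \<subseteq> C" using ND(1)[OF f] by (auto simp: A_def)
  have "(g \<circ> f) ` C = (\<Union>u\<in>prefix k ` A. (g \<star> u) ` C)"
    unfolding image_comp[symmetric] A_def[symmetric]
    by (subst lev_decomp[OF k]) (auto simp: image_UN image_image)
  moreover have "[mass (\<Union>u\<in>prefix k ` A. (g \<star> u) ` C) =
      (\<Sum>u\<in>prefix k ` A. mass ((g \<star> u) ` C))] (mod (n - 1))"
  proof (rule mass_UN[OF finite_prefix_image[OF AC]])
    fix u assume u: "u \<in> prefix k ` A"
    then have uX: "u \<in> Xs" using AC prefix_in_Xs by blast
    show "clp ((g \<star> u) ` C)" using embD(4) ND(2)[OF g] uX by blast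
    show "finite (prefix j ` (g \<star> u) ` C)" for j
      using finite_prefix_emb emb_conc ND(2)[OF g] uX by blast
    fix v assume v: "v \<in> prefix k ` A" "u \<noteq> v"
    have vX: "v \<in> Xs" using v AC prefix_in_Xs by blast
    from u v uX vX show "(g \<star> u) ` C \<inter> (g \<star> v) ` C = {}"
      by (intro cones_disjoint ND(4)[OF g]) auto
  qed
  ultimately have "[mult_const (g \<circ> f) = (\<Sum>u\<in>prefix k ` A. mass ((g \<star> u) ` C))] (mod (n - 1))"
    by (simp add: mult_const_def)
  also have "[(\<Sum>u\<in>prefix k ` A. mass ((g \<star> u) ` C)) = (\<Sum>u\<in>prefix k ` A. mult_const g)] (mod (n - 1))"
  proof (rule cong_sum)
    fix u assume u: "u \<in> prefix k ` A"
    then have uX: "u \<in> Xs" using AC prefix_in_Xs by blast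
    show "[mass ((g \<star> u) ` C) = mult_const g] (mod (n - 1))"
      using mult_const_sim[OF N_conc[OF g uX] g syn_sim_conc[OF ND(3)[OF g] uX]]
      by (simp add: mult_const_def)
  qed
  also have "(\<Sum>u\<in>prefix k ` A. mult_const g) = card (prefix k ` A) * mult_const g" by simp
  also have "[card (prefix k ` A) * mult_const g = mult_const f * mult_const g] (mod (n - 1))"
    using mass_cong[OF k] unfolding A_def mult_const_def
    by (intro cong_scalar_right) (rule cong_sym)
  finally show ?thesis .
qed

section \<open>The states of the core, as maps\<close>

text \<open>The maps induced by the states of the core of \<open>f\<close>.\<close>

definition Q :: "(letter word \<Rightarrow> letter word) \<Rightarrow> (letter word \<Rightarrow> letter word) set" where
  "Q f = {q. \<forall>K. \<exists>w\<in>Xs. K \<le> length w \<and> q = nrm (f \<star> w)}"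

lemma Q_sim: assumes "sim f g" shows "Q f = Q g"
proof -
  have "Q f \<subseteq> Q g" if fg: "sim f g" for f g
  proof
    fix q assume q: "q \<in> Q f"
    obtain K where K: "\<And>w. w \<in> Xs \<Longrightarrow> K \<le> length w \<Longrightarrow> nrm (f \<star> w) = nrm (g \<star> w)"
      using fg unfolding sim_def by metis
    show "q \<in> Q g" unfolding Q_def
    proof (intro CollectI allI)
      fix K'
      obtain w where "w \<in> Xs" "max K K' \<le> length w" "q = nrm (f \<star> w)"
        using q unfolding Q_def by blast
      then show "\<exists>w\<in>Xs. K' \<le> length w \<and> q = nrm (g \<star> w)"
        using K[of w] by auto
    qed
  qed
  then show ?thesis using assms sim_sym by blast
qed

text \<open>Every state of the core of \<open>f\<close> is thus equivalent to \<open>f\<close> and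
  may replace it in computations modulo \<open>sim\<close>.\<close>

lemma Q_cases:
  assumes "N f" "q \<in> Q f" shows "N q" "sim q f" "q \<in> extensional C" "pre q = []"
proof -
  obtain w where w: "w \<in> Xs" "q = nrm (f \<star> w)" using assms unfolding Q_def by blast
  show "N q" unfolding w(2) using assms w by (intro N_nrm N_conc)
  show "sim q f" unfolding w(2)
    using sim_trans[OF sim_nrm syn_sim_conc[OF _ w(1)],
        of f] ND[OF assms(1)] ND(4)[OF N_conc[OF assms(1) w(1)]] by blast
  show "q \<in> extensional C" by (simp add: w)
  show "pre q = []" unfolding w(2) by (rule pre_nrm_Nil[OF ND(6)[OF N_conc[OF assms(1) w(1)]]])
qed

text \<open>By synchronization the local action at a word of length \<open>K\<close> recurs at the
  longer words that end in it.\<close>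

lemma Q_nonempty:
  assumes "syn f"
  shows "Q f \<noteq> {}"
proof -
  obtain K where K: "\<And>v w. v \<in> Xs \<Longrightarrow> w \<in> Xs \<Longrightarrow> K \<le> length w \<Longrightarrow>
      nrm (f \<star> (v @ w)) = nrm (f \<star> w)"
    using assms unfolding syn_def by metis
  obtain w where w: "w \<in> Xs" "length w = K" using Xs_length_ex by blast
  have "nrm (f \<star> w) \<in> Q f"
    unfolding Q_def
  proof (intro CollectI allI)
    fix K'
    obtain v where "v \<in> Xs" "length v = K'" using Xs_length_ex by blast
    then show "\<exists>u\<in>Xs. K' \<le> length u \<and> nrm (f \<star> w) = nrm (f \<star> u)"
      using K[of v w] w by (intro bexI[of _ "v @ w"]) auto
  qed
  then show ?thesis by blast
qed

lemma finite_Q: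
  assumes "syn f" shows "finite (Q f)"
proof -
  obtain K where K: "\<And>v w. v \<in> Xs \<Longrightarrow> w \<in> Xs \<Longrightarrow> K \<le> length w \<Longrightarrow>
      nrm (f \<star> (v @ w)) = nrm (f \<star> w)"
    using assms unfolding syn_def by metis
  have "Q f \<subseteq> (\<lambda>w. nrm (f \<star> w)) ` {w \<in> Xs. length w = K}"
  proof
    fix q assume "q \<in> Q f"
    then obtain w where w: "w \<in> Xs" "K \<le> length w" "q = nrm (f \<star> w)" unfolding Q_def by blast
    obtain u v where "w = u @ v" "u \<in> Xs" "v \<in> Xs" "length v = K"
      using Xs_split[OF w(1,2)] by metis
    then have "q = nrm (f \<star> v)" "v \<in> {w \<in> Xs. length w = K}" using K[of u v] w(3) by auto
    then show "q \<in> (\<lambda>w. nrm (f \<star> w)) ` {w \<in> Xs. length w = K}" by (intro image_eqI)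
  qed
  then show ?thesis by (rule finite_subset) (intro finite_imageI finite_Xs_length)
qed

end

subsection \<open>Transducers\<close>

lemma step_word_simps [simp]:
  "step_word T [] q = q" "step_word T (i # w) q = step_word T w (step T i q)"
  "step_word T (u @ v) q = step_word T v (step_word T u q)"
  by (simp_all add: step_word_def)

lemma out_word_append: "out_word T (u @ v) q = out_word T u q @ out_word T v (step_word T u q)"
  by (induction u arbitrary: q) auto

lemma readable_append: "readable T q (u @ v) \<longleftrightarrow> readable T q u \<and> readable T (step_word T u q) v"
  by (induction u arbitrary: q) auto

lemma inputs_conc_iff: "w \<frown> x \<in> inputs T q \<longleftrightarrow> readable T q w \<and> x \<in> inputs T (step_word T w q)"
proof
  assume *: "w \<frown> x \<in> inputs T q"
  have "readable T q (w @ prefix k x)" for k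
  proof -
    have "readable T q (prefix (length w + k) (w \<frown> x))" using * unfolding inputs_def by blast
    then show ?thesis by (simp add: prefix_conc_snd)
  qed
  then show "readable T q w \<and> x \<in> inputs T (step_word T w q)"
    unfolding inputs_def readable_append by simp
next
  assume *: "readable T q w \<and> x \<in> inputs T (step_word T w q)"
  show "w \<frown> x \<in> inputs T q" unfolding inputs_def
  proof (intro CollectI allI)
    fix k
    have "readable T q (w @ prefix k x)" using * unfolding readable_append inputs_def by blast
    then have "readable T q (prefix (length w + k) (w \<frown> x))" by (simp add: prefix_conc_snd)
    moreover have "prefix (length w + k) (w \<frown> x) = prefix k (w \<frown> x) @ subsequence (w \<frown> x) k
        (k + length w)"
      by (metis add.commute subsequence_append)
    ultimately show "readable T q (prefix k (w \<frown> x))" by (metis readable_append)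
  qed
qed

lemma is_prefix_append_left: "is_prefix (u @ v) x \<Longrightarrow> is_prefix u x"
  unfolding is_prefix_def by (metis append_eq_conv_conj prefix_eq_take length_append le_add1)

lemma out_word_prefix_mono:
  assumes "k \<le> j" obtains d where "out_word T (prefix j x) q = out_word T (prefix k x) q @ d"
proof -
  have "prefix j x = prefix k x @ subsequence x k j"
    using subsequence_append[of x k "j - k"] assms by simp
  then show ?thesis using that out_word_append by metis
qed

text \<open>Productivity at a single input passes both ways between a state and the states met along
  that input (\<open>productive_at_conc\<close>).\<close>

definition productive_at :: "'q transducer \<Rightarrow> 'q \<Rightarrow> letter word \<Rightarrow> bool" where
  "productive_at T q x \<longleftrightarrow> (\<forall>m. \<exists>k. m < length (out_word T (prefix k x) q))"

lemma productiveD: "productive T q \<Longrightarrow> x \<in> inputs T q \<Longrightarrow> productive_at T q x"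
  by (simp add: productive_def productive_at_def)

lemma productive_at_conc: "productive_at T q (w \<frown> x) \<longleftrightarrow> productive_at T (step_word T w q) x"
proof -
  have eq: "out_word T (prefix (length w + k) (w \<frown> x)) q = out_word T w q @ out_word T (prefix k x)
      (step_word T w q)" for k
    by (simp add: prefix_conc_snd out_word_append)
  show ?thesis
  proof
    assume *: "productive_at T q (w \<frown> x)"
    show "productive_at T (step_word T w q) x" unfolding productive_at_def
    proof
      fix m
      obtain k where k: "m + length (out_word T w q) < length (out_word T (prefix k (w \<frown> x)) q)"
        using * unfolding productive_at_def by blast
      obtain d where "out_word T (prefix (length w + k) (w \<frown> x)) q = out_word T (prefix k (w \<frown> x)) q @ d"
        using out_word_prefix_mono[of k "length w + k"] by (metis le_add2)
      then have "m < length (out_word T (prefix k x) (step_word T w q))"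
        using k arg_cong[OF eq[of k], of length] by simp
      then show "\<exists>k. m < length (out_word T (prefix k x) (step_word T w q))" ..
    qed
  next
    assume *: "productive_at T (step_word T w q) x"
    show "productive_at T q (w \<frown> x)" unfolding productive_at_def
    proof
      fix m
      obtain k where "m < length (out_word T (prefix k x) (step_word T w q))"
        using * unfolding productive_at_def by blast
      then have "m < length (out_word T (prefix (length w + k) (w \<frown> x)) q)" unfolding eq by simp
      then show "\<exists>k. m < length (out_word T (prefix k (w \<frown> x)) q)" ..
    qed
  qed
qed

lemma local_map_prefix:
  assumes "productive_at T q x" shows "is_prefix (out_word T (prefix k x) q) (local_map T q x)"
  unfolding is_prefix_def
proof (rule nth_equalityI)
  fix m assume "m < length (prefix (length (out_word T (prefix k x) q)) (local_map T q x))"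
  then have m: "m < length (out_word T (prefix k x) q)" by simp
  define K where "K = (LEAST k. m < length (out_word T (prefix k x) q))"
  have K: "K \<le> k" "m < length (out_word T (prefix K x) q)"
    unfolding K_def using m by (auto intro: Least_le LeastI)
  obtain d where "out_word T (prefix k x) q = out_word T (prefix K x) q @ d"
    by (rule out_word_prefix_mono[OF K(1)])
  then show "prefix (length (out_word T (prefix k x) q)) (local_map T q x) ! m = out_word T
      (prefix k x) q ! m"
    using m K by (simp add: local_map_def K_def[symmetric] nth_append)
qed simp

lemma local_map_eqI:
  assumes "productive_at T q x" "\<And>k. is_prefix (out_word T (prefix k x) q) y"
  shows "local_map T q x = y"
proof
  fix m
  obtain k where k: "m < length (out_word T (prefix k x) q)"
    using assms unfolding productive_at_def by blast
  have "prefix (length (out_word T (prefix k x) q)) (local_map T q x) = prefix (length (out_word T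
      (prefix k x) q)) y"
    using local_map_prefix[OF assms(1), of k] assms(2)[of k] by (simp add: is_prefix_def)
  then have "prefix (Suc m) (local_map T q x) = prefix (Suc m) y"
    by (rule prefix_eq_mono) (use k in simp)
  then show "local_map T q x m = y m" by simp
qed

lemma local_map_conc:
  assumes "productive_at T q (w \<frown> x)"
  shows "local_map T q (w \<frown> x) = out_word T w q \<frown> local_map T (step_word T w q) x"
proof (rule local_map_eqI[OF assms])
  fix k
  have p: "productive_at T (step_word T w q) x" using assms unfolding productive_at_conc .
  obtain d where d: "out_word T (prefix (length w + k) (w \<frown> x)) q = out_word T (prefix k (w \<frown> x)) q @ d"
    using out_word_prefix_mono[of k "length w + k"] by (metis le_add2)
  have "out_word T (prefix (length w + k) (w \<frown> x)) q = out_word T w q @ out_word T (prefix k x)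
      (step_word T w q)"
    by (simp add: prefix_conc_snd out_word_append)
  then have "is_prefix (out_word T (prefix (length w + k) (w \<frown> x)) q) (out_word T w q \<frown> local_map T
      (step_word T w q) x)"
    using local_map_prefix[OF p, of k] by (simp add: is_prefix_conc_append)
  then show "is_prefix (out_word T (prefix k (w \<frown> x)) q) (out_word T w q \<frown> local_map T
      (step_word T w q) x)"
    unfolding d by (rule is_prefix_append_left)
qed

text \<open>A homomorphism of transducers. In contrast to \<open>transducer_iso\<close> it includes
  closure of the states under steps and leaves out bijectivity.\<close>

definition simulates :: "('q \<Rightarrow> 'p) \<Rightarrow> 'q transducer \<Rightarrow> 'p transducer \<Rightarrow> bool" where
  "simulates e S T \<longleftrightarrow> (\<forall>q \<in> states S. reads T (e q) = reads S q \<and>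
     (\<forall>i \<in> reads S q. step S i q \<in> states S \<and> step T i (e q) = e (step S i q) \<and>
         out T i (e q) = out S i q))"

lemma simulates_readable:
  assumes "simulates e S T" "q \<in> states S"
  shows "readable T (e q) w = readable S q w"
  using assms(2) by (induction w arbitrary: q) (use assms(1) in \<open>auto simp: simulates_def\<close>)

lemma simulates_word:
  assumes "simulates e S T" "q \<in> states S" "readable S q w"
  shows "step_word S w q \<in> states S \<and> step_word T w (e q) = e (step_word S w q) \<and>
      out_word T w (e q) = out_word S w q"
  using assms(2,3) by (induction w arbitrary: q) (use assms(1) in \<open>auto simp: simulates_def\<close>)

lemma simulates_inputs:
  assumes "simulates e S T" "q \<in> states S" shows "inputs T (e q) = inputs S q"
  unfolding inputs_def simulates_readable[OF assms] ..

lemma simulates_local_map: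
  assumes "simulates e S T" "q \<in> states S" "x \<in> inputs S q"
  shows "local_map T (e q) x = local_map S q x"
proof -
  have "out_word T (prefix k x) (e q) = out_word S (prefix k x) q" for k
    using simulates_word[OF assms(1,2)] assms(3) unfolding inputs_def by blast
  then show ?thesis unfolding local_map_def by simp
qed

lemma simulates_productive:
  assumes "simulates e S T" "q \<in> states S" shows "productive T (e q) = productive S q"
proof -
  have "out_word T (prefix k x) (e q) = out_word S (prefix k x) q" if "x \<in> inputs S q" for k x
    using simulates_word[OF assms(1,2)] that unfolding inputs_def by blast
  then show ?thesis unfolding productive_def simulates_inputs[OF assms] by simp
qed

lemma simulates_minimal:
  assumes sim: "simulates e S T" and bij: "bij_betw e (states S) (states T)"
    and q0: "q0 \<in> states S" and min: "minimal S q0"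
  shows "minimal T (e q0)"
  unfolding minimal_def
proof (intro conjI ballI impI)
  note st = bij_betw_imp_surj_on[OF bij, symmetric]
  fix p assume "p \<in> states T"
  then obtain q where q: "q \<in> states S" "p = e q" unfolding st by blast
  obtain w where "readable S q0 w" "step_word S w q0 = q" using min q unfolding minimal_def by blast
  then show "\<exists>w. readable T (e q0) w \<and> step_word T w (e q0) = p"
    using simulates_readable[OF sim q0] simulates_word[OF sim q0] q by metis
next
  note st = bij_betw_imp_surj_on[OF bij, symmetric]
  fix p p' assume "p \<in> states T" "p' \<in> states T"
    and eq: "inputs T p = inputs T p' \<and> (\<forall>x\<in>inputs T p. local_map T p x = local_map T p' x)"
  then obtain q q' where q: "q \<in> states S" "p = e q" "q' \<in> states S" "p' = e q'" unfolding st by blast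
  have "inputs S q = inputs S q'" using eq simulates_inputs[OF sim] q by metis
  moreover have "\<forall>x\<in>inputs S q. local_map S q x = local_map S q' x"
    using eq simulates_inputs[OF sim] simulates_local_map[OF sim] q by metis
  ultimately show "p = p'" using min q unfolding minimal_def by blast
next
  note st = bij_betw_imp_surj_on[OF bij, symmetric]
  fix p i assume "p \<in> states T" "i \<in> reads T p"
  then obtain q where q: "q \<in> states S" "p = e q" "i \<in> reads S q"
    unfolding st using sim unfolding simulates_def by blast
  have "greatest_common_prefix (out S i q) {local_map S q ([i] \<frown> x) | x. [i] \<frown> x \<in> inputs S q}"
    using min q unfolding minimal_def by blast
  moreover have "{local_map S q ([i] \<frown> x) | x. [i] \<frown> x \<in> inputs S q} = {local_map T p ([i] \<frown> x)
      | x. [i] \<frown> x \<in> inputs T p}"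
    unfolding q(2) simulates_inputs[OF sim q(1)]
        by (rule Collect_cong) (use simulates_local_map[OF sim q(1)] in force)
  moreover have "out T i p = out S i q" using sim q unfolding simulates_def by blast
  ultimately show "greatest_common_prefix (out T i p) {local_map T p ([i] \<frown> x)
      | x. [i] \<frown> x \<in> inputs T p}"
    by simp
qed

lemma transducer_iso_trans:
  assumes "transducer_iso S T" "transducer_iso T T'" shows "transducer_iso S T'"
proof -
  obtain f where f: "bij_betw f (states S) (states T)" "\<And>q. q \<in> states S \<Longrightarrow> reads T (f q) = reads S q"
    "\<And>q i. q \<in> states S \<Longrightarrow> i \<in> reads S q \<Longrightarrow> step T i (f q) = f (step S i q) \<and> out T i (f q) = out S i q"
    using assms(1) unfolding transducer_iso_def by blast
  obtain g where g: "bij_betw g (states T) (states T')" "\<And>q. q \<in> states T \<Longrightarrow> reads T' (g q) = reads T q"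
    "\<And>q i. q \<in> states T \<Longrightarrow> i \<in> reads T q \<Longrightarrow> step T' i (g q) = g (step T i q) \<and> out T' i (g q) = out T i q"
    using assms(2) unfolding transducer_iso_def by blast
  have fS: "f q \<in> states T" if "q \<in> states S" for q using f(1) that bij_betwE by blast
  show ?thesis unfolding transducer_iso_def
    by (intro exI[of _ "g \<circ> f"] conjI bij_betw_trans[OF f(1) g(1)] ballI) (use f(2,3) g(2,3) fS in auto)
qed

text \<open>\<open>transducer_iso\<close> alone does not keep steps inside \<open>states\<close>,
  where the inverse bijection is controlled; hence the closure hypothesis.\<close>

lemma transducer_iso_sym:
  assumes "transducer_iso S T" and closed: "\<And>q i. q \<in> states S \<Longrightarrow> i \<in> reads S q \<Longrightarrow> step S i q \<in> states S"
  shows "transducer_iso T S"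
proof -
  obtain f where f: "bij_betw f (states S) (states T)" "\<And>q. q \<in> states S \<Longrightarrow> reads T (f q) = reads S q"
    "\<And>q i. q \<in> states S \<Longrightarrow> i \<in> reads S q \<Longrightarrow> step T i (f q) = f (step S i q) \<and> out T i (f q) = out S i q"
    using assms(1) unfolding transducer_iso_def by blast
  define g where "g = inv_into (states S) f"
  have gf: "g (f q) = q" if "q \<in> states S" for q
    unfolding g_def using f(1) that bij_betw_inv_into_left by metis
  have T: "\<exists>q\<in>states S. p = f q" if "p \<in> states T" for p
    using f(1) that unfolding bij_betw_def by blast
  show ?thesis unfolding transducer_iso_def
  proof (intro exI[of _ g] conjI ballI)
    show "bij_betw g (states T) (states S)" unfolding g_def by (rule bij_betw_inv_into[OF f(1)])
    fix p assume "p \<in> states T"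
    then obtain q where q: "q \<in> states S" "p = f q" using T by blast
    show "reads S (g p) = reads T p" using q gf f(2) by simp
    fix i assume "i \<in> reads T p"
    then have "i \<in> reads S q" using q f(2) by simp
    then show "step S i (g p) = g (step T i p)" "out S i (g p) = out T i p"
      using q gf f(3) closed by auto
  qed
qed

lemma iso_class_eqI:
  assumes "transducer_iso S T" "\<And>q i. q \<in> states S \<Longrightarrow> i \<in> reads S q \<Longrightarrow> step S i q \<in> states S"
  shows "iso_class S = iso_class T"
  unfolding iso_class_def
  using transducer_iso_trans[OF assms(1)] transducer_iso_trans[OF transducer_iso_sym[OF assms]] by blast

section \<open>Minimal transducers and the local actions of their maps\<close>

context alphabet
begin

text \<open>The common features of transducers over \<open>\<CC>\<^bsub>n,r\<^esub>\<close> and over \<open>\<CC>\<^sub>n\<close>.\<close>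

definition good :: "letter set \<Rightarrow> 'q transducer \<Rightarrow> 'q \<Rightarrow> bool" where
  "good I A q0 \<longleftrightarrow> q0 \<in> states A \<and> I \<noteq> {} \<and> reads A q0 = I \<and> (\<forall>q\<in>states A. productive A q) \<and>
     (\<forall>q\<in>states A. \<forall>i\<in>reads A q. step A i q \<in> states A \<and> reads A (step A i q) = X)"

lemma goodD:
  assumes "good I A q0"
  shows "q0 \<in> states A" "I \<noteq> {}" "reads A q0 = I" "q \<in> states A \<Longrightarrow> productive A q"
    "q \<in> states A \<Longrightarrow> i \<in> reads A q \<Longrightarrow> step A i q \<in> states A"
    "q \<in> states A \<Longrightarrow> i \<in> reads A q \<Longrightarrow> reads A (step A i q) = X"
  using assms unfolding good_def by blast+

lemma good_word_X:
  assumes "good I A q0" "q \<in> states A" "reads A q = X"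
  shows "readable A q w = (w \<in> Xs) \<and> (w \<in> Xs \<longrightarrow> step_word A w q \<in> states A \<and>
      reads A (step_word A w q) = X)"
  using assms(2,3)
proof (induction w arbitrary: q)
  case (Cons i w)
  show ?case
  proof (cases "i \<in> X")
    case True
    then show ?thesis using Cons.IH[of "step A i q"] Cons.prems goodD(5,6)[OF assms(1), of q i] by simp
  qed (use Cons.prems in auto)
qed auto

lemma good_word:
  assumes "good I A q0" "q \<in> states A" "reads A q = J"
  shows "readable A q w = (w \<in> W J)" "w \<in> W J \<Longrightarrow> step_word A w q \<in> states A"
    "w \<in> W J \<Longrightarrow> w \<noteq> [] \<Longrightarrow> reads A (step_word A w q) = X"
proof -
  have "readable A q w = (w \<in> W J) \<and> (w \<in> W J \<longrightarrow> step_word A w q \<in> states A) \<and>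
      (w \<in> W J \<longrightarrow> w \<noteq> [] \<longrightarrow> reads A (step_word A w q) = X)"
  proof (cases w)
    case (Cons i v)
    show ?thesis
    proof (cases "i \<in> J")
      case True
      then show ?thesis
        using Cons good_word_X[OF assms(1), of "step A i q" v] goodD(5,6)[OF assms(1), of q i] assms
            by simp
    qed (use Cons assms in auto)
  qed (use assms in simp)
  then show "readable A q w = (w \<in> W J)" "w \<in> W J \<Longrightarrow> step_word A w q \<in> states A"
    "w \<in> W J \<Longrightarrow> w \<noteq> [] \<Longrightarrow> reads A (step_word A w q) = X" by blast+
qed

lemma prefixes_in_W_iff: "J \<noteq> {} \<Longrightarrow> (\<forall>k. prefix k x \<in> W J) \<longleftrightarrow> x \<in> D J"
proof
  assume *: "\<forall>k. prefix k x \<in> W J"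
  have "x 0 # prefix k (suffix 1 x) \<in> W J" for k
    using * prefix_Suc_Cons by metis
  then have k: "x 0 \<in> J" "prefix k (suffix 1 x) \<in> Xs" for k by (auto simp only: Cons_in_W)
  have "suffix 1 x j \<in> X" for j
    using k(2)[of "Suc j"] by simp
  then show "x \<in> D J" using k(1) by (simp add: D_def C_def)
qed (auto intro: prefix_in_W)

lemma good_inputs:
  assumes "good I A q0" "q \<in> states A" "reads A q = J" "J \<noteq> {}"
  shows "inputs A q = D J"
  unfolding inputs_def good_word(1)[OF assms(1-3)] prefixes_in_W_iff[OF assms(4)] by simp

lemma good_local_map:
  assumes "good I A q0" "q \<in> states A" "reads A q = J" "w \<in> W J" "w \<noteq> []" "y \<in> C"
  shows "local_map A q (w \<frown> y) = out_word A w q \<frown> local_map A (step_word A w q) y"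
proof (rule local_map_conc)
  have "J \<noteq> {}" using assms(4,5) by (cases w) auto
  then have "w \<frown> y \<in> inputs A q"
    using good_inputs[OF assms(1-3)] D_conc_iff assms by simp
  then show "productive_at A q (w \<frown> y)" using productiveD goodD(4)[OF assms(1,2)] by metis
qed

text \<open>In a minimal transducer the output of the last letter is the full greatest common prefix
  of what follows. So the map of the state reached has no common prefix left, which makes it the
  normalized map \<open>nrm (F \<star> w)\<close>.\<close>

lemma good_minimal_nrm:
  assumes A: "good I A q0" "minimal A q0" and F: "represents A q0 F" "inj_on F (D I)"
    and w: "w \<in> W I" "w \<noteq> []"
  shows "nrm (F \<star> w) = restrict (local_map A (step_word A w q0)) C"
    and "pre (F \<star> w) = out_word A w q0"
    and "y \<in> C \<Longrightarrow> F (w \<frown> y) = out_word A w q0 \<frown> local_map A (step_word A w q0) y"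
    and "inj_on (local_map A (step_word A w q0)) C"
    and "pre (local_map A (step_word A w q0)) = []"
proof -
  note q0 = goodD(1,3)[OF A(1)]
  define q where "q = step_word A w q0"
  have F_eq: "F (w \<frown> y) = out_word A w q0 \<frown> local_map A q y" if "y \<in> C" for y
  proof -
    have "w \<frown> y \<in> inputs A q0"
      using good_inputs[OF A(1) q0 goodD(2)[OF A(1)]] w that D_conc_iff by simp
    then have "F (w \<frown> y) = local_map A q0 (w \<frown> y)" using F(1) unfolding represents_def by simp
    then show ?thesis using good_local_map[OF A(1) q0 w that] by (simp add: q_def)
  qed
  have inj: "inj_on (local_map A q) C"
  proof (rule inj_onI)
    fix x y assume *: "x \<in> C" "y \<in> C" "local_map A q x = local_map A q y"
    then have "F (w \<frown> x) = F (w \<frown> y)" by (simp add: F_eq)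
    then show "x = y" using inj_on_eq_iff[OF inj_on_D_conc[OF F(2) w] *(1,2)] by simp
  qed
  obtain u i where ui: "w = u @ [i]" using w rev_exhaust by blast
  define p where "p = step_word A u q0"
  have wi: "readable A q0 (u @ [i])" using good_word(1)[OF A(1) q0, of w] w ui by simp
  have p: "p \<in> states A" "i \<in> reads A p" "q = step A i p"
    using wi good_word(1,2)[OF A(1) q0, of u] unfolding readable_append by (auto simp: p_def q_def ui)
  have q: "q \<in> states A" "reads A q = X" using goodD(5,6)[OF A(1) p(1,2)] p by auto
  have "greatest_common_prefix (out A i p) {local_map A p ([i] \<frown> x) | x. [i] \<frown> x \<in> inputs A p}"
    using A(2) p unfolding minimal_def by blast
  moreover have "{local_map A p ([i] \<frown> x) | x. [i] \<frown> x \<in> inputs A p} =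
      (\<lambda>x. out A i p \<frown> local_map A q x) ` C"
  proof -
    have "[i] \<frown> x \<in> inputs A p \<longleftrightarrow> x \<in> C" for x
      unfolding inputs_conc_iff using p q good_inputs[OF A(1) q X_nonempty(3)] by simp
    then have eq: "{local_map A p ([i] \<frown> x) | x. [i] \<frown> x \<in> inputs A p} = (\<lambda>x. local_map A p ([i] \<frown> x))
        ` C"
      by blast
    have "local_map A p ([i] \<frown> x) = out A i p \<frown> local_map A q x" if "x \<in> C" for x
      using good_local_map[OF A(1) p(1) refl, of "[i]" x] p that by simp
    then show ?thesis unfolding eq by (intro image_cong refl)
  qed
  ultimately have "pre (\<lambda>x. out A i p \<frown> local_map A q x) = out A i p"
    using pre_eqI by simp
  moreover have "pre (\<lambda>x. out A i p \<frown> local_map A q x) = out A i p @ pre (local_map A q)"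
    by (rule pre_shift[OF inj_on_nc[OF inj]]) simp
  ultimately have pre: "pre (local_map A q) = []" by simp
  show "nrm (F \<star> w) = restrict (local_map A (step_word A w q0)) C"
    using nrm_shift[OF inj_on_nc[OF inj] F_eq] pre unfolding q_def[symmetric]
        by (simp add: nrm_def[of "local_map A q"])
  show "pre (F \<star> w) = out_word A w q0"
    using pre_shift[OF inj_on_nc[OF inj] F_eq] pre by simp
  show "inj_on (local_map A (step_word A w q0)) C" "pre (local_map A (step_word A w q0)) = []"
    using inj pre by (simp_all add: q_def)
  show "y \<in> C \<Longrightarrow> F (w \<frown> y) = out_word A w q0 \<frown> local_map A (step_word A w q0) y"
    using F_eq by (simp add: q_def)
qed

end

text \<open>The canonical transducers below have maps as states, whereas the groups are defined with
  natural numbers as states.\<close>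

lemma nat_copy:
  assumes "finite (states S)" and closed: "\<And>q i. q \<in> states S \<Longrightarrow> i \<in> reads S q \<Longrightarrow> step S i q \<in> states S"
  obtains T :: "nat transducer" and e where "simulates e S T" "bij_betw e (states S) (states T)"
proof -
  obtain e :: "'a \<Rightarrow> nat" where e: "inj_on e (states S)"
    using finite_imp_inj_to_nat_seg[OF assms(1)] by blast
  define d where "d = inv_into (states S) e"
  define T where "T = \<lparr>states = e ` states S, reads = (\<lambda>p. reads S (d p)),
    step = (\<lambda>i p. e (step S i (d p))), out = (\<lambda>i p. out S i (d p))\<rparr>"
  have "d (e q) = q" if "q \<in> states S" for q
    unfolding d_def using e that by (rule inv_into_f_f)
  then have "simulates e S T" unfolding simulates_def T_def using closed by simp
  moreover have "bij_betw e (states S) (states T)"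
    using e by (simp add: T_def bij_betw_def)
  ultimately show ?thesis by (rule that)
qed

lemma simulates_iso: "simulates e S T \<Longrightarrow> bij_betw e (states S) (states T) \<Longrightarrow> transducer_iso S T"
  unfolding simulates_def transducer_iso_def by blast

context alphabet
begin

text \<open>Synchronization for maps on \<open>D I\<close>. A dotted word cannot be extended to the
  left, so two words with the same ending are compared instead. The condition \<open>K > 0\<close>
  keeps them nonempty, which makes their cones subsets of \<open>D I\<close>.\<close>

definition syncI :: "letter set \<Rightarrow> (letter word \<Rightarrow> letter word) \<Rightarrow> bool" where
  "syncI I F \<longleftrightarrow> (\<exists>K>0. \<forall>v\<in>Xs. length v = K \<longrightarrow> (\<forall>u u'. u @ v \<in> W I \<longrightarrow> u' @ v \<in> W I \<longrightarrow>
     nrm (F \<star> (u @ v)) = nrm (F \<star> (u' @ v))))"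

definition QI :: "letter set \<Rightarrow> (letter word \<Rightarrow> letter word) \<Rightarrow> (letter word \<Rightarrow> letter word) set" where
  "QI I F = {q. \<forall>K. \<exists>w\<in>W I. K \<le> length w \<and> q = nrm (F \<star> w)}"

lemma QI_X: "QI X = Q"
  by (simp add: QI_def Q_def fun_eq_iff)

lemma syn_syncI:
  assumes "syn f" shows "syncI X f"
proof -
  obtain K where K: "\<And>v w. v \<in> Xs \<Longrightarrow> w \<in> Xs \<Longrightarrow> K \<le> length w \<Longrightarrow>
      nrm (f \<star> (v @ w)) = nrm (f \<star> w)"
    using assms unfolding syn_def by metis
  show ?thesis unfolding syncI_def W_X
  proof (intro exI[of _ "Suc K"] conjI ballI impI allI)
    fix v u u' assume *: "v \<in> Xs" "length v = Suc K" "u @ v \<in> Xs" "u' @ v \<in> Xs"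
    then show "nrm (f \<star> (u @ v)) = nrm (f \<star> (u' @ v))"
      using K[of u v] K[of u' v] by auto
  qed simp
qed

lemma W_length_ex: "I \<noteq> {} \<Longrightarrow> \<exists>w\<in>W I. length w = k"
proof (cases k)
  case (Suc j)
  assume "I \<noteq> {}"
  then obtain i w where "i \<in> I" "w \<in> Xs" "length w = j" using Xs_length_ex by blast
  then show ?thesis using Suc by (intro bexI[of _ "i # w"]) auto
qed auto

lemma W_split:
  assumes "w \<in> W I" "K < length w"
  obtains u v where "w = u @ v" "u \<in> W I" "u \<noteq> []" "v \<in> Xs" "length v = K"
proof -
  have "w = take (length w - K) w @ drop (length w - K) w" "take (length w - K) w \<noteq> []"
    using assms by auto
  then show ?thesis using that append_in_W assms
    by (metis diff_diff_cancel length_drop less_imp_le)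
qed

lemma good_minimal_eq:
  assumes A: "good I A q0" "minimal A q0" and F: "represents A q0 F" "inj_on F (D I)"
    and w: "w \<in> W I" "w \<noteq> []" "v \<in> W I" "v \<noteq> []"
    and eq: "nrm (F \<star> w) = nrm (F \<star> v)"
  shows "step_word A w q0 = step_word A v q0"
proof -
  note q0 = goodD(1,3)[OF A(1)]
  have r: "restrict (local_map A (step_word A w q0)) C = restrict (local_map A (step_word A v q0)) C"
    using eq unfolding good_minimal_nrm(1)[OF A F w(1,2)] good_minimal_nrm(1)[OF A F w(3,4)] .
  have st: "step_word A w q0 \<in> states A" "step_word A v q0 \<in> states A"
    using good_word(2)[OF A(1) q0] w by auto
  have inp: "inputs A (step_word A w q0) = C" "inputs A (step_word A v q0) = C"
    using good_inputs[OF A(1) st(1) good_word(3)[OF A(1) q0 w(1,2)] X_nonempty(3)]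
      good_inputs[OF A(1) st(2) good_word(3)[OF A(1) q0 w(3,4)] X_nonempty(3)] by simp_all
  have "\<forall>x\<in>inputs A (step_word A w q0). local_map A (step_word A w q0) x = local_map A
      (step_word A v q0) x"
    unfolding inp using r by (metis restrict_apply')
  then show ?thesis using A(2) st inp unfolding minimal_def by metis
qed

lemma good_reachable:
  assumes "good I A q0" "minimal A q0" "q \<in> states A"
  obtains u where "u \<in> W I" "q = step_word A u q0"
  using assms(2,3) good_word(1)[OF assms(1) goodD(1,3)[OF assms(1)]] unfolding minimal_def by metis

text \<open>All states are reached from \<open>q0\<close>, and by minimality words with equal local
  actions lead to the same state.\<close>

lemma syncI_synchronizing:
  assumes A: "good I A q0" "minimal A q0" and F: "represents A q0 F" "inj_on F (D I)"
    and sync: "syncI I F"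
  shows "synchronizing A"
proof -
  note q0 = goodD(1,3)[OF A(1)]
  obtain K where K: "K > 0" "\<And>v u u'. v \<in> Xs \<Longrightarrow> length v = K \<Longrightarrow> u @ v \<in> W I \<Longrightarrow> u' @ v \<in> W I \<Longrightarrow>
     nrm (F \<star> (u @ v)) = nrm (F \<star> (u' @ v))"
    using sync unfolding syncI_def by blast
  have "synchronizing_at A K" unfolding synchronizing_at_def
  proof (intro allI impI ballI)
    fix v p q assume v: "length v = K" and p: "p \<in> states A" and q: "q \<in> states A"
      and rd: "readable A p v \<and> readable A q v"
    obtain u where u: "u \<in> W I" "p = step_word A u q0" using good_reachable[OF A p] .
    obtain u' where u': "u' \<in> W I" "q = step_word A u' q0" using good_reachable[OF A q] .
    have uv: "u @ v \<in> W I" "u' @ v \<in> W I"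
      using rd u u' unfolding good_word(1)[OF A(1) q0, symmetric] readable_append by auto
    show "step_word A v p = step_word A v q"
    proof (cases "u = [] \<and> u' = []")
      case False
      then have "v \<in> Xs" using uv append_in_W by blast
      then have "step_word A (u @ v) q0 = step_word A (u' @ v) q0"
        using v K(1) by (intro good_minimal_eq[OF A F uv(1) _ uv(2) _ K(2)[OF _ v uv]]) auto
      then show ?thesis using u u' by simp
    qed (use u u' in simp)
  qed
  then show ?thesis unfolding synchronizing_def by blast
qed

lemma synchronizing_syncI:
  assumes A: "good I A q0" "minimal A q0" and F: "represents A q0 F" "inj_on F (D I)"
    and sync: "synchronizing A"
  shows "syncI I F"
proof -
  note q0 = goodD(1,3)[OF A(1)]
  obtain k where k: "synchronizing_at A k" using sync unfolding synchronizing_def by blast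
  show ?thesis unfolding syncI_def
  \<comment> \<open>One letter more than the level of \<open>A\<close>: moving it to the left makes
    the words before the last \<open>k\<close> letters nonempty, as \<open>append_in_W\<close>
    requires.\<close>
  proof (intro exI[of _ "Suc k"] conjI ballI impI allI)
    fix v u u' assume v: "v \<in> Xs" "length v = Suc k" and uv: "u @ v \<in> W I" "u' @ v \<in> W I"
    define a b where "a = hd v" and "b = tl v"
    have ab: "u @ v = (u @ [a]) @ b" "u' @ v = (u' @ [a]) @ b" "length b = k"
      using v unfolding a_def b_def by (cases v; simp)+
    have ne: "u @ [a] \<noteq> []" "u' @ [a] \<noteq> []" by auto
    have w: "u @ [a] \<in> W I" "u' @ [a] \<in> W I"
      using uv(1)[unfolded ab(1)] uv(2)[unfolded ab(2)] append_in_W[OF ne(1)] append_in_W[OF ne(2)]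
          by blast+
    have "readable A (step_word A (u @ [a]) q0) b" "readable A (step_word A (u' @ [a]) q0) b"
      using uv unfolding ab good_word(1)[OF A(1) q0, symmetric] readable_append[of _ _ "_ @ [a]"]
          by simp_all
    then have "step_word A b (step_word A (u @ [a]) q0) = step_word A b (step_word A (u' @ [a]) q0)"
      using k ab(3) good_word(2)[OF A(1) q0 w(1)] good_word(2)[OF A(1) q0 w(2)]
      unfolding synchronizing_at_def by blast
    then have "step_word A (u @ v) q0 = step_word A (u' @ v) q0" unfolding ab by simp
    then show "nrm (F \<star> (u @ v)) = nrm (F \<star> (u' @ v))"
    proof -
      have "u @ v \<noteq> []" "u' @ v \<noteq> []" using v by auto
      then show ?thesis
        using good_minimal_nrm(1)[OF A F uv(1)] good_minimal_nrm(1)[OF A F uv(2)]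
          \<open>step_word A (u @ v) q0 = step_word A (u' @ v) q0\<close> by simp
    qed
  qed simp
qed

lemma nrm_normalized: "pre g = [] \<Longrightarrow> nrm g = restrict g C"
  by (simp add: nrm_def)

text \<open>Here a state is the map it induces, together with the domain of that map.\<close>

definition Bst :: "(letter word set \<times> (letter word \<Rightarrow> letter word)) set \<Rightarrow>
    (letter word set \<times> (letter word \<Rightarrow> letter word)) transducer" where
  "Bst S = \<lparr>states = S, reads = (\<lambda>(d, g). (\<lambda>x. x 0) ` d),
     step = (\<lambda>i (d, g). (C, nrm (g \<star> [i]))), out = (\<lambda>i (d, g). pre (g \<star> [i]))\<rparr>"

lemma Bst_simps [simp]:
  "states (Bst S) = S" "reads (Bst S) (D J, g) = J" "reads (Bst S) (C, g) = X"
  "step (Bst S) i (d, g) = (C, nrm (g \<star> [i]))" "out (Bst S) i (d, g) = pre (g \<star> [i])"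
  using first_letters_D[of X] by (simp_all add: Bst_def first_letters_D)

lemma core_simps [simp]: "reads (core n A) = reads A" "step (core n A) = step A" "out (core n A) = out A"
  by (simp_all add: core_def)

text \<open>Sending a state to its map is the isomorphism. It is injective by minimality; its image
  is \<open>QI I F\<close>, because words longer than the level lead into the core and every core
  state is reached by arbitrarily long words.\<close>

lemma core_iso:
  assumes A: "good I A q0" "minimal A q0" and F: "represents A q0 F" "inj_on F (D I)"
    and sync: "syncI I F"
  shows "iso_class (core n A) = iso_class (Bst (Pair C ` QI I F))"
proof (rule iso_class_eqI)
  note q0 = goodD(1,3)[OF A(1)]
  obtain k where k: "synchronizing_at A k"
    using syncI_synchronizing[OF A F sync] unfolding synchronizing_def by blast
  have long: "step_word A w q0 \<in> states (core n A)" if w: "w \<in> W I" "k < length w" for w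
  proof -
    obtain u v where uv: "w = u @ v" "u \<in> W I" "u \<noteq> []" "v \<in> Xs" "length v = k"
      using W_split[OF w] .
    have "readable A q0 (u @ v)" using good_word(1)[OF A(1) q0] w uv by simp
    then have "readable A (step_word A u q0) v" unfolding readable_append by blast
    then show ?thesis unfolding core_def using k uv good_word(2)[OF A(1) q0 uv(2)] by auto
  qed
  \<comment> \<open>The word \<open>v\<close> that forces \<open>s\<close> can be read after any
    nonempty \<open>u\<close> in \<open>W I\<close>, and leads to \<open>s\<close> from there too;
    the length of \<open>u\<close> is free.\<close>
  have core: "\<exists>w\<in>W I. K \<le> length w \<and> w \<noteq> [] \<and> s = step_word A w q0" if s: "s \<in> states (core n A)" for s K
  proof -
    obtain j v q where v: "s = step_word A v q" "synchronizing_at A j" "v \<in> Xs" "length v = j"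
      "q \<in> states A" "readable A q v"
      using s unfolding core_def by auto
    obtain u where u: "u \<in> W I" "length u = Suc K" using W_length_ex goodD(2)[OF A(1)] by blast
    have "u \<noteq> []" using u by auto
    then have uv: "u @ v \<in> W I" using u v append_in_W[of u v I] by blast
    have "readable A (step_word A u q0) v"
      using good_word(1)[OF A(1) q0, of "u @ v"] uv unfolding readable_append by blast
    then have "s = step_word A v (step_word A u q0)"
      using v good_word(2)[OF A(1) q0 u(1)] unfolding synchronizing_at_def by blast
    then show ?thesis using uv u by (intro bexI[of _ "u @ v"]) auto
  qed
  show "step (core n A) i s \<in> states (core n A)" if s: "s \<in> states (core n A)" "i \<in> reads (core n A) s"
      for s i
  proof -
    obtain w where w: "w \<in> W I" "k \<le> length w" "w \<noteq> []" "s = step_word A w q0" using core[OF s(1)]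
        by blast
    then have "i \<in> X" using s good_word(3)[OF A(1) q0] by simp
    then have "step_word A (w @ [i]) q0 \<in> states (core n A)"
      using w by (intro long) (auto simp: append_in_W)
    then show ?thesis using w by simp
  qed
  define e where "e s = (C, restrict (local_map A s) C)" for s
  show "transducer_iso (core n A) (Bst (Pair C ` QI I F))"
    unfolding transducer_iso_def
  proof (intro exI[of _ e] conjI ballI)
    show "bij_betw e (states (core n A)) (states (Bst (Pair C ` QI I F)))"
    proof (intro bij_betwI')
      fix s t assume st: "s \<in> states (core n A)" "t \<in> states (core n A)"
      obtain w where w: "w \<in> W I" "w \<noteq> []" "s = step_word A w q0" using core[OF st(1)] by blast
      obtain v where v: "v \<in> W I" "v \<noteq> []" "t = step_word A v q0" using core[OF st(2)] by blast
      show "(e s = e t) = (s = t)"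
        using good_minimal_eq[OF A F w(1,2) v(1,2)] good_minimal_nrm(1)[OF A F w(1,2)]
          good_minimal_nrm(1)[OF A F v(1,2)] w(3) v(3) unfolding e_def by auto
    next
      fix s assume s: "s \<in> states (core n A)"
      have "restrict (local_map A s) C \<in> QI I F"
        unfolding QI_def
      proof (intro CollectI allI)
        fix K
        obtain w where w: "w \<in> W I" "K \<le> length w" "w \<noteq> []" "s = step_word A w q0" using core[OF s]
            by blast
        then show "\<exists>w\<in>W I. K \<le> length w \<and> restrict (local_map A s) C = nrm (F \<star> w)"
          using good_minimal_nrm(1)[OF A F w(1,3)] by (intro bexI[of _ w]) auto
      qed
      then show "e s \<in> states (Bst (Pair C ` QI I F))" by (simp add: e_def)
    next
      fix p assume "p \<in> states (Bst (Pair C ` QI I F))"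
      then obtain q where q: "q \<in> QI I F" "p = (C, q)" by auto
      obtain w where w: "w \<in> W I" "Suc k \<le> length w" "q = nrm (F \<star> w)"
        using q unfolding QI_def by blast
      moreover have "w \<noteq> []" using w by auto
      ultimately have "p = e (step_word A w q0)"
        using good_minimal_nrm(1)[OF A F w(1)] unfolding e_def q by simp
      then show "\<exists>s\<in>states (core n A). p = e s" using long w by auto
    qed
    fix s assume s: "s \<in> states (core n A)"
    obtain w where w: "w \<in> W I" "w \<noteq> []" "s = step_word A w q0" using core[OF s] by blast
    have rs: "reads A s = X" using w good_word(3)[OF A(1) q0] by simp
    then show "reads (Bst (Pair C ` QI I F)) (e s) = reads (core n A) s" by (simp add: e_def)
    fix i assume "i \<in> reads (core n A) s"
    then have i: "i \<in> X" using rs by simp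
    have sA: "s \<in> states A" using w good_word(2)[OF A(1) q0] by simp
    have wi: "w @ [i] \<in> W I" "w @ [i] \<noteq> []" "step_word A (w @ [i]) q0 = step A i s"
      using w i by (auto simp: append_in_W)
    have inj: "inj_on (local_map A (step A i s)) C" and nil: "pre (local_map A (step A i s)) = []"
      using good_minimal_nrm(4,5)[OF A F wi(1,2)] unfolding wi(3) by auto
    have eq: "restrict (local_map A s) C ([i] \<frown> y) = out A i s \<frown> local_map A (step A i s) y" if "y \<in> C"
        for y
      using good_local_map[OF A(1) sA rs, of "[i]" y] i that by simp
    show "step (Bst (Pair C ` QI I F)) i (e s) = e (step (core n A) i s)"
      using nrm_shift[OF inj_on_nc[OF inj] eq] nrm_normalized[OF nil] by (simp add: e_def)
    show "out (Bst (Pair C ` QI I F)) i (e s) = out (core n A) i s"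
      using pre_shift[OF inj_on_nc[OF inj] eq] nil by (simp add: e_def)
  qed
qed

text \<open>By \<open>nrm_conc\<close>, taking local actions letter by letter gives the local action
  of the whole word.\<close>

lemma Bst_word:
  assumes "inj_on g (D J)" "w \<in> W J" "w \<noteq> []"
  shows "step_word (Bst S) w (D J, g) = (C, nrm (g \<star> w)) \<and>
    out_word (Bst S) w (D J, g) = pre (g \<star> w)"
  using assms
proof (induction w arbitrary: g J)
  case (Cons i w)
  show ?case
  proof (cases "w = []")
    case False
    define g' where "g' = nrm (g \<star> [i])"
    have i: "[i] \<in> W J" "w \<in> Xs" using Cons.prems by auto
    have inj: "inj_on (g \<star> [i]) C" using inj_on_D_conc[OF Cons.prems(1) i(1)] by simp
    have inj2: "inj_on (\<lambda>y. g ([i] \<frown> (w \<frown> y))) C"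
      using inj_on_conc[OF inj i(2)] .
    have "inj_on g' (D X)" using inj_on_nrm[OF inj] by (simp add: g'_def)
    from Cons.IH[OF this] have "step_word (Bst S) w (C, g') = (C, nrm (g' \<star> w))"
      "out_word (Bst S) w (C, g') = pre (g' \<star> w)"
      using i False by auto
    moreover have "nrm (g' \<star> w) = nrm (g \<star> (i # w))"
      using nrm_conc(1)[OF inj_on_nc[OF inj] inj_on_nc[OF inj2] i(2)] by (simp add: g'_def)
    moreover have "pre (g \<star> (i # w)) = pre (g \<star> [i]) @ pre (g' \<star> w)"
      using nrm_conc(2)[OF inj_on_nc[OF inj] inj_on_nc[OF inj2] i(2)] by (simp add: g'_def)
    ultimately show ?thesis by (simp add: g'_def)
  qed simp
qed simp

lemma Bst_readable_X: "readable (Bst S) (C, g) w \<longleftrightarrow> w \<in> Xs"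
  by (induction w arbitrary: g) auto

lemma Bst_readable: "readable (Bst S) (D J, g) w \<longleftrightarrow> w \<in> W J"
  by (cases w) (auto simp: Bst_readable_X)

lemma Bst_inputs: "J \<noteq> {} \<Longrightarrow> inputs (Bst S) (D J, g) = D J"
  unfolding inputs_def Bst_readable using prefixes_in_W_iff[of J] by simp

lemma Bst_productive_at:
  assumes "inj_on g (D J)" "ucont (D J) g" "x \<in> D J"
  shows "productive_at (Bst S) (D J, g) x"
  unfolding productive_at_def
proof
  fix m
  obtain k where k: "0 < k" "\<And>w. w \<in> W J \<Longrightarrow> k \<le> length w \<Longrightarrow> Suc m \<le> length (pre (g \<star> w))"
    using ucont_pre_long_D[OF assms(2,1), of "Suc m"] by metis
  have "m < length (out_word (Bst S) (prefix k x) (D J, g))"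
    using Bst_word[OF assms(1) prefix_in_W[OF assms(3), of k]] k(2)[OF prefix_in_W[OF assms(3),
        of k]] k(1) by auto
  then show "\<exists>k. m < length (out_word (Bst S) (prefix k x) (D J, g))" ..
qed

lemma Bst_local_map:
  assumes "inj_on g (D J)" "ucont (D J) g" "x \<in> D J"
  shows "local_map (Bst S) (D J, g) x = g x"
proof (rule local_map_eqI[OF Bst_productive_at[OF assms]])
  fix k
  show "is_prefix (out_word (Bst S) (prefix k x) (D J, g)) (g x)"
  proof (cases "k = 0")
    case False
    have w: "prefix k x \<in> W J" "prefix k x \<noteq> []" using prefix_in_W[OF assms(3)] False by auto
    have "g (prefix k x \<frown> suffix k x) = pre (\<lambda>y. g (prefix k x \<frown> y)) \<frown> nrm (\<lambda>y. g (prefix k x \<frown> y))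
        (suffix k x)"
      using suffix_D_in_C[OF assms(3), of k] False
          by (intro pre_nrm inj_on_nc inj_on_D_conc[OF assms(1) w]) blast
    then show ?thesis using Bst_word[OF assms(1) w] by simp
  qed (simp add: is_prefix_def)
qed

lemma Bst_productive:
  assumes "inj_on g (D J)" "ucont (D J) g" "J \<noteq> {}"
  shows "productive (Bst S) (D J, g)"
  using Bst_productive_at[OF assms(1,2)] Bst_inputs[OF assms(3)]
  unfolding productive_def productive_at_def by blast

end

lemma Union_eq_const: "Z \<noteq> {} \<Longrightarrow> (\<And>A. A \<in> Z \<Longrightarrow> A = c) \<Longrightarrow> \<Union> Z = c"
  by blast

section \<open>Existence of minimal transducers\<close>

context alphabet
begin

lemma syncI_cong:
  assumes "\<And>x. x \<in> D I \<Longrightarrow> F x = G x" "syncI I F" shows "syncI I G"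
proof -
  obtain K where K: "K > 0" "\<And>v u u'. v \<in> Xs \<Longrightarrow> length v = K \<Longrightarrow> u @ v \<in> W I \<Longrightarrow> u' @ v \<in> W I \<Longrightarrow>
     nrm (F \<star> (u @ v)) = nrm (F \<star> (u' @ v))"
    using assms unfolding syncI_def by blast
  have eq: "nrm (F \<star> w) = nrm (G \<star> w)" if "w \<in> W I" "w \<noteq> []" for w
    using that assms by (intro nrm_cong) (simp add: D_conc_iff)
  show ?thesis unfolding syncI_def
  proof (intro exI[of _ K] conjI ballI impI allI)
    fix v u u' assume v: "v \<in> Xs" "length v = K" "u @ v \<in> W I" "u' @ v \<in> W I"
    have "u @ v \<noteq> []" "u' @ v \<noteq> []" using v K by auto
    then show "nrm (G \<star> (u @ v)) = nrm (G \<star> (u' @ v))"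
      using eq[of "u @ v"] eq[of "u' @ v"] K(2)[OF v] v by simp
  qed (rule K)
qed

lemma ucont_D_conc:
  assumes "ucont (D I) g" "w \<in> W I" "w \<noteq> []" shows "ucont C (g \<star> w)"
proof -
  have "ucont C (g \<circ> (\<lambda>y. w \<frown> y))"
    using assms by (intro ucont_comp[where D' = "D I"] ucont_conc) (auto simp: D_conc_iff)
  then show ?thesis by (simp add: comp_def)
qed

text \<open>A word longer than \<open>Suc K\<close> may be shortened to its first letter followed by
  its last \<open>K\<close> letters without changing the local action.\<close>

lemma finite_local_actions:
  assumes "finite I" "syncI I F"
  shows "finite ((\<lambda>w. nrm (F \<star> w)) ` (W I - {[]}))"
proof -
  obtain K where K: "K > 0" "\<And>v u u'. v \<in> Xs \<Longrightarrow> length v = K \<Longrightarrow> u @ v \<in> W I \<Longrightarrow> u' @ v \<in> W I \<Longrightarrow>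
     nrm (F \<star> (u @ v)) = nrm (F \<star> (u' @ v))"
    using assms unfolding syncI_def by blast
  have "(\<lambda>w. nrm (F \<star> w)) ` (W I - {[]}) \<subseteq> (\<lambda>w. nrm (F \<star> w)) ` {w \<in> W I. length w \<le> Suc K}"
  proof
    fix q assume "q \<in> (\<lambda>w. nrm (F \<star> w)) ` (W I - {[]})"
    then obtain w where q: "q = nrm (F \<star> w)" and w: "w \<in> W I" by blast
    show "q \<in> (\<lambda>w. nrm (F \<star> w)) ` {w \<in> W I. length w \<le> Suc K}"
    proof (cases "length w \<le> Suc K")
      case False
      then have "K < length w" by simp
      then obtain u v where uv: "w = u @ v" "u \<in> W I" "u \<noteq> []" "v \<in> Xs" "length v = K"
        by (rule W_split[OF w])
      then obtain i u' where "u = i # u'" by (cases u) auto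
      then have i: "[i] @ v \<in> W I" using uv by simp
      have "q = nrm (F \<star> ([i] @ v))"
        unfolding q uv(1) using w uv(1) by (intro K(2)[OF uv(4,5) _ i]) simp
      then show ?thesis by (rule image_eqI) (use i uv in simp)
    qed (use q w in blast)
  qed
  then show ?thesis by (rule finite_subset) (intro finite_imageI finite_W_length assms)
qed

text \<open>The outputs of \<open>Bst\<close> are greatest common prefixes by construction, and its
  states are extensional maps, so states that induce the same map are equal. Finiteness is
  \<open>finite_local_actions\<close>.\<close>

lemma exists_minimal_Bst:
  assumes I: "finite I" "I \<noteq> {}" and F: "inj_on F (D I)" "ucont (D I) F" "F \<in> extensional (D I)"
      and sync: "syncI I F"
  defines "S \<equiv> insert (D I, F) (Pair C ` (\<lambda>w. nrm (F \<star> w)) ` (W I - {[]}))"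
  shows "good I (Bst S) (D I, F)" "minimal (Bst S) (D I, F)" "represents (Bst S) (D I, F) F" "finite S"
proof -
  define B where "B = Bst S"
  define s0 where "s0 = (D I, F)"
  have word: "step_word B w s0 = (C, nrm (F \<star> w))" if "w \<in> W I" "w \<noteq> []" for w
    using Bst_word[OF F(1) that] by (simp add: B_def s0_def)
  have inS: "step_word B w s0 \<in> S" if "w \<in> W I" for w
    using that word[of w] by (cases "w = []") (auto simp: S_def s0_def)
  have S: "\<exists>J g w. s = (D J, g) \<and> J \<noteq> {} \<and> inj_on g (D J) \<and> ucont (D J) g \<and> g \<in> extensional (D J) \<and>
      w \<in> W I \<and> s = step_word B w s0" if s: "s \<in> S" for s
  proof -
    consider "s = (D I, F)" | w where "w \<in> W I" "w \<noteq> []" "s = (C, nrm (F \<star> w))"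
      using s unfolding S_def by blast
    then show ?thesis
    proof cases
      case 1
      then show ?thesis using I F by (intro exI[of _ I] exI[of _ F] exI[of _ "[]"]) (simp add: s0_def)
    next
      case 2
      have inj: "inj_on (F \<star> w) C" using inj_on_D_conc[OF F(1) 2(1,2)] .
      have "ucont C (nrm (F \<star> w))"
        using ucont_unshift[OF ucont_D_conc[OF F(2) 2(1,2)] pre_nrm[OF inj_on_nc[OF inj]]] .
      then show ?thesis using 2 word inj_on_nrm[OF inj] X_nonempty(3)
        by (intro exI[of _ X] exI[of _ "nrm (F \<star> w)"] exI[of _ w]) simp
    qed
  qed
  have rdb: "readable B s0 w \<longleftrightarrow> w \<in> W I" for w
    by (simp add: B_def s0_def Bst_readable)
  show "good I (Bst S) (D I, F)" unfolding good_def B_def[symmetric] s0_def[symmetric]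
  proof (intro conjI ballI)
    show "s0 \<in> states B" by (simp add: B_def s0_def S_def)
    show "reads B s0 = I" by (simp add: B_def s0_def)
    fix s assume "s \<in> states B"
    then have sS: "s \<in> S" by (simp add: B_def)
    obtain J g w where s: "s = (D J, g)" "J \<noteq> {}" "inj_on g (D J)" "ucont (D J) g" "w \<in> W I"
        "s = step_word B w s0"
      using S[OF sS] by blast
    show "productive B s" unfolding B_def s(1) by (rule Bst_productive[OF s(3,4,2)])
    fix i assume i: "i \<in> reads B s"
    have "readable B s0 w" using s rdb by simp
    then have "readable B s0 (w @ [i])" unfolding readable_append s(6)[symmetric] using i by simp
    then show "step B i s \<in> states B" using inS[of "w @ [i]"] rdb s(6) by (simp add: B_def)
    show "reads B (step B i s) = X" unfolding B_def s(1) by simp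
  qed fact+
  show "minimal (Bst S) (D I, F)" unfolding minimal_def B_def[symmetric] s0_def[symmetric]
  proof (intro conjI ballI impI)
    fix s assume "s \<in> states B"
    then have "s \<in> S" by (simp add: B_def)
    then show "\<exists>w. readable B s0 w \<and> step_word B w s0 = s" using S rdb by metis
  next
    fix s t assume st: "s \<in> states B" "t \<in> states B"
      and eq: "inputs B s = inputs B t \<and> (\<forall>x\<in>inputs B s. local_map B s x = local_map B t x)"
    have sS: "s \<in> S" and tS: "t \<in> S" using st by (simp_all add: B_def)
    obtain J g where s: "s = (D J, g)" "J \<noteq> {}" "inj_on g (D J)" "ucont (D J) g" "g \<in> extensional (D J)"
      using S[OF sS] by blast
    obtain J' g' where t: "t = (D J', g')" "J' \<noteq> {}" "inj_on g' (D J')" "ucont (D J') g'"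
        "g' \<in> extensional (D J')"
      using S[OF tS] by blast
    have DJ: "D J = D J'" using eq unfolding B_def s(1) t(1) Bst_inputs[OF s(2)] Bst_inputs[OF t(2)]
        by blast
    have "g x = g' x" if x: "x \<in> D J" for x
    proof -
      have "x \<in> inputs B s" unfolding B_def s(1) Bst_inputs[OF s(2)] by (rule x)
      then have "local_map B s x = local_map B t x" using eq by blast
      then show ?thesis
        using Bst_local_map[OF s(3,4) x, of S] Bst_local_map[OF t(3,4), of x S] x DJ
        unfolding B_def s(1) t(1) by simp
    qed
    then have "g = g'" using s(5) t(5) unfolding DJ by (metis extensionalityI)
    then show "s = t" using s(1) t(1) DJ by simp
  next
    fix s i assume "s \<in> states B" and i: "i \<in> reads B s"
    then have sS: "s \<in> S" by (simp add: B_def)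
    obtain J g where s: "s = (D J, g)" "J \<noteq> {}" "inj_on g (D J)" "ucont (D J) g"
      using S[OF sS] by blast
    have iJ: "[i] \<in> W J" using i by (simp add: s B_def)
    have inp: "[i] \<frown> x \<in> inputs B s \<longleftrightarrow> x \<in> C" for x
      using Bst_inputs[OF s(2), of S g] iJ D_conc_iff[of "[i]" x J] by (simp add: B_def s(1))
    have "{local_map B s ([i] \<frown> x) | x. [i] \<frown> x \<in> inputs B s} = (\<lambda>x. local_map B s ([i] \<frown> x)) ` C"
      unfolding inp by blast
    also have "\<dots> = (\<lambda>x. g ([i] \<frown> x)) ` C"
    proof (rule image_cong[OF refl])
      fix x assume "x \<in> C"
      then have "[i] \<frown> x \<in> D J" using iJ D_conc_iff[of "[i]" x J] by simp
      then show "local_map B s ([i] \<frown> x) = g ([i] \<frown> x)"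
        unfolding B_def s(1) by (rule Bst_local_map[OF s(3,4)])
    qed
    finally have eq: "{local_map B s ([i] \<frown> x) | x. [i] \<frown> x \<in> inputs B s} = (\<lambda>x. g ([i] \<frown> x)) ` C" .
    have "out B i s = pre (\<lambda>x. g ([i] \<frown> x))" by (simp add: B_def s(1))
    then show "greatest_common_prefix (out B i s) {local_map B s ([i] \<frown> x) | x. [i] \<frown> x \<in> inputs B s}"
      unfolding eq using pre_gcp[OF inj_on_nc[OF inj_on_D_conc[OF s(3) iJ]]] by simp
  qed
  show "represents (Bst S) (D I, F) F"
    unfolding represents_def Bst_inputs[OF I(2)] using Bst_local_map[OF F(1,2)] by blast
  show "finite S" unfolding S_def using finite_local_actions[OF I(1) sync] by simp
qed

lemma exists_minimal:
  assumes I: "finite I" "I \<noteq> {}" and F: "inj_on F (D I)" "ucont (D I) F" and sync: "syncI I F"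
  obtains A :: "nat transducer" and q0 where
    "good I A q0" "minimal A q0" "represents A q0 F" "finite (states A)"
proof -
  define G where "G = restrict F (D I)"
  define S where "S = insert (D I, G) (Pair C ` (\<lambda>w. nrm (G \<star> w)) ` (W I - {[]}))"
  have G: "inj_on G (D I)" "ucont (D I) G" "G \<in> extensional (D I)" "syncI I G"
    using F ucont_cong[of "D I" F G] syncI_cong[OF _ sync, of G] by (auto simp: G_def inj_on_def)
  have B: "good I (Bst S) (D I, G)" "minimal (Bst S) (D I, G)" "represents (Bst S) (D I, G) G" "finite S"
    unfolding S_def by (rule exists_minimal_Bst[OF I G])+
  obtain A :: "nat transducer" and e where e: "simulates e (Bst S) A"
      "bij_betw e (states (Bst S)) (states A)"
    using nat_copy[of "Bst S"] B(4) goodD(5)[OF B(1)] Bst_simps(1)[of S] by metis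
  define q0 where "q0 = e (D I, G)"
  have s0: "(D I, G) \<in> states (Bst S)" by (simp add: S_def)
  have st: "states A = e ` states (Bst S)" using e(2) by (simp add: bij_betw_def)
  have "good I A q0" unfolding good_def
  proof (intro conjI ballI)
    show "q0 \<in> states A" using s0 st by (simp add: q0_def)
    show "reads A q0 = I" using e(1) s0 goodD(3)[OF B(1)] unfolding simulates_def q0_def by blast
    fix q assume "q \<in> states A"
    then obtain s where s: "s \<in> states (Bst S)" "q = e s" unfolding st by blast
    show "productive A q" unfolding s(2) simulates_productive[OF e(1) s(1)]
        using goodD(4)[OF B(1) s(1)] .
    fix i assume "i \<in> reads A q"
    then have i: "i \<in> reads (Bst S) s" using e(1) s unfolding simulates_def by blast
    have st': "step A i q = e (step (Bst S) i s)" "step (Bst S) i s \<in> states (Bst S)"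
      using e(1) s i unfolding simulates_def by blast+
    then show "step A i q \<in> states A" unfolding st by blast
    show "reads A (step A i q) = X"
      unfolding st'(1) using e(1) st'(2) goodD(6)[OF B(1) s(1) i] unfolding simulates_def by blast
  qed (rule I)
  moreover have "minimal A q0"
    unfolding q0_def by (rule simulates_minimal[OF e s0 B(2)])
  moreover have "represents A q0 F"
    unfolding represents_def q0_def simulates_inputs[OF e(1) s0]
  proof
    fix x assume x: "x \<in> inputs (Bst S) (D I, G)"
    then have "x \<in> D I" using Bst_inputs[OF I(2)] by blast
    then show "local_map A (e (D I, G)) x = F x"
      using simulates_local_map[OF e(1) s0 x] B(3) x unfolding represents_def by (simp add: G_def)
  qed
  moreover have "finite (states A)" using st B(4) by simp
  ultimately show ?thesis by (rule that)
qed

section \<open>The class of cores that a map represents, and products of classes\<close>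

definition Cl :: "(letter word \<Rightarrow> letter word) \<Rightarrow> nat transducer set" where
  "Cl f = iso_class (Bst (Pair C ` Q f))"

lemma Cl_sim: "sim f g \<Longrightarrow> Cl f = Cl g"
  unfolding Cl_def using Q_sim by simp

lemma Q_step:
  assumes f: "N f" and q: "q \<in> Q f" and i: "i \<in> X"
  shows "nrm (q \<star> [i]) \<in> Q f"
  unfolding Q_def
proof (intro CollectI allI)
  fix K
  obtain w where w: "w \<in> Xs" "K \<le> length w" "q = nrm (f \<star> w)" using q unfolding Q_def by blast
  have nc: "nc (f \<star> w)" "nc (\<lambda>y. f (w \<frown> ([i] \<frown> y)))"
    using ND(6)[OF N_conc[OF f w(1)]] ND(6)[OF N_conc[OF N_conc[OF f w(1)], of "[i]"]] i by simp_all
  have "nrm (q \<star> [i]) = nrm (f \<star> (w @ [i]))"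
    unfolding w(3) using nrm_conc(1)[OF nc] i by simp
  then show "\<exists>w\<in>Xs. K \<le> length w \<and> nrm (q \<star> [i]) = nrm (f \<star> w)"
    using w i by (intro bexI[of _ "w @ [i]"]) auto
qed

lemma Bst_Q_closed:
  assumes "N f" "s \<in> states (Bst (Pair C ` Q f))" "i \<in> reads (Bst (Pair C ` Q f)) s"
  shows "step (Bst (Pair C ` Q f)) i s \<in> states (Bst (Pair C ` Q f))"
  using assms Q_step by auto

lemma Cl_nonempty:
  assumes f: "N f" obtains T q where "T \<in> Cl f" "q \<in> states T"
proof -
  have "finite (states (Bst (Pair C ` Q f)))" using finite_Q[OF ND(3)[OF f]] by simp
  then obtain T :: "nat transducer" and e where e: "simulates e (Bst (Pair C ` Q f)) T"
    "bij_betw e (states (Bst (Pair C ` Q f))) (states T)"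
    using nat_copy[of "Bst (Pair C ` Q f)"] Bst_Q_closed[OF f] by metis
  have "states T \<noteq> {}" using e(2) Q_nonempty[OF ND(3)[OF f]] unfolding bij_betw_def by auto
  then show ?thesis using that simulates_iso[OF e] unfolding Cl_def iso_class_def by blast
qed

text \<open>This reduces the choices of copies and states in \<open>core_mult\<close> to choices of
  maps in \<open>Q f\<close>.\<close>

lemma Cl_local_map:
  assumes f: "N f" and T: "T \<in> Cl f" "q \<in> states T"
  shows "\<exists>p\<in>Q f. \<forall>x\<in>C. local_map T q x = p x"
proof -
  obtain e where e: "bij_betw e (states (Bst (Pair C ` Q f))) (states T)"
      "simulates e (Bst (Pair C ` Q f)) T"
    using T(1) Bst_Q_closed[OF f] unfolding Cl_def iso_class_def transducer_iso_def simulates_def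
        by blast
  obtain p where p: "p \<in> Q f" "q = e (C, p)" using T(2) e(1) unfolding bij_betw_def by auto
  have Np: "N p" using Q_cases(1)[OF f p(1)] .
  have pD: "inj_on p (D X)" "ucont (D X) p" using ND[OF Np] by simp_all
  have "local_map T q x = p x" if x: "x \<in> C" for x
  proof -
    have "x \<in> inputs (Bst (Pair C ` Q f)) (C, p)"
      using x Bst_inputs[OF X_nonempty(3), of "Pair C ` Q f" p] by simp
    then have "local_map T q x = local_map (Bst (Pair C ` Q f)) (C, p) x"
      unfolding p(2) using p by (intro simulates_local_map[OF e(2)]) simp
    also have "\<dots> = p x" using Bst_local_map[OF pD, of x "Pair C ` Q f"] x by simp
    finally show ?thesis .
  qed
  with p(1) show ?thesis by blast
qed

lemma transducer_over_good:
  assumes "transducer_over n A" "q0 \<in> states A" shows "good X A q0"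
  using assms X_nonempty(3) unfolding transducer_over_def good_def by auto

lemma good_transducer_over:
  assumes A: "good X A q0" "minimal A q0" "represents A q0 F" "inj_on F C" "F \<in> C \<rightarrow> C"
  shows "transducer_over n A"
  unfolding transducer_over_def
proof (intro ballI conjI)
  note q0 = goodD(1,3)[OF A(1)]
  fix q assume q: "q \<in> states A"
  obtain u where u: "u \<in> Xs" "q = step_word A u q0" using good_reachable[OF A(1,2) q] by auto
  show rq: "reads A q = X" using u good_word_X[OF A(1) q0] by simp
  show "productive A q" using goodD(4)[OF A(1) q] .
  fix i assume i: "i \<in> X"
  then show "step A i q \<in> states A" using goodD(5)[OF A(1) q] rq by simp
  have w: "u @ [i] \<in> W X" "u @ [i] \<noteq> []" using u i by simp_all
  obtain y where y: "y \<in> C" using C_nonempty by auto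
  have F: "inj_on F (D X)" using A(4) by simp
  have "F ((u @ [i]) \<frown> y) \<in> C" using A(5) w y by (simp add: Pi_iff)
  then have "out_word A (u @ [i]) q0 \<in> Xs"
    using good_minimal_nrm(3)[OF A(1,2,3) F w y] by simp
  then show "out A i q \<in> Xs" by (simp add: out_word_append u)
qed

text \<open>Any chosen states induce maps equivalent to \<open>f\<close> and \<open>g\<close>, and
  \<open>sim\<close> is a congruence; hence every admissible choice gives the core of
  \<open>g \<circ> f\<close>. The order is reversed because the first factor is applied
  first.\<close>

lemma core_mult_Cl:
  assumes f: "N f" and g: "N g"
  shows "core_mult n (Cl f) (Cl g) = Cl (g \<circ> f)"
proof -
  have key: "iso_class (core n A) = Cl (g \<circ> f)"
    if A: "T1 \<in> Cl f" "T2 \<in> Cl g" "q1 \<in> states T1" "q2 \<in> states T2" "good X A q0" "minimal A q0"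
      "represents A q0 (local_map T2 q2 \<circ> local_map T1 q1)" for A :: "nat transducer" and q0 T1 T2 q1 q2
  proof -
    obtain p1 where p1: "p1 \<in> Q f" "\<And>x. x \<in> C \<Longrightarrow> local_map T1 q1 x = p1 x"
        using Cl_local_map[OF f A(1,3)] by blast
    obtain p2 where p2: "p2 \<in> Q g" "\<And>x. x \<in> C \<Longrightarrow> local_map T2 q2 x = p2 x"
        using Cl_local_map[OF g A(2,4)] by blast
    have Np: "N p1" "N p2" "sim p1 f" "sim p2 g" using Q_cases[OF f p1(1)] Q_cases[OF g p2(1)] by blast+
    have N: "N (p2 \<circ> p1)" and sm: "sim (p2 \<circ> p1) (g \<circ> f)"
      using N_comp N_comp_sim Np f g by blast+
    have "inputs A q0 = C"
      using good_inputs[OF A(5) goodD(1,3)[OF A(5)] X_nonempty(3)] by simp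
    then have rep: "represents A q0 (p2 \<circ> p1)"
      using A(7) p1(2) p2(2) ND(1)[OF Np(1)] unfolding represents_def by (auto simp: Pi_iff)
    have "inj_on (p2 \<circ> p1) (D X)" using ND(4)[OF N] by simp
    from core_iso[OF A(5,6) rep this syn_syncI[OF ND(3)[OF N]]]
    show ?thesis unfolding Cl_def QI_X Q_sim[OF sm] .
  qed
  have ex: "\<exists>(A :: nat transducer) q0 T1 T2 q1 q2. T1 \<in> Cl f \<and> T2 \<in> Cl g \<and> q1 \<in> states T1 \<and>
      q2 \<in> states T2 \<and>
     transducer_over n A \<and> q0 \<in> states A \<and> minimal A q0 \<and>
         represents A q0 (local_map T2 q2 \<circ> local_map T1 q1)"
  proof -
    obtain T1 q1 where T1: "T1 \<in> Cl f" "q1 \<in> states T1" using Cl_nonempty[OF f] .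
    obtain T2 q2 where T2: "T2 \<in> Cl g" "q2 \<in> states T2" using Cl_nonempty[OF g] .
    obtain p1 where p1: "p1 \<in> Q f" "\<And>x. x \<in> C \<Longrightarrow> local_map T1 q1 x = p1 x" using Cl_local_map[OF f T1]
        by blast
    obtain p2 where p2: "p2 \<in> Q g" "\<And>x. x \<in> C \<Longrightarrow> local_map T2 q2 x = p2 x" using Cl_local_map[OF g T2]
        by blast
    have Np: "N p1" "N p2" using Q_cases[OF f p1(1)] Q_cases[OF g p2(1)] by blast+
    have N: "N (p2 \<circ> p1)" using N_comp Np by blast
    have N': "inj_on (p2 \<circ> p1) (D X)" "ucont (D X) (p2 \<circ> p1)" using ND[OF N] by simp_all
    obtain A :: "nat transducer" and q0 where A: "good X A q0" "minimal A q0" "represents A q0 (p2 \<circ> p1)"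
      using exists_minimal[OF finite_X X_nonempty(3) N' syn_syncI[OF ND(3)[OF N]]] by metis
    have "inputs A q0 = C"
      using good_inputs[OF A(1) goodD(1,3)[OF A(1)] X_nonempty(3)] by simp
    then have rep: "represents A q0 (local_map T2 q2 \<circ> local_map T1 q1)"
      using A(3) p1(2) p2(2) ND(1)[OF Np(1)] unfolding represents_def by (auto simp: Pi_iff)
    show ?thesis
      using T1 T2 A(2) rep goodD(1)[OF A(1)] good_transducer_over[OF A ND(4,1)[OF N]] by blast
  qed
  show ?thesis unfolding core_mult_def
  proof (rule Union_eq_const)
    fix Z assume "Z \<in> {iso_class (core n A) | (A :: nat transducer) q0 T1 T2 q1 q2.
     T1 \<in> Cl f \<and> T2 \<in> Cl g \<and> q1 \<in> states T1 \<and> q2 \<in> states T2 \<and>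
     transducer_over n A \<and> q0 \<in> states A \<and> minimal A q0 \<and>
     represents A q0 (local_map T2 q2 \<circ> local_map T1 q1)}"
    then obtain A :: "nat transducer" and q0 T1 T2 q1 q2 where
      "Z = iso_class (core n A)" "T1 \<in> Cl f" "T2 \<in> Cl g" "q1 \<in> states T1" "q2 \<in> states T2"
      "transducer_over n A" "q0 \<in> states A" "minimal A q0"
      "represents A q0 (local_map T2 q2 \<circ> local_map T1 q1)" by blast
    then show "Z = Cl (g \<circ> f)" using key[of T1 T2 q1 q2 A q0] transducer_over_good[of A q0] by simp
  qed (use ex in blast)
qed

subsection \<open>Homeomorphisms of the Cantor space\<close>

lemma D_iff: "x \<in> D I \<longleftrightarrow> (\<forall>k. x k \<in> (if k = 0 then I else X))"
proof -
  have "(\<forall>k. suffix 1 x k \<in> X) \<longleftrightarrow> (\<forall>k>0. x k \<in> X)"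
    by (metis Suc_pred add.commute add_Suc_right add_0_right One_nat_def plus_1_eq_Suc suffix_nth
        zero_less_Suc)
  then show ?thesis unfolding D_def C_def by auto
qed

lemma PiE_UNIV_iff: "x \<in> Pi\<^sub>E UNIV V \<longleftrightarrow> (\<forall>j. x j \<in> V j)"
  by (simp add: PiE_iff)

lemma topspace_cantor: "topspace (cantor_r n r) = Cr r"
  unfolding cantor_r_def topspace_product_topology topspace_discrete_topology o_def
  by (auto simp only: set_eq_iff D_iff PiE_UNIV_iff)

lemma finite_dots [simp]: "finite (dots r)"
  by (simp add: dots_def)

lemma openin_cone: "openin (cantor_r n r) {y \<in> Cr r. prefix k y = w}"
  unfolding cantor_r_def openin_product_topology_alt
proof
  fix x assume x: "x \<in> {y \<in> Cr r. prefix k y = w}"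
  define V where "V j = (if j < k then {x j} else if j = 0 then dots r else X)" for j
  show "\<exists>V. finite {i \<in> UNIV. V i \<noteq> topspace (discrete_topology (if i = 0 then dots r else X))} \<and>
      (\<forall>i\<in>UNIV. openin (discrete_topology (if i = 0 then dots r else X)) (V i)) \<and>
      x \<in> Pi\<^sub>E UNIV V \<and> Pi\<^sub>E UNIV V \<subseteq> {y \<in> Cr r. prefix k y = w}"
  proof (intro exI[of _ V] conjI ballI)
    have "{i \<in> UNIV. V i \<noteq> topspace (discrete_topology (if i = 0 then dots r else X))} \<subseteq> {..<k}"
      unfolding V_def by (auto split: if_splits)
    then show "finite {i \<in> UNIV. V i \<noteq> topspace (discrete_topology (if i = 0 then dots r else X))}"
      by (rule finite_subset) simp
    show "openin (discrete_topology (if i = 0 then dots r else X)) (V i)" for i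
      using x unfolding V_def by (auto simp: D_iff split: if_splits)
    show "x \<in> Pi\<^sub>E UNIV V" using x unfolding V_def PiE_UNIV_iff by (auto simp: D_iff split: if_splits)
    show "Pi\<^sub>E UNIV V \<subseteq> {y \<in> Cr r. prefix k y = w}"
    proof
      fix y assume "y \<in> Pi\<^sub>E UNIV V"
      then have y: "y j \<in> V j" for j unfolding PiE_UNIV_iff by blast
      have "prefix k y = prefix k x"
      proof (rule nth_equalityI)
        fix i assume "i < length (prefix k y)"
        then show "prefix k y ! i = prefix k x ! i" using y[of i] by (simp add: V_def)
      qed simp
      moreover have "y j \<in> (if j = 0 then dots r else X)" for j
        using y[of j] x by (auto simp: V_def D_iff split: if_splits)
      ultimately show "y \<in> {y \<in> Cr r. prefix k y = w}" using x by (auto simp: D_iff)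
    qed
  qed
qed

lemma openin_cantor_cone:
  assumes "openin (cantor_r n r) S" "x \<in> S"
  shows "\<exists>k. \<forall>y\<in>Cr r. prefix k y = prefix k x \<longrightarrow> y \<in> S"
proof -
  obtain V where V: "finite {i \<in> UNIV. V i \<noteq> topspace (discrete_topology (if i = 0 then dots r else X))}"
    "x \<in> Pi\<^sub>E UNIV V" "Pi\<^sub>E UNIV V \<subseteq> S"
    using assms unfolding cantor_r_def openin_product_topology_alt by blast
  obtain k where "\<forall>i\<in>{i \<in> UNIV. V i \<noteq> topspace (discrete_topology (if i = 0 then dots r else X))}. i < k"
    using V(1) unfolding finite_nat_set_iff_bounded by blast
  then have k: "V i \<noteq> (if i = 0 then dots r else X) \<Longrightarrow> i < k" for i by auto
  show ?thesis
  proof (intro exI[of _ k] ballI impI)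
    fix y assume y: "y \<in> Cr r" "prefix k y = prefix k x"
    have "y j \<in> V j" for j
    proof (cases "j < k")
      case True
      then have "y j = x j" using arg_cong[OF y(2), of "\<lambda>l. l ! j"] by simp
      then show ?thesis using V(2) unfolding PiE_UNIV_iff by simp
    next
      case False
      then have "V j = (if j = 0 then dots r else X)" using k[of j] by blast
      then show ?thesis using y(1) unfolding D_iff by simp
    qed
    then show "y \<in> S" using V(3) unfolding PiE_UNIV_iff[symmetric] by blast
  qed
qed

lemma compact_cantor: "compact_space (cantor_r n r)"
  unfolding cantor_r_def compact_space_product_topology by (auto simp: compact_space_discrete_topology)

text \<open>Continuity gives a length \<open>k x\<close> for each point. By compactness finitely
  many of the corresponding cones cover the space, and the maximum of their lengths serves
  everywhere.\<close>

lemma continuous_map_ucont: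
  "continuous_map (cantor_r n r) (cantor_r n r) h \<longleftrightarrow> h \<in> Cr r \<rightarrow> Cr r \<and> ucont (Cr r) h"
proof safe
  assume h: "continuous_map (cantor_r n r) (cantor_r n r) h"
  then show hD: "x \<in> Cr r \<Longrightarrow> h x \<in> Cr r" for x
    unfolding continuous_map_def topspace_cantor by blast
  show "ucont (Cr r) h" unfolding ucont_def
  proof
    fix m
    have "\<exists>k. \<forall>y\<in>Cr r. prefix k y = prefix k x \<longrightarrow> prefix m (h y) = prefix m (h x)" if x: "x \<in> Cr r" for x
    proof -
      have "openin (cantor_r n r) {y \<in> Cr r. h y \<in> {z \<in> Cr r. prefix m z = prefix m (h x)}}"
        using h openin_cone unfolding continuous_map_def topspace_cantor by blast
      from openin_cantor_cone[OF this, of x] show ?thesis using x hD by blast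
    qed
    then obtain k where k: "\<And>x y. x \<in> Cr r \<Longrightarrow> y \<in> Cr r \<Longrightarrow> prefix (k x) y = prefix (k x) x \<Longrightarrow>
        prefix m (h y) = prefix m (h x)"
      by metis
    define cone where "cone x = {y \<in> Cr r. prefix (k x) y = prefix (k x) x}" for x
    have "\<exists>\<F>. finite \<F> \<and> \<F> \<subseteq> cone ` Cr r \<and> topspace (cantor_r n r) \<subseteq> \<Union>\<F>"
      using compact_cantor[of r] openin_cone unfolding compact_space_alt topspace_cantor
      by (elim allE[of _ "cone ` Cr r"]) (auto simp: cone_def)
    then obtain \<F> where \<F>: "finite \<F>" "\<F> \<subseteq> cone ` Cr r" "Cr r \<subseteq> \<Union>\<F>"
      unfolding topspace_cantor by blast
    obtain Z where Z: "Z \<subseteq> Cr r" "finite Z" "\<F> = cone ` Z"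
      using finite_subset_image[OF \<F>(1,2)] by blast
    show "\<exists>k. \<forall>x\<in>Cr r. \<forall>y\<in>Cr r. prefix k x = prefix k y \<longrightarrow> prefix m (h x) = prefix m (h y)"
    proof (intro exI[of _ "Max (k ` Z)"] ballI impI)
      fix x y assume xy: "x \<in> Cr r" "y \<in> Cr r" "prefix (Max (k ` Z)) x = prefix (Max (k ` Z)) y"
      obtain z where z: "z \<in> Z" "x \<in> cone z" using \<F>(3) xy(1) Z(3) by blast
      have "prefix (k z) x = prefix (k z) y"
        using xy(3) by (rule prefix_eq_mono) (use z Z in simp)
      then have "prefix m (h x) = prefix m (h z)" "prefix m (h y) = prefix m (h z)"
        using z Z xy(1,2) k[of z] unfolding cone_def by auto
      then show "prefix m (h x) = prefix m (h y)" by simp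
    qed
  qed
next
  assume h: "h \<in> Cr r \<rightarrow> Cr r" "ucont (Cr r) h"
  show "continuous_map (cantor_r n r) (cantor_r n r) h"
    unfolding continuous_map_def topspace_cantor
  proof (intro conjI allI impI)
    fix V assume V: "openin (cantor_r n r) V"
    show "openin (cantor_r n r) {x \<in> Cr r. h x \<in> V}"
    proof (subst openin_subopen, safe)
      fix x assume x: "x \<in> Cr r" "h x \<in> V"
      obtain m where m: "\<And>y. y \<in> Cr r \<Longrightarrow> prefix m y = prefix m (h x) \<Longrightarrow> y \<in> V"
        using openin_cantor_cone[OF V x(2)] by blast
      obtain k where k: "\<And>x y. x \<in> Cr r \<Longrightarrow> y \<in> Cr r \<Longrightarrow> prefix k x = prefix k y \<Longrightarrow>
          prefix m (h x) = prefix m (h y)"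
        using ucontD[OF h(2)] by metis
      have "{y \<in> Cr r. prefix k y = prefix k x} \<subseteq> {x \<in> Cr r. h x \<in> V}"
        using k m h(1) x(1) by blast
      then show "\<exists>T. openin (cantor_r n r) T \<and> x \<in> T \<and> T \<subseteq> {x \<in> Cr r. h x \<in> V}"
        using openin_cone x(1) by (intro exI[of _ "{y \<in> Cr r. prefix k y = prefix k x}"]) simp
    qed
  qed (use h in blast)
qed

text \<open>The space is compact and Hausdorff, so the inverse of a continuous bijection is
  continuous.\<close>

lemma homeomorphic_map_iff:
  "homeomorphic_map (cantor_r n r) (cantor_r n r) h \<longleftrightarrow>
     bij_betw h (Cr r) (Cr r) \<and> ucont (Cr r) h"
proof
  assume h: "homeomorphic_map (cantor_r n r) (cantor_r n r) h"
  show "bij_betw h (Cr r) (Cr r) \<and> ucont (Cr r) h"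
    using homeomorphic_imp_injective_map[OF h] homeomorphic_imp_surjective_map[OF h]
      homeomorphic_imp_continuous_map[OF h]
    by (simp add: bij_betw_def topspace_cantor continuous_map_ucont)
next
  assume h: "bij_betw h (Cr r) (Cr r) \<and> ucont (Cr r) h"
  then have "continuous_map (cantor_r n r) (cantor_r n r) h"
    unfolding continuous_map_ucont using bij_betw_imp_funcset by blast
  moreover have "Hausdorff_space (cantor_r n r)"
    unfolding cantor_r_def Hausdorff_space_product_topology by auto
  ultimately show "homeomorphic_map (cantor_r n r) (cantor_r n r) h"
    using h compact_cantor unfolding bij_betw_def
    by (intro continuous_imp_homeomorphic_map) (simp_all add: topspace_cantor)
qed

lemma ucont_inverse:
  assumes "bij_betw h (Cr r) (Cr r)" "ucont (Cr r) h"
  shows "ucont (Cr r) (inv_into (Cr r) h)"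
proof -
  obtain g where g: "homeomorphic_maps (cantor_r n r) (cantor_r n r) h g"
    using homeomorphic_map_iff assms homeomorphic_map_maps by blast
  have "g x = inv_into (Cr r) h x" if x: "x \<in> Cr r" for x
  proof -
    have "g x \<in> Cr r" "h (g x) = x"
      using g x unfolding homeomorphic_maps_def continuous_map_ucont topspace_cantor by auto
    then show ?thesis using bij_betw_inv_into_left[OF assms(1), of "g x"] by simp
  qed
  moreover have "ucont (Cr r) g"
    using g unfolding homeomorphic_maps_def continuous_map_ucont by blast
  ultimately show ?thesis using ucont_cong by blast
qed

lemma C_D_disjoint: "x \<in> C \<Longrightarrow> x \<in> Cr r \<Longrightarrow> False"
  by (auto simp: D_def C_def Xn_def dots_def dest: spec[of _ 0])

lemma dots_nonempty: "1 \<le> r \<Longrightarrow> dots r \<noteq> {}"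
  by (auto simp: dots_def lessThan_empty_iff)

lemma dots_neq_X: "1 \<le> r \<Longrightarrow> dots r \<noteq> X"
  using X_nonempty(1) by (auto simp: dots_def)

lemma Xr_plus_eq: "Xr_plus n r = W (dots r) - {[]}"
  by (auto simp: Xr_plus_def W_def)

text \<open>States of \<open>R\<close> are productive because a path of states of \<open>R\<close> cannot be infinite.\<close>

lemma initial_good:
  assumes r: "1 \<le> r" and A: "initial_transducer_over_r n r A q0"
  shows "good (dots r) A q0"
proof -
  obtain R S where RS: "states A = R \<union> S" "R \<inter> S = {}" "finite R" "q0 \<in> R" "reads A q0 = dots r"
    "\<forall>q\<in>states A - {q0}. reads A q = X" "\<forall>q\<in>states A. \<forall>i\<in>reads A q. step A i q \<in> states A - {q0}"
    "\<forall>q\<in>S. productive A q"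
    "\<forall>q\<in>R. \<forall>w. w \<noteq> [] \<and> readable A q w \<longrightarrow> step_word A w q \<noteq> q"
    using A unfolding initial_transducer_over_r_def by (elim exE conjE) (rule that; assumption)
  have closed: "step_word A w q \<in> states A" if "q \<in> states A" "readable A q w" for q w
    using that by (induction w arbitrary: q) (use RS(7) in auto)
  have "productive_at A q x" if q: "q \<in> states A" and x: "x \<in> inputs A q" for q x
  proof -
    define s where "s k = step_word A (prefix k x) q" for k
    have sx: "readable A q (prefix k x)" "suffix k x \<in> inputs A (s k)" for k
      using inputs_conc_iff[of "prefix k x" "suffix k x" A q] x by (auto simp: s_def)
    have "\<exists>k. s k \<in> S"
    proof (rule ccontr)
      assume "\<nexists>k. s k \<in> S"
      then have "range s \<subseteq> R" using closed[OF q sx(1)] RS(1) unfolding s_def by blast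
      then have "\<not> inj s" using RS(3) finite_subset infinite_UNIV_nat finite_imageD by blast
      then obtain i j where ij: "i < j" "s i = s j" unfolding inj_def by (metis linorder_neqE_nat)
      have "prefix j x = prefix i x @ subsequence x i j"
        using subsequence_append[of x i "j - i"] ij by simp
      then have "step_word A (subsequence x i j) (s i) = s i" "readable A (s i) (subsequence x i j)"
        using ij(2) sx(1)[of j] unfolding s_def by (simp_all add: readable_append)
      moreover have "s i \<in> R" "subsequence x i j \<noteq> []" using \<open>range s \<subseteq> R\<close> ij by auto
      ultimately show False using RS(9) by blast
    qed
    then obtain k where "s k \<in> S" by blast
    then have "productive_at A (s k) (suffix k x)" using RS(8) by (intro productiveD[OF _ sx(2)]) blast
    then show ?thesis using productive_at_conc[of A q "prefix k x" "suffix k x"] by (simp add: s_def)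
  qed
  then have "productive A q" if "q \<in> states A" for q
    using that unfolding productive_def productive_at_def by blast
  then show ?thesis unfolding good_def using RS dots_nonempty[OF r] by blast
qed

text \<open>The partition into \<open>R\<close> and \<open>S\<close> is recovered from the induced
  maps. A cycle in \<open>R\<close> would have no output, and the state on it would then induce a
  map that is not injective.\<close>

lemma good_initial:
  assumes r: "1 \<le> r" and A: "good (dots r) A q0" "minimal A q0" "represents A q0 F"
      and fin: "finite (states A)"
    and F: "inj_on F (Cr r)" "F \<in> Cr r \<rightarrow> Cr r"
  shows "initial_transducer_over_r n r A q0"
proof -
  note q0 = goodD(1,3)[OF A(1)]
  define loc where "loc q = local_map A q" for q
  \<comment> \<open>A state other than \<open>q0\<close> belongs to \<open>R\<close> if its values
    still begin with the dotted letter, that is, if nothing has been emitted on the way to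
    it.\<close>
  define R where "R = insert q0 {q \<in> states A. loc q ` C \<subseteq> Cr r}"
  define S where "S = states A - R"
  have step: "step A i q \<in> states A" "step A i q \<noteq> q0" if "q \<in> states A" "i \<in> reads A q" for q i
    using goodD(5,6)[OF A(1) that] q0 dots_neq_X[OF r] by auto
  have reach: "\<exists>u\<in>W (dots r). u \<noteq> [] \<and> q = step_word A u q0" if q: "q \<in> states A" "q \<noteq> q0" for q
  proof -
    obtain u where u: "u \<in> W (dots r)" "q = step_word A u q0" using good_reachable[OF A(1,2) q(1)]
        by blast
    then show ?thesis using q by (cases "u = []") auto
  qed
  have rX: "reads A q = X" if q: "q \<in> states A" "q \<noteq> q0" for q
    using reach[OF q] good_word(3)[OF A(1) q0] by blast
  have val: "out_word A u q0 \<frown> loc q y \<in> Cr r"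
    if "u \<in> W (dots r)" "u \<noteq> []" "q = step_word A u q0" "y \<in> C" for u q y
    using good_minimal_nrm(3)[OF A F(1) that(1,2,4)] F(2) that D_conc_iff[of u y "dots r"]
        by (auto simp: loc_def Pi_iff)
  have loc_step: "loc q ([i] \<frown> y) = out A i q \<frown> loc (step A i q) y"
      if "q \<in> states A" "i \<in> reads A q" "y \<in> C" for q i y
    using good_local_map[OF A(1) that(1) refl, of "[i]" y] that by (simp add: loc_def)
  have R_out: "out_word A u q0 = []" if "u \<in> W (dots r)" "u \<noteq> []" "q = step_word A u q0" "q \<in> R" for u q
  proof (rule ccontr)
    assume "out_word A u q0 \<noteq> []"
    obtain y where y: "y \<in> C" using C_nonempty by blast
    have "loc q y \<in> C" using val[OF that(1-3) y] D_conc_iff[OF \<open>out_word A u q0 \<noteq> []\<close>] by simp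
    moreover have "q \<noteq> q0" using that good_word(3)[OF A(1) q0 that(1,2)] q0 dots_neq_X[OF r] by auto
    then have "loc q y \<in> Cr r" using that(4) y unfolding R_def by blast
    ultimately show False by (rule C_D_disjoint)
  qed
  have S_out: "out_word A u q0 \<in> Xr_plus n r \<and> (\<forall>y\<in>C. loc q y \<in> C)"
    if u: "u \<in> W (dots r)" "u \<noteq> []" "q = step_word A u q0" and q: "q \<in> S" for u q
  proof -
    obtain y where y: "y \<in> C" "loc q y \<notin> Cr r" using q unfolding S_def R_def by blast
    then have ne: "out_word A u q0 \<noteq> []" using val[OF u y(1)] by auto
    then show ?thesis using val[OF u] D_conc_iff[OF ne] y(1) unfolding Xr_plus_eq by blast
  qed
  show ?thesis unfolding initial_transducer_over_r_def
  proof (rule exI[of _ R], rule exI[of _ S], intro conjI ballI allI impI)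
    show "states A = R \<union> S" "R \<inter> S = {}" "q0 \<in> R" using q0 unfolding S_def R_def by auto
    show "finite R" unfolding R_def using fin by simp
    show "reads A q0 = dots r" by (rule q0)
  next
    show "reads A q = X" if "q \<in> states A - {q0}" for q using rX that by simp
    show "step A i q \<in> states A - {q0}" if "q \<in> states A" "i \<in> reads A q" for q i using step[OF that]
        by simp
  next
    fix q i assume q: "q \<in> R" and i: "i \<in> reads A q"
    have qs: "q \<in> states A" using q q0 unfolding R_def by auto
    obtain u where u: "u \<in> W (dots r)" "q = step_word A u q0" "out_word A u q0 = []"
    proof (cases "q = q0")
      case False
      then show ?thesis using that reach[OF qs False] R_out q by blast
    qed (use that[of "[]"] in simp)
    have ui: "u @ [i] \<in> W (dots r)" "u @ [i] \<noteq> []" "step A i q = step_word A (u @ [i]) q0"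
      using good_word(1)[OF A(1) q0, of u] good_word(1)[OF A(1) q0, of "u @ [i]"] u i
          by (auto simp: readable_append)
    have out: "out_word A (u @ [i]) q0 = out A i q" using u by (simp add: out_word_append)
    show "step A i q \<in> R \<Longrightarrow> out A i q = []" using R_out[OF ui] out by simp
    show "step A i q \<in> S \<Longrightarrow> out A i q \<in> Xr_plus n r" using S_out[OF ui] out by simp
  next
    fix q i assume q: "q \<in> S" and i: "i \<in> reads A q"
    have qs: "q \<in> states A" "q \<noteq> q0" using q unfolding S_def R_def by auto
    obtain u where u: "u \<in> W (dots r)" "u \<noteq> []" "q = step_word A u q0" using reach[OF qs] by blast
    have iX: "i \<in> X" using i rX[OF qs] by simp
    have in_C: "out A i q \<frown> loc (step A i q) y \<in> C" if "y \<in> C" for y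
      using S_out[OF u q] loc_step[OF qs(1) i that] iX that C_conc_iff[of "[i]" y]
          by (metis Cons_in_lists_iff lists.Nil)
    obtain y where y: "y \<in> C" using C_nonempty by blast
    show "out A i q \<in> Xs" using in_C[OF y] by simp
    have "loc (step A i q) y \<in> C" using in_C[OF y] by simp
    then have "loc (step A i q) y \<notin> Cr r" using C_D_disjoint by blast
    then show "step A i q \<in> S" using step[OF qs(1) i] y unfolding S_def R_def by blast
  next
    fix q assume "q \<in> S"
    then show "productive A q" using goodD(4)[OF A(1)] unfolding S_def by blast
  next
    fix q w assume q: "q \<in> R" and w: "w \<noteq> [] \<and> readable A q w"
    have qs: "q \<in> states A" using q q0 unfolding R_def by auto
    have wW: "w \<in> W (reads A q)" using w good_word(1)[OF A(1) qs refl] by simp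
    show "step_word A w q \<noteq> q"
    proof
      assume loop: "step_word A w q = q"
      have "reads A q = X" using good_word(3)[OF A(1) qs refl wW] w loop by simp
      then have "q \<noteq> q0" using q0 dots_neq_X[OF r] by auto
      then have locD: "loc q y \<in> Cr r" if "y \<in> C" for y using q that unfolding R_def by blast
      obtain u where u: "u \<in> W (dots r)" "u \<noteq> []" "q = step_word A u q0" using reach[OF qs \<open>q \<noteq> q0\<close>]
          by blast
      have wX: "w \<in> Xs" using wW \<open>reads A q = X\<close> by simp
      obtain i v where iv: "w = i # v" using w by (cases w) auto
      \<comment> \<open>A constant word \<open>y\<close> whose letter differs from the first letter
        of \<open>w\<close> ensures that \<open>w \<frown> y\<close> and \<open>y\<close> are
        different.\<close>
      obtain j where j: "j \<in> X" "j \<noteq> i" using X_nonempty by (metis letter.inject(1) zero_neq_one)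
      define y where "y = (\<lambda>_::nat. j)"
      have y: "y \<in> C" unfolding y_def by (rule const_in_C[OF j(1)])
      have eq: "loc q (w \<frown> y) = out_word A w q \<frown> loc q y"
        using good_local_map[OF A(1) qs refl wW _ y] w loop by (simp add: loc_def)
      have "w \<frown> y \<in> C" using wX y by simp
      have "out_word A w q = []"
      proof (rule ccontr)
        assume ne: "out_word A w q \<noteq> []"
        have "loc q y \<in> C" using locD[OF \<open>w \<frown> y \<in> C\<close>] D_conc_iff[OF ne] unfolding eq by simp
        then show False using locD[OF y] C_D_disjoint by blast
      qed
      then have "loc q (w \<frown> y) = loc q y" using eq by simp
      moreover have "inj_on (loc q) C" using good_minimal_nrm(4)[OF A F(1) u(1,2)] u(3)
          by (simp add: loc_def)
      ultimately have "w \<frown> y = y" using inj_on_eq_iff[of "loc q" C "w \<frown> y" y] \<open>w \<frown> y \<in> C\<close> y by blast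
      then have "(w \<frown> y) 0 = y 0" by simp
      then show False using iv j by (simp add: y_def)
    qed
  qed
qed

lemma finite_sync_iff:
  assumes r: "1 \<le> r" and h: "inj_on h (Cr r)" "h \<in> Cr r \<rightarrow> Cr r" "ucont (Cr r) h"
  shows "finite_sync n r h \<longleftrightarrow> syncI (dots r) h"
proof
  assume "finite_sync n r h"
  then obtain A :: "nat transducer" and q0 where A: "initial_transducer_over_r n r A q0" "minimal A q0"
      "represents A q0 h" "synchronizing A"
    unfolding finite_sync_def minimal_transducer_of_def by blast
  show "syncI (dots r) h"
    by (rule synchronizing_syncI[OF initial_good[OF r A(1)] A(2,3) h(1) A(4)])
next
  assume sync: "syncI (dots r) h"
  obtain A :: "nat transducer" and q0 where A: "good (dots r) A q0" "minimal A q0" "represents A q0 h"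
      "finite (states A)"
    using exists_minimal[OF finite_dots dots_nonempty[OF r] h(1,3) sync] by blast
  then show "finite_sync n r h"
    unfolding finite_sync_def minimal_transducer_of_def
    using good_initial[OF r A h(1,2)] syncI_synchronizing[OF A(1,2,3) h(1) sync] by blast
qed

text \<open>By \<open>core_iso\<close> all members of the union agree, and
  \<open>exists_minimal\<close> provides one.\<close>

lemma Core_eq:
  assumes r: "1 \<le> r" and h: "inj_on h (Cr r)" "h \<in> Cr r \<rightarrow> Cr r" "ucont (Cr r) h"
    and sync: "syncI (dots r) h"
  shows "Core n r h = iso_class (Bst (Pair C ` QI (dots r) h))"
  unfolding Core_def
proof (rule Union_eq_const)
  obtain A :: "nat transducer" and q0 where A: "good (dots r) A q0" "minimal A q0" "represents A q0 h"
      "finite (states A)"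
    using exists_minimal[OF finite_dots dots_nonempty[OF r] h(1,3) sync] by blast
  then show "{iso_class (core n A) | A q0. minimal_transducer_of n r h A q0} \<noteq> {}"
    unfolding minimal_transducer_of_def using good_initial[OF r A h(1,2)] by blast
  fix Z assume "Z \<in> {iso_class (core n A) | A q0. minimal_transducer_of n r h A q0}"
  then obtain A :: "nat transducer" and q0 where A: "Z = iso_class (core n A)"
      "initial_transducer_over_r n r A q0" "minimal A q0" "represents A q0 h"
    unfolding minimal_transducer_of_def by blast
  show "Z = iso_class (Bst (Pair C ` QI (dots r) h))"
    unfolding A(1) by (rule core_iso[OF initial_good[OF r A(2)] A(3,4) h(1) sync])
qed

text \<open>Finitely many cones of one length admit a common bound, and synchronization of
  \<open>g\<close> identifies its local actions at \<open>v\<close> and at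
  \<open>w @ v\<close>.\<close>

lemma sim_local:
  assumes g: "syn g" and loc: "\<And>w. w \<in> Xs \<Longrightarrow> length w = k \<Longrightarrow> sim (e \<star> w) g"
  shows "sim e g"
proof -
  have "\<forall>w\<in>{w \<in> Xs. length w = k}. \<exists>K. \<forall>v\<in>Xs. K \<le> length v \<longrightarrow>
      nrm (\<lambda>y. e (w \<frown> (v \<frown> y))) = nrm (g \<star> v)"
    using loc unfolding sim_def by simp
  from bchoice[OF this] obtain K where K: "\<forall>w\<in>{w \<in> Xs. length w = k}. \<forall>v\<in>Xs. K w \<le> length v \<longrightarrow>
      nrm (\<lambda>y. e (w \<frown> (v \<frown> y))) = nrm (g \<star> v)"
    by blast
  obtain L where L: "\<And>v w. v \<in> Xs \<Longrightarrow> w \<in> Xs \<Longrightarrow> L \<le> length w \<Longrightarrow>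
      nrm (g \<star> (v @ w)) = nrm (g \<star> w)"
    using g unfolding syn_def by metis
  define M where "M = max L (Max (K ` {w \<in> Xs. length w = k}))"
  show ?thesis unfolding sim_def
  proof (intro exI[of _ "k + M"] ballI impI)
    fix u assume u: "u \<in> Xs" "k + M \<le> length u"
    obtain w v where uv: "u = w @ v" "w \<in> Xs" "v \<in> Xs" "length v = length u - k"
      using Xs_split[OF u(1) diff_le_self] by blast
    have lw: "length w = k" and lv: "M \<le> length v" using uv u by auto
    have "K w \<le> M" unfolding M_def using uv(2) lw finite_Xs_length by (intro max.coboundedI2 Max_ge) auto
    then have "nrm (\<lambda>y. e (w \<frown> (v \<frown> y))) = nrm (g \<star> v)" using uv lw lv K by simp
    also have "\<dots> = nrm (g \<star> (w @ v))" using uv lv by (intro L[symmetric]) (auto simp: M_def)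
    finally show "nrm (e \<star> u) = nrm (g \<star> u)" by (simp add: uv(1))
  qed
qed

text \<open>After a nonempty word only the last \<open>K\<close> letters matter, so the restrictions
  to all cones are synchronizing and equivalent to each other.\<close>

lemma syncI_syn:
  assumes "syncI I h" "v \<in> W I" "v \<noteq> []"
  shows "syn (h \<star> v)"
    and "w \<in> W I \<Longrightarrow> w \<noteq> [] \<Longrightarrow> sim (h \<star> v) (h \<star> w)"
proof -
  obtain K where K: "\<And>v u u'. v \<in> Xs \<Longrightarrow> length v = K \<Longrightarrow> u @ v \<in> W I \<Longrightarrow> u' @ v \<in> W I \<Longrightarrow>
     nrm (h \<star> (u @ v)) = nrm (h \<star> (u' @ v))"
    using assms unfolding syncI_def by blast
  have K': "nrm (h \<star> (u @ x)) = nrm (h \<star> (u' @ x))"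
    if ux: "u \<in> W I" "u \<noteq> []" "u' \<in> W I" "u' \<noteq> []" "x \<in> Xs" "K \<le> length x" for u u' x
  proof -
    obtain x1 x2 where x: "x = x1 @ x2" "x1 \<in> Xs" "x2 \<in> Xs" "length x2 = K"
        by (rule Xs_split[OF ux(5,6)])
    have "(u @ x1) @ x2 \<in> W I" "(u' @ x1) @ x2 \<in> W I"
      using append_in_W[of u x I] append_in_W[of u' x I] ux x by auto
    from K[OF x(3,4) this] show ?thesis by (simp add: x(1))
  qed
  show "syn (h \<star> v)" unfolding syn_def
  proof (intro exI[of _ K] ballI impI)
    fix a x assume a: "a \<in> Xs" "x \<in> Xs" "K \<le> length x"
    have "nrm (\<lambda>y. h (((v @ a) @ x) \<frown> y)) = nrm (h \<star> (v @ x))"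
      using a assms append_in_W[of v a I] by (intro K') auto
    then show "nrm (\<lambda>y. h (v \<frown> (a @ x) \<frown> y)) = nrm (\<lambda>y. h (v \<frown> x \<frown> y))" by simp
  qed
  assume w: "w \<in> W I" "w \<noteq> []"
  show "sim (h \<star> v) (h \<star> w)" unfolding sim_def
  proof (intro exI[of _ K] ballI impI)
    fix x assume "x \<in> Xs" "K \<le> length x"
    then show "nrm (\<lambda>y. h (v \<frown> x \<frown> y)) = nrm (\<lambda>y. h (w \<frown> x \<frown> y))"
      using K'[OF assms(2,3) w] by simp
  qed
qed

section \<open>Homeomorphisms and their local equivalence classes\<close>

text \<open>\<open>f\<close> represents the common equivalence class of the restrictions of \<open>h\<close> to cones.\<close>

definition locally :: "nat \<Rightarrow> (letter word \<Rightarrow> letter word) \<Rightarrow> (letter word \<Rightarrow> letter word) \<Rightarrow> bool" where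
  "locally r h f \<longleftrightarrow> N f \<and> (\<forall>a<r. sim f (h \<star> [Dot a]))"

lemma Dot_in_dots [simp]: "Dot a \<in> dots r \<longleftrightarrow> a < r"
  by (auto simp: dots_def)

lemma locally_levels:
  assumes "locally r h f"
  shows "\<exists>K. \<forall>a<r. \<forall>w\<in>Xs. K \<le> length w \<longrightarrow>
    nrm (h \<star> (Dot a # w)) = nrm (f \<star> w)"
proof -
  have "\<forall>a\<in>{..<r}. \<exists>K. \<forall>w\<in>Xs. K \<le> length w \<longrightarrow> nrm (f \<star> w) = nrm (h \<star> (Dot a # w))"
    using assms unfolding locally_def sim_def by simp
  then obtain K where K: "\<And>a w. a \<in> {..<r} \<Longrightarrow> w \<in> Xs \<Longrightarrow> K a \<le> length w \<Longrightarrow>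
      nrm (f \<star> w) = nrm (h \<star> (Dot a # w))"
    by metis
  have "nrm (h \<star> (Dot a # w)) = nrm (f \<star> w)"
    if a: "a < r" "w \<in> Xs" "Max (K ` {..<r}) \<le> length w" for a w
  proof -
    have "K a \<le> Max (K ` {..<r})" using a by (intro Max_ge) auto
    then have "K a \<le> length w" using a(3) by (rule order_trans)
    then show ?thesis using K[of a w] a by simp
  qed
  then show ?thesis by blast
qed

lemma W_dots_cases:
  assumes "w \<in> W (dots r)" "w \<noteq> []" shows "\<exists>a v. a < r \<and> v \<in> Xs \<and> w = Dot a # v"
  using assms by (cases w) (auto simp: dots_def)

lemma locally_QI:
  assumes r: "1 \<le> r" and h: "locally r h f" shows "QI (dots r) h = Q f"
proof -
  obtain K where K: "\<forall>a<r. \<forall>w\<in>Xs. K \<le> length w \<longrightarrow>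
    nrm (h \<star> (Dot a # w)) = nrm (f \<star> w)"
    using locally_levels[OF h] by blast
  show ?thesis
  proof (intro equalityI subsetI)
    fix q assume q: "q \<in> QI (dots r) h"
    show "q \<in> Q f" unfolding Q_def
    proof (intro CollectI allI)
      fix k
      obtain w where w: "w \<in> W (dots r)" "Suc (max K k) \<le> length w" "q = nrm (h \<star> w)"
        using q unfolding QI_def by blast
      have "w \<noteq> []" using w(2) by auto
      then obtain a v where v: "a < r" "v \<in> Xs" "w = Dot a # v" using W_dots_cases[OF w(1)] by blast
      then show "\<exists>w\<in>Xs. k \<le> length w \<and> q = nrm (f \<star> w)"
        using K w by (intro bexI[of _ v]) simp_all
    qed
  next
    fix q assume q: "q \<in> Q f"
    show "q \<in> QI (dots r) h" unfolding QI_def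
    proof (intro CollectI allI)
      fix k
      obtain w where w: "w \<in> Xs" "max K k \<le> length w" "q = nrm (f \<star> w)"
        using q unfolding Q_def by blast
      then show "\<exists>w\<in>W (dots r). k \<le> length w \<and> q = nrm (h \<star> w)"
        using K r by (intro bexI[of _ "Dot 0 # w"]) simp_all
    qed
  qed
qed

lemma locally_syncI:
  assumes h: "locally r h f" shows "syncI (dots r) h"
proof -
  obtain K where K: "\<forall>a<r. \<forall>w\<in>Xs. K \<le> length w \<longrightarrow>
    nrm (h \<star> (Dot a # w)) = nrm (f \<star> w)"
    using locally_levels[OF h] by blast
  have f: "syn f" using h ND(3) unfolding locally_def by blast
  obtain L where L: "\<And>v w. v \<in> Xs \<Longrightarrow> w \<in> Xs \<Longrightarrow> L \<le> length w \<Longrightarrow>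
      nrm (f \<star> (v @ w)) = nrm (f \<star> w)"
    using f unfolding syn_def by metis
  have eq: "nrm (h \<star> (u @ v)) = nrm (f \<star> v)"
    if v: "v \<in> Xs" "length v = Suc (max K L)" "u @ v \<in> W (dots r)" for u v
  proof -
    \<comment> \<open>Words of \<open>W (dots r)\<close> begin with a dotted letter, which
      \<open>v\<close> does not contain.\<close>
    have "u \<noteq> []"
    proof
      assume "u = []"
      then have "v \<in> W (dots r)" "v \<noteq> []" using v by auto
      then obtain a w where "v = Dot a # w" using W_dots_cases by blast
      then show False using v(1) by (auto simp: Xn_def)
    qed
    then have "u \<in> W (dots r)" using v append_in_W by metis
    then obtain a w where w: "a < r" "w \<in> Xs" "u = Dot a # w" using W_dots_cases \<open>u \<noteq> []\<close> by blast
    have "nrm (\<lambda>y. h ((Dot a # (w @ v)) \<frown> y)) = nrm (f \<star> (w @ v))"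
      using w v K by simp
    also have "\<dots> = nrm (f \<star> v)" using w v by (intro L) auto
    finally show ?thesis by (simp add: w(3))
  qed
  show ?thesis unfolding syncI_def
    using eq by (intro exI[of _ "Suc (max K L)"]) simp
qed

text \<open>The homeomorphisms in \<open>B_set n r\<close>, without the extensionality requirement.\<close>

definition Bh :: "nat \<Rightarrow> (letter word \<Rightarrow> letter word) \<Rightarrow> bool" where
  "Bh r h \<longleftrightarrow> bij_betw h (Cr r) (Cr r) \<and> ucont (Cr r) h \<and>
     syncI (dots r) h \<and> syncI (dots r) (inv_into (Cr r) h)"

lemma BhD:
  assumes "Bh r h"
  shows "bij_betw h (Cr r) (Cr r)" "ucont (Cr r) h" "syncI (dots r) h"
    "inj_on h (Cr r)" "h \<in> Cr r \<rightarrow> Cr r"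
  using assms bij_betw_imp_funcset unfolding Bh_def by (auto simp: bij_betw_def)

lemma syncI_cong_iff: "(\<And>x. x \<in> D I \<Longrightarrow> F x = G x) \<Longrightarrow> syncI I F \<longleftrightarrow> syncI I G"
  using syncI_cong[of I F G] syncI_cong[of I G F] by metis

lemma Bh_inverse:
  assumes "Bh r h" shows "Bh r (inv_into (Cr r) h)"
proof -
  note h = BhD[OF assms]
  have inv: "bij_betw (inv_into (Cr r) h) (Cr r) (Cr r)" using bij_betw_inv_into[OF h(1)] .
  have "inv_into (Cr r) (inv_into (Cr r) h) x = h x" if x: "x \<in> Cr r" for x
  proof -
    have "h x \<in> Cr r" using h(5) x by blast
    then show ?thesis
      using bij_betw_inv_into_left[OF inv, of "h x"] bij_betw_inv_into_left[OF h(1) x] by simp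
  qed
  then have "syncI (dots r) (inv_into (Cr r) (inv_into (Cr r) h))"
    using syncI_cong_iff h(3) by metis
  then show ?thesis using assms inv ucont_inverse[OF h(1,2)] unfolding Bh_def by blast
qed

lemma B_set_iff:
  assumes r: "1 \<le> r"
  shows "h \<in> B_set n r \<longleftrightarrow> h \<in> extensional (Cr r) \<and> Bh r h"
proof -
  have "finite_sync n r h \<and> finite_sync n r (inv_into (Cr r) h) \<longleftrightarrow>
      syncI (dots r) h \<and> syncI (dots r) (inv_into (Cr r) h)"
    if h: "bij_betw h (Cr r) (Cr r)" "ucont (Cr r) h"
  proof -
    note inv = bij_betw_inv_into[OF h(1)]
    have "finite_sync n r h \<longleftrightarrow> syncI (dots r) h"
      using finite_sync_iff[OF r] h bij_betw_imp_funcset[OF h(1)] by (simp add: bij_betw_def)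
    moreover have "finite_sync n r (inv_into (Cr r) h) \<longleftrightarrow> syncI (dots r) (inv_into (Cr r) h)"
      using finite_sync_iff[OF r] ucont_inverse[OF h] inv bij_betw_imp_funcset[OF inv]
          by (simp add: bij_betw_def)
    ultimately show ?thesis by simp
  qed
  then show ?thesis unfolding B_set_def Bh_def topspace_cantor homeomorphic_map_iff by blast
qed

text \<open>Whether \<open>x\<close> lies in the image of the cone of \<open>u\<close> is visible
  from the first letters of its preimage, hence, by uniform continuity of the inverse, from
  boundedly many letters of \<open>x\<close>.\<close>

lemma Bh_emb:
  assumes h: "Bh r h" and w: "w \<in> W (dots r)" "w \<noteq> []"
  shows "emb (h \<star> w)"
  unfolding emb_def
proof (intro conjI ballI)
  note b = BhD[OF h]
  define g where "g = inv_into (Cr r) h"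
  show "inj_on (h \<star> w) C" using inj_on_D_conc[OF b(4) w] .
  show "ucont C (h \<star> w)" using ucont_D_conc[OF b(2) w] .
  fix v assume v: "v \<in> Xs"
  define u where "u = w @ v"
  have u: "u \<in> W (dots r)" "u \<noteq> []" using w v append_in_W by (auto simp: u_def)
  obtain k where k: "\<And>x y. x \<in> Cr r \<Longrightarrow> y \<in> Cr r \<Longrightarrow> prefix k x = prefix k y \<Longrightarrow>
      prefix (length u) (g x) = prefix (length u) (g y)"
    using ucontD[OF ucont_inverse[OF b(1,2)]] unfolding g_def by metis
  \<comment> \<open>\<open>Suc k\<close> keeps the prefix nonempty, so that it contains the dotted
    letter and only letters of \<open>X\<close> follow.\<close>
  have "lev (Suc k) ((\<lambda>y. h (w \<frown> v \<frown> y)) ` C)" unfolding lev_def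
  proof (intro ballI conjI)
    fix x assume "x \<in> (\<lambda>y. h (w \<frown> v \<frown> y)) ` C"
    then obtain y where y: "y \<in> C" "x = h (u \<frown> y)" by (auto simp: u_def)
    have uy: "u \<frown> y \<in> Cr r" using u y by (simp add: D_conc_iff)
    then have xD: "x \<in> Cr r" using y b(5) by blast
    show "suffix (Suc k) x \<in> C" using suffix_D_in_C[OF xD] by simp
    fix z assume z: "z \<in> C"
    define x' where "x' = prefix (Suc k) x \<frown> z"
    have px: "prefix (Suc k) x \<in> W (dots r)" using prefix_in_W[OF xD] .
    have x'D: "x' \<in> Cr r" unfolding x'_def using px z D_conc_iff[of "prefix (Suc k) x" z] by simp
    have "prefix (Suc k) x' = prefix (Suc k) x" unfolding x'_def
      using prefix_conc_length[of "prefix (Suc k) x" z] by (simp del: subseq_to_Suc)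
    then have "prefix k x' = prefix k x" by (rule prefix_eq_mono) simp
    then have "prefix (length u) (g x') = prefix (length u) (g x)" using k x'D xD by blast
    moreover have "g x = u \<frown> y" unfolding g_def y(2) using bij_betw_inv_into_left[OF b(1) uy] .
    ultimately have "prefix (length u) (g x') = u" by simp
    then have gx': "g x' = u \<frown> suffix (length u) (g x')" using prefix_suffix[of "g x'" "length u"]
        by simp
    have "g x' \<in> Cr r" unfolding g_def using bij_betw_imp_funcset[OF bij_betw_inv_into[OF b(1)]] x'D
        by blast
    then have "suffix (length u) (g x') \<in> C" using suffix_D_in_C u(2) by blast
    moreover have "x' = h (u \<frown> suffix (length u) (g x'))"
      using bij_betw_inv_into_right[OF b(1) x'D] gx' unfolding g_def by metis
    ultimately show "prefix (Suc k) x \<frown> z \<in> (\<lambda>y. h (w \<frown> v \<frown> y)) ` C"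
      unfolding x'_def[symmetric] by (intro image_eqI[of _ _ "suffix (length u) (g x')"])
          (simp_all add: u_def)
  qed
  then show "clp ((\<lambda>y. h (w \<frown> v \<frown> y)) ` C)" unfolding clp_def by blast
qed

text \<open>The values of \<open>h\<close> carry a dotted letter, so its restrictions are not maps
  of \<open>C\<close> to itself. On a smaller cone the dotted letter belongs to the common prefix,
  and normalization removes it.\<close>

lemma Bh_local_N:
  assumes h: "Bh r h" and v: "v \<in> W (dots r)" "v \<noteq> []"
  shows "\<exists>w\<in>Xs. m < length (pre (h \<star> (v @ w))) \<and>
    pre (h \<star> (v @ w)) \<in> W (dots r) \<and> N (nrm (h \<star> (v @ w))) \<and>
    sim (nrm (h \<star> (v @ w))) (h \<star> v)"
proof -
  define g where "g = (h \<star> v)"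
  have g: "emb g" unfolding g_def using Bh_emb[OF h v] .
  obtain k where k: "\<And>w. w \<in> Xs \<Longrightarrow> k \<le> length w \<Longrightarrow> Suc m \<le> length (pre (g \<star> w))"
    using ucont_pre_long[OF embD(2,1)[OF g]] by metis
  obtain w where w: "w \<in> Xs" "length w = k" using Xs_length_ex by blast
  define e where "e = (h \<star> (v @ w))"
  have eg: "e = (g \<star> w)" by (simp add: e_def g_def)
  have e: "emb e" unfolding eg using emb_conc[OF g w(1)] .
  have m: "m < length (pre e)" using k[of w] w unfolding eg by simp
  have vw: "v @ w \<in> W (dots r)" "v @ w \<noteq> []" using v w append_in_W by auto
  have split: "pre e \<in> W (dots r) \<and> nrm e y \<in> C" if "y \<in> C" for y
  proof -
    have "e y \<in> Cr r" unfolding e_def using that vw D_conc_iff BhD(5)[OF h] by blast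
    then have "pre e \<frown> nrm e y \<in> Cr r" using pre_nrm[OF embD(3)[OF e] that] by simp
    moreover have "pre e \<noteq> []" using m by auto
    ultimately show ?thesis using D_conc_iff by blast
  qed
  have "syn g" unfolding g_def using syncI_syn(1)[OF BhD(3)[OF h] v] .
  have "sim e g" unfolding eg using syn_sim_conc[OF \<open>syn g\<close> w(1)] .
  have sm: "sim (nrm e) g" using sim_trans[OF sim_nrm[OF embD(1)[OF e]] \<open>sim e g\<close>] .
  have "N (nrm e)" unfolding N_def
    using split emb_nrm[OF e] syn_sim[OF \<open>syn g\<close> sim_sym[OF sm]] by blast
  moreover have "pre e \<in> W (dots r)" using split C_nonempty by blast
  ultimately show ?thesis using w m sm unfolding e_def g_def by blast
qed

lemma Bh_locally_ex:
  assumes r: "1 \<le> r" and h: "Bh r h" shows "\<exists>f. locally r h f"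
proof -
  have v: "[Dot 0] \<in> W (dots r)" "[Dot 0] \<noteq> []" using r by auto
  obtain w where w: "w \<in> Xs" "N (nrm (h \<star> ([Dot 0] @ w)))"
    "sim (nrm (h \<star> ([Dot 0] @ w))) (h \<star> [Dot 0])"
    using Bh_local_N[OF h v, of 0] by blast
  have "sim (h \<star> [Dot 0]) (h \<star> [Dot a])" if "a < r" for a
    using that by (intro syncI_syn(2)[OF BhD(3)[OF h] v]) auto
  then show ?thesis unfolding locally_def using w sim_trans by blast
qed

lemma locally_sim:
  assumes h: "syncI (dots r) h" "locally r h f" and v: "v \<in> W (dots r)" "v \<noteq> []"
  shows "sim f (h \<star> v)"
proof -
  obtain a u where a: "a < r" "v = Dot a # u" using W_dots_cases[OF v] by blast
  have "sim (h \<star> [Dot a]) (h \<star> v)"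
    using a v by (intro syncI_syn(2)[OF h(1)]) auto
  then show ?thesis using h(2) a(1) sim_trans unfolding locally_def by blast
qed

lemma sim_id_conc: "sim (\<lambda>y. w \<frown> y) id"
  by (rule sim_shift[of id _ w]) auto

text \<open>On a small cone the inverse of \<open>h\<close> emits a word \<open>a\<close> and
  continues with some \<open>q\<close> equivalent to \<open>g\<close>. Below \<open>a\<close> the
  map \<open>h\<close> is equivalent to \<open>f\<close> and undoes this, so
  \<open>f \<circ> q\<close> is equivalent to putting a fixed word in front.\<close>

lemma locally_inverse:
  assumes r: "1 \<le> r" and h: "Bh r h" and f: "locally r h f" and g: "locally r (inv_into (Cr r) h) g"
  shows "sim (f \<circ> g) id"
proof -
  define h' where "h' = inv_into (Cr r) h"
  have h': "Bh r h'" unfolding h'_def using Bh_inverse[OF h] .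
  have v: "[Dot 0] \<in> W (dots r)" "[Dot 0] \<noteq> []" using r by auto
  obtain w where w: "w \<in> Xs" "0 < length (pre (h' \<star> ([Dot 0] @ w)))"
    "pre (h' \<star> ([Dot 0] @ w)) \<in> W (dots r)" "N (nrm (h' \<star> ([Dot 0] @ w)))"
    "sim (nrm (h' \<star> ([Dot 0] @ w))) (h' \<star> [Dot 0])"
    using Bh_local_N[OF h' v, of 0] by blast
  define a where "a = pre (h' \<star> ([Dot 0] @ w))"
  define q where "q = nrm (h' \<star> ([Dot 0] @ w))"
  have a: "a \<in> W (dots r)" "a \<noteq> []" using w by (auto simp: a_def)
  have q: "N q" "sim q (h' \<star> [Dot 0])" using w by (auto simp: q_def)
  have w0: "[Dot 0] @ w \<in> W (dots r)" "[Dot 0] @ w \<noteq> []" using w r by auto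
  have eq: "h (a \<frown> q y) = ([Dot 0] @ w) \<frown> y" if y: "y \<in> C" for y
  proof -
    have "h' (([Dot 0] @ w) \<frown> y) = a \<frown> q y"
      unfolding a_def q_def by (rule pre_nrm[OF embD(3)[OF Bh_emb[OF h' w0]] y])
    moreover have "([Dot 0] @ w) \<frown> y \<in> Cr r" using D_conc_iff[OF w0(2)] w0(1) y by blast
    ultimately show ?thesis using bij_betw_inv_into_right[OF BhD(1)[OF h]] unfolding h'_def by metis
  qed
  have Nf: "N f" and Ng: "N g" using f g unfolding locally_def by auto
  have "sim g q" using g q(2) r sim_sym sim_trans unfolding locally_def h'_def[symmetric]
      by (metis less_eq_Suc_le One_nat_def)
  then have "sim (f \<circ> g) (f \<circ> q)" by (rule N_comp_sim_left[OF Ng q(1) Nf])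
  also have "sim (f \<circ> q) ((h \<star> a) \<circ> q)"
    using locally_sim[OF BhD(3)[OF h] f a] ND[OF Nf] ND[OF q(1)] inj_on_D_conc[OF BhD(4)[OF h] a]
    by (intro sim_comp_right) auto
  also have "sim ((h \<star> a) \<circ> q) (\<lambda>y. ([Dot 0] @ w) \<frown> y)"
    by (rule sim_cong_on) (simp only: comp_def eq)
  also have "sim (\<lambda>y. ([Dot 0] @ w) \<frown> y) id" by (rule sim_id_conc)
  finally show ?thesis .
qed

lemma locally_U:
  assumes r: "1 \<le> r" and h: "Bh r h" and f: "locally r h f" shows "U f"
proof -
  define h' where "h' = inv_into (Cr r) h"
  have h': "Bh r h'" unfolding h'_def using Bh_inverse[OF h] .
  obtain g where g: "locally r h' g" using Bh_locally_ex[OF r h'] by blast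
  have fg: "sim (f \<circ> g) id" using locally_inverse[OF r h f] g unfolding h'_def .
  have "inv_into (Cr r) h' x = h x" if x: "x \<in> Cr r" for x
  proof -
    have "h x \<in> Cr r" using BhD(5)[OF h] x by blast
    then show ?thesis
      using bij_betw_inv_into_left[OF BhD(1)[OF h'], of "h x"] bij_betw_inv_into_left[OF BhD(1)[OF h] x]
      by (simp add: h'_def)
  qed
  then have "sim (h \<star> [Dot a]) (\<lambda>y. inv_into (Cr r) h' ([Dot a] \<frown> y))" if "a < r" for a
    using that by (intro sim_cong_on) (simp add: D_conc_iff)
  then have "locally r (inv_into (Cr r) h') f"
    using f sim_trans unfolding locally_def by blast
  from locally_inverse[OF r h' g this] fg show ?thesis
    using f g unfolding U_def locally_def by blast
qed

lemma mass_dotted: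
  assumes F: "\<And>a. a < r \<Longrightarrow> emb (F \<star> [Dot a])" "inj_on F (Cr r)"
    and m: "\<And>a. a < r \<Longrightarrow> [mass ((F \<star> [Dot a]) ` C) = m] (mod (n - 1))"
  shows "[mass (F ` Cr r) = r * m] (mod (n - 1))"
proof -
  have DU: "Cr r = (\<Union>a\<in>{..<r}. (\<lambda>y. [Dot a] \<frown> y) ` C)"
  proof (intro equalityI subsetI)
    fix x assume "x \<in> Cr r"
    then obtain i y where "i \<in> dots r" "y \<in> C" "x = [i] \<frown> y" by (rule D_cases)
    then show "x \<in> (\<Union>a\<in>{..<r}. (\<lambda>y. [Dot a] \<frown> y) ` C)" by (auto simp: dots_def)
  qed (auto simp: D_conc_iff)
  have "F ` Cr r = (\<Union>a\<in>{..<r}. (F \<star> [Dot a]) ` C)"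
    unfolding DU image_UN image_image ..
  moreover have "[mass (\<Union>a\<in>{..<r}. (F \<star> [Dot a]) ` C) = (\<Sum>a<r. mass ((F \<star> [Dot a]) ` C))] (mod (n - 1))"
  proof (rule mass_UN)
    fix a b assume ab: "a \<in> {..<r}" "b \<in> {..<r}" "a \<noteq> b"
    have False if "y \<in> C" "z \<in> C" "F ([Dot a] \<frown> y) = F ([Dot b] \<frown> z)" for y z
    proof -
      have "[Dot a] \<frown> y = [Dot b] \<frown> z"
        using inj_on_eq_iff[OF F(2), of "[Dot a] \<frown> y" "[Dot b] \<frown> z"] that ab by simp
      then show False using conc_inject[of "[Dot a]" y "[Dot b]" z] ab by simp
    qed
    then show "(F \<star> [Dot a]) ` C \<inter> (F \<star> [Dot b]) ` C = {}" by blast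
  qed (use F(1) embD(5) finite_prefix_emb in auto)
  moreover have "[(\<Sum>a<r. mass ((F \<star> [Dot a]) ` C)) = (\<Sum>a<r. m)] (mod (n - 1))"
    by (rule cong_sum) (use m in simp)
  ultimately show ?thesis using cong_trans by simp
qed

text \<open>The set \<open>Cr r\<close> is counted twice: as the union of the images under
  \<open>h\<close> of its \<open>r\<close> dotted cones, and as the union of these cones
  themselves.\<close>

lemma locally_mult_const:
  assumes h: "Bh r h" and f: "locally r h f"
  shows "[r * mult_const f = r] (mod (n - 1))"
proof -
  have m1: "[mass (h ` Cr r) = r * mult_const f] (mod (n - 1))"
  proof (rule mass_dotted[OF _ BhD(4)[OF h]])
    fix a assume a: "a < r"
    show e: "emb (h \<star> [Dot a])" using a by (intro Bh_emb[OF h]) auto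
    have "emb f" "sim f (h \<star> [Dot a])" using f a ND(2) unfolding locally_def by auto
    from mass_sim[OF this(1) e this(2)]
    show "[mass ((h \<star> [Dot a]) ` C) = mult_const f] (mod (n - 1))"
      unfolding mult_const_def by (rule cong_sym)
  qed
  \<comment> \<open>The second count is the same lemma, applied to the identity.\<close>
  have m2: "[mass (id ` Cr r) = r * 1] (mod (n - 1))"
  proof (rule mass_dotted)
    fix a assume a: "a < r"
    have "clp ((\<lambda>y. (Dot a # w) \<frown> y) ` C)" for w using clp_conc lev_C clp_def by blast
    then show "emb (id \<star> [Dot a])"
      using ucont_conc by (simp add: emb_def inj_on_def)
    have "[mass ((\<lambda>y. [Dot a] \<frown> y) ` C) = mass C] (mod (n - 1))"
      using lev_C by (intro mass_conc) (auto simp: clp_def)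
    then show "[mass ((id \<star> [Dot a]) ` C) = 1] (mod (n - 1))"
      using cong_trans[OF _ mult_const_id] by (simp add: mult_const_def)
  qed simp
  have "h ` Cr r = id ` Cr r" using BhD(1)[OF h] by (simp add: bij_betw_def)
  then have "[r * mult_const f = mass (id ` Cr r)] (mod (n - 1))" using cong_sym[OF m1] by simp
  from cong_trans[OF this m2] show ?thesis by simp
qed

lemma Core_locally:
  assumes r: "1 \<le> r" and h: "Bh r h" and f: "locally r h f"
  shows "Core n r h = Cl f"
  using Core_eq[OF r BhD(4,5,2,3)[OF h]] unfolding locally_QI[OF r f] Cl_def .

end

subsection \<open>The lexicographic order\<close>

text \<open>Forgetting the dot is harmless: in the spaces considered, each position carries letters
  of one kind only.\<close>

primrec lval :: "letter \<Rightarrow> nat" where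
  "lval (Ltr i) = i"
| "lval (Dot i) = i"

definition wless :: "letter word \<Rightarrow> letter word \<Rightarrow> bool" where
  "wless x y \<longleftrightarrow> (\<exists>k. (\<forall>j<k. x j = y j) \<and> lval (x k) < lval (y k))"

definition wle :: "letter word \<Rightarrow> letter word \<Rightarrow> bool" where
  "wle x y \<longleftrightarrow> x = y \<or> wless x y"

lemma prefix_eq_iff: "prefix k x = prefix k y \<longleftrightarrow> (\<forall>j<k. x j = y j)"
proof
  assume eq: "prefix k x = prefix k y"
  show "\<forall>j<k. x j = y j"
  proof (intro allI impI)
    fix j assume "j < k"
    then show "x j = y j" using arg_cong[OF eq, of "\<lambda>l. l ! j"] by simp
  qed
qed (auto intro: nth_equalityI)

lemma wlessI: "(\<And>j. j < k \<Longrightarrow> x j = y j) \<Longrightarrow> lval (x k) < lval (y k) \<Longrightarrow> wless x y"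
  unfolding wless_def by blast

lemma wless_irrefl [simp]: "\<not> wless x x"
  by (simp add: wless_def)

lemma wless_trans:
  assumes "wless x y" "wless y z" shows "wless x z"
proof -
  obtain k l where k: "\<forall>j<k. x j = y j" "lval (x k) < lval (y k)"
    and l: "\<forall>j<l. y j = z j" "lval (y l) < lval (z l)"
    using assms unfolding wless_def by blast
  show ?thesis
  proof (rule wlessI[of "min k l"])
    show "x j = z j" if "j < min k l" for j using k l that by simp
    show "lval (x (min k l)) < lval (z (min k l))"
      using k l by (cases k l rule: linorder_cases) (auto simp: min_def)
  qed
qed

lemma wless_asym: "wless x y \<Longrightarrow> \<not> wless y x"
  using wless_trans wless_irrefl by blast

lemma wle_trans: "wle x y \<Longrightarrow> wle y z \<Longrightarrow> wle x z"
  unfolding wle_def using wless_trans by blast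

lemma wle_wless: "wle x y \<Longrightarrow> wless y z \<Longrightarrow> wless x z"
  unfolding wle_def using wless_trans by blast

lemma wless_wle: "wless x y \<Longrightarrow> wle y z \<Longrightarrow> wless x z"
  unfolding wle_def using wless_trans by blast

lemma wless_conc [simp]: "wless (u \<frown> x) (u \<frown> y) \<longleftrightarrow> wless x y"
proof
  assume "wless x y"
  then obtain k where k: "\<forall>j<k. x j = y j" "lval (x k) < lval (y k)" unfolding wless_def by blast
  show "wless (u \<frown> x) (u \<frown> y)"
    by (rule wlessI[of "length u + k"]) (use k in \<open>auto simp: conc_def\<close>)
next
  assume "wless (u \<frown> x) (u \<frown> y)"
  then obtain k where k: "\<forall>j<k. (u \<frown> x) j = (u \<frown> y) j" "lval ((u \<frown> x) k) < lval ((u \<frown> y) k)"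
    unfolding wless_def by blast
  have l: "length u \<le> k" using k(2) by (rule_tac ccontr) (simp add: conc_def)
  show "wless x y"
  proof (rule wlessI[of "k - length u"])
    fix j assume "j < k - length u"
    then show "x j = y j" using k(1)[rule_format, of "length u + j"] by simp
  qed (use k(2) l in \<open>simp add: conc_def\<close>)
qed

lemma wle_conc [simp]: "wle (u \<frown> x) (u \<frown> y) \<longleftrightarrow> wle x y"
  by (simp add: wle_def)

lemma wless_first_letter: "lval a < lval b \<Longrightarrow> wless ((a # u) \<frown> x) ((b # v) \<frown> y)"
  by (rule wlessI[of 0]) auto

lemma wless_branch: "lval a < lval b \<Longrightarrow> wless ((w @ a # u) \<frown> x) ((w @ b # v) \<frown> y)"
  using wless_conc[of w "(a # u) \<frown> x" "(b # v) \<frown> y"] wless_first_letter[of a b u x v y] by simp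

text \<open>If \<open>r\<close> differs from \<open>q\<close> within the first \<open>k\<close>
  letters, the comparison is decided there, and \<open>p\<close> has the same letters.\<close>

lemma wless_prefix_cong:
  assumes "prefix k p = prefix k q" "prefix k q \<noteq> prefix k r"
  shows "wless r p \<longleftrightarrow> wless r q"
proof -
  have "wless r q" if pq: "prefix k p = prefix k q" "prefix k q \<noteq> prefix k r" and "wless r p" for p q
  proof -
    obtain l where l: "\<forall>j<l. r j = p j" "lval (r l) < lval (p l)" using \<open>wless r p\<close> unfolding wless_def
        by blast
    have "\<forall>j<k. p j = q j" "\<not> (\<forall>j<k. q j = r j)" using pq unfolding prefix_eq_iff by blast+
    then have "l < k" using l by (metis order_less_le_trans not_le)
    then show ?thesis using l \<open>\<forall>j<k. p j = q j\<close> by (intro wlessI[of l]) auto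
  qed
  then show ?thesis using assms by metis
qed

text \<open>In other words, cones are order-convex.\<close>

lemma wle_prefix_convex:
  assumes "wle a b" "wle b c" "prefix k a = prefix k c" shows "prefix k b = prefix k a"
proof (rule ccontr)
  assume ne: "prefix k b \<noteq> prefix k a"
  then have "wless a b" using assms(1) unfolding wle_def by auto
  then obtain l where l: "\<forall>j<l. a j = b j" "lval (a l) < lval (b l)" unfolding wless_def by blast
  have "l < k"
  proof (rule ccontr)
    assume "\<not> l < k"
    then have "prefix k b = prefix k a" using l unfolding prefix_eq_iff by auto
    then show False using ne by simp
  qed
  then have "wless c b" using l assms(3) unfolding prefix_eq_iff by (intro wlessI[of l]) auto
  then show False using assms(2) wless_asym unfolding wle_def by auto
qed

text \<open>Serves to number the cones of an image in lexicographic order.\<close>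

lemma increasing_enumeration:
  assumes "finite A" "transp_on A R" "totalp_on A R"
  shows "\<exists>f. bij_betw f {..<card A} A \<and> (\<forall>i j. i < j \<longrightarrow> j < card A \<longrightarrow> R (f i) (f j))"
  using assms
proof (induction "card A" arbitrary: A)
  case 0
  then show ?case by (auto simp: bij_betw_def)
next
  case (Suc m)
  have ne: "A \<noteq> {}" using Suc.hyps(2) by auto
  obtain g where g: "g \<in> A" "\<forall>x\<in>A. x \<noteq> g \<longrightarrow> R x g"
    using Finite_Set.bex_greatest_element[of A R] Suc.prems ne by blast
  have m: "m = card (A - {g})" using Suc.hyps(2) g(1) Suc.prems(1) by simp
  have "transp_on (A - {g}) R" "totalp_on (A - {g}) R"
    using transp_on_subset[OF Suc.prems(2)] totalp_on_subset[OF Suc.prems(3)] by blast+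
  then obtain f where f: "bij_betw f {..<m} (A - {g})" "\<forall>i j. i < j \<longrightarrow> j < m \<longrightarrow> R (f i) (f j)"
    using Suc.hyps(1)[OF m] Suc.prems(1) m by auto
  define f' where "f' = f(m := g)"
  have "bij_betw f' {..<m} (A - {g})"
    using f(1) bij_betw_cong[of "{..<m}" f f' "A - {g}"] by (simp add: f'_def)
  then have "bij_betw f' ({..<m} \<union> {m}) ((A - {g}) \<union> {g})"
    by (intro bij_betw_combine) (auto simp: f'_def bij_betw_def)
  moreover have "{..<m} \<union> {m} = {..<card A}" "(A - {g}) \<union> {g} = A" using Suc.hyps(2) g(1) by auto
  moreover have "R (f' i) (f' j)" if "i < j" "j < card A" for i j
  proof (cases "j = m")
    case True
    have "f i \<in> A - {g}" using bij_betwE[OF f(1)] that True by auto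
    then show ?thesis using g(2) that True by (simp add: f'_def)
  next
    case False
    then show ?thesis using f(2) that Suc.hyps(2) by (simp add: f'_def)
  qed
  ultimately show ?case by auto
qed

context alphabet
begin

abbreviation "zeros \<equiv> (\<lambda>_::nat. Ltr 0)"
abbreviation "tops \<equiv> (\<lambda>_::nat. Ltr (n - 1))"

lemma zeros_tops_in_C [simp]: "zeros \<in> C" "tops \<in> C" "(\<lambda>_. Ltr (n - Suc 0)) \<in> C"
  using two_le by (auto intro: const_in_C)

lemma lval_X: "a \<in> X \<Longrightarrow> lval a \<le> n - 1"
  by (auto simp: Xn_def)

lemma inj_lval: "inj_on lval X" "inj_on lval (dots r)"
  by (auto simp: inj_on_def Xn_def dots_def)

lemma wless_linear_D:
  assumes "inj_on lval I" "x \<in> D I" "y \<in> D I" "x \<noteq> y" shows "wless x y \<or> wless y x"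
proof -
  define k where "k = (LEAST k. x k \<noteq> y k)"
  have k: "x k \<noteq> y k" "\<And>j. j < k \<Longrightarrow> x j = y j"
    using assms(4) LeastI_ex[of "\<lambda>k. x k \<noteq> y k"] not_less_Least[of _ "\<lambda>k. x k \<noteq> y k"]
    unfolding k_def by blast+
  have "inj_on lval (if k = 0 then I else X)" using assms(1) inj_lval by simp
  then have "lval (x k) \<noteq> lval (y k)" using k(1) assms(2,3) unfolding D_iff by (metis inj_onD)
  then show ?thesis using k(2) wlessI[of k x y] wlessI[of k y x] by (metis linorder_neqE_nat)
qed

lemma wless_linear: "x \<in> C \<Longrightarrow> y \<in> C \<Longrightarrow> x \<noteq> y \<Longrightarrow> wless x y \<or> wless y x"
  using wless_linear_D[of X x y] inj_lval by simp

lemma zeros_le: "y \<in> C \<Longrightarrow> wle zeros y"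
  using wless_linear[of zeros y] unfolding wle_def wless_def by auto

lemma le_tops: "y \<in> C \<Longrightarrow> wle y tops"
proof -
  assume y: "y \<in> C"
  have "\<not> wless tops y"
  proof
    assume "wless tops y"
    then obtain k where "n - 1 < lval (y k)" unfolding wless_def by auto
    moreover have "y k \<in> X" using y by (simp add: C_def)
    ultimately show False using lval_X by fastforce
  qed
  then show "wle y tops" using wless_linear[OF y zeros_tops_in_C(2)] unfolding wle_def by blast
qed

lemma C_cases: "x \<in> C \<Longrightarrow> \<exists>i y. i < n \<and> y \<in> C \<and> x = [Ltr i] \<frown> y"
proof -
  assume "x \<in> C"
  then have "x \<in> D X" by simp
  then obtain a y where a: "a \<in> X" "y \<in> C" "x = [a] \<frown> y" by (rule D_cases)
  then obtain i where "a = Ltr i" "i < n" by (auto simp: Xn_def)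
  then show ?thesis using a by blast
qed

text \<open>A discrete form of the connectedness of intervals: \<open>C\<close> becomes an interval once each pair
  \<open>w i (n-1) (n-1) \<dots>\<close>, \<open>w (i+1) 0 0 \<dots>\<close> is glued.\<close>

lemma interval_connected:
  assumes loc: "\<And>x y. x \<in> C \<Longrightarrow> y \<in> C \<Longrightarrow> wle b x \<Longrightarrow> wle x c \<Longrightarrow> wle b y \<Longrightarrow> wle y c \<Longrightarrow>
      prefix k x = prefix k y \<Longrightarrow> P x = P y"
    and adj: "\<And>u i. u \<in> Xs \<Longrightarrow> Suc i < n \<Longrightarrow> wle b ((u @ [Ltr i]) \<frown> tops) \<Longrightarrow>
        wle ((u @ [Ltr (Suc i)]) \<frown> zeros) c \<Longrightarrow>
      P ((u @ [Ltr i]) \<frown> tops) = P ((u @ [Ltr (Suc i)]) \<frown> zeros)"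
    and xy: "x \<in> C" "y \<in> C" "wle b x" "wle x c" "wle b y" "wle y c"
  shows "P x = P y"
proof -
  \<comment> \<open>\<open>j\<close> counts the letters missing from a cone of length
    \<open>k\<close>, on which \<open>P\<close> is constant by \<open>loc\<close>.\<close>
  have claim: "P (u \<frown> x) = P (u \<frown> y)"
    if "length u + j = k" "u \<in> Xs" "x \<in> C" "y \<in> C" "wle b (u \<frown> x)" "wle (u \<frown> x) c" "wle b (u \<frown> y)"
        "wle (u \<frown> y) c" for u j x y
    using that
  proof (induction j arbitrary: u x y)
    case 0
    then have "prefix k (u \<frown> x) = prefix k (u \<frown> y)" by auto
    then show ?case using 0 by (intro loc) simp_all
  next
    case (Suc j)
    have cone: "P ((u @ [Ltr i]) \<frown> x) = P ((u @ [Ltr i]) \<frown> y)"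
      if "i < n" "x \<in> C" "y \<in> C" "wle b ((u @ [Ltr i]) \<frown> x)" "wle ((u @ [Ltr i]) \<frown> x) c"
        "wle b ((u @ [Ltr i]) \<frown> y)" "wle ((u @ [Ltr i]) \<frown> y) c" for i x y
      using Suc.prems(1,2) that by (intro Suc.IH) auto
    \<comment> \<open>Walk through the sibling cones between the letters \<open>i\<close> and
      \<open>i'\<close> and cross each boundary at a glued pair. The pair lies between the two given
      points, so it respects the bounds \<open>b\<close> and \<open>c\<close>.\<close>
    have chain: "P ((u @ [Ltr i]) \<frown> x) = P ((u @ [Ltr i']) \<frown> y)"
      if "i \<le> i'" "i' < n" "x \<in> C" "y \<in> C" "wle b ((u @ [Ltr i]) \<frown> x)" "wle ((u @ [Ltr i]) \<frown> x) c"
        "wle b ((u @ [Ltr i']) \<frown> y)" "wle ((u @ [Ltr i']) \<frown> y) c"  for i i' x y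
      using that
    proof (induction i' arbitrary: y rule: dec_induct)
      case base
      then show ?case by (intro cone)
    next
      case (step i')
      define t s where "t = (u @ [Ltr i']) \<frown> tops" and "s = (u @ [Ltr (Suc i')]) \<frown> zeros"
      have "wless ((u @ [Ltr i]) \<frown> x) ((u @ [Ltr i']) \<frown> tops) \<or>
          wle ((u @ [Ltr i]) \<frown> x) ((u @ [Ltr i']) \<frown> tops)"
        using step.hyps(1) le_tops[OF step.prems(2)] wless_branch[of "Ltr i" "Ltr i'" u "[]" x "[]" tops]
        by (cases "i = i'") auto
      then have xt: "wle ((u @ [Ltr i]) \<frown> x) t" unfolding t_def wle_def by blast
      have ts: "wle t s"
        unfolding t_def s_def wle_def using wless_branch[of "Ltr i'"
            "Ltr (Suc i')" u "[]" tops "[]" zeros] by simp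
      have sy: "wle s ((u @ [Ltr (Suc i')]) \<frown> y)"
        unfolding s_def wle_conc using zeros_le[OF step.prems(3)] .
      have bt: "wle b t" using wle_trans[OF step.prems(4) xt] .
      have bs: "wle b s" using wle_trans[OF bt ts] .
      have sc: "wle s c" using wle_trans[OF sy step.prems(7)] .
      have tc: "wle t c" using wle_trans[OF ts sc] .
      have "P ((u @ [Ltr i]) \<frown> x) = P t"
        unfolding t_def using step.prems step.hyps bt tc by (intro step.IH) (auto simp: t_def)
      also have "P t = P s"
        unfolding t_def s_def using Suc.prems(2) step.prems(1) bt sc
            by (intro adj) (auto simp: t_def s_def)
      also have "P s = P ((u @ [Ltr (Suc i')]) \<frown> y)"
        unfolding s_def using step.prems bs sc by (intro cone) (auto simp: s_def)
      finally show ?case .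
    qed
    obtain i x' where x: "x = [Ltr i] \<frown> x'" "i < n" "x' \<in> C"
      using C_cases[OF Suc.prems(3)] by blast
    obtain i' y' where y: "y = [Ltr i'] \<frown> y'" "i' < n" "y' \<in> C"
      using C_cases[OF Suc.prems(4)] by blast
    have ux: "u \<frown> x = (u @ [Ltr i]) \<frown> x'" "u \<frown> y = (u @ [Ltr i']) \<frown> y'" by (simp_all add: x y)
    show ?case
    proof (cases "i \<le> i'")
      case True
      then show ?thesis using Suc.prems(5-8) x y unfolding ux by (intro chain)
    next
      case False
      then show ?thesis using Suc.prems(5-8) x y unfolding ux by (intro chain[symmetric]) auto
    qed
  qed
  show ?thesis using claim[of "[]" k x y] xy by simp
qed

section \<open>Monotone maps and maps that respect glued pairs\<close>

definition inc :: "(letter word \<Rightarrow> letter word) \<Rightarrow> bool" where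
  "inc f \<longleftrightarrow> (\<forall>x\<in>C. \<forall>y\<in>C. wless x y \<longrightarrow> wless (f x) (f y))"

definition dec :: "(letter word \<Rightarrow> letter word) \<Rightarrow> bool" where
  "dec f \<longleftrightarrow> (\<forall>x\<in>C. \<forall>y\<in>C. wless x y \<longrightarrow> wless (f y) (f x))"

text \<open>No point of \<open>C\<close> separates the images of a glued pair: this is what the
  intermediate value argument uses of the invariance of \<simeq>.\<close>

definition adj_preserving :: "(letter word \<Rightarrow> letter word) \<Rightarrow> bool" where
  "adj_preserving f \<longleftrightarrow> (\<forall>u\<in>Xs. \<forall>i. Suc i < n \<longrightarrow> (\<forall>z\<in>C.
     \<not> (wless (f ((u @ [Ltr i]) \<frown> tops)) z \<and> wless z (f ((u @ [Ltr (Suc i)]) \<frown> zeros))) \<and>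
     \<not> (wless (f ((u @ [Ltr (Suc i)]) \<frown> zeros)) z \<and> wless z (f ((u @ [Ltr i]) \<frown> tops)))))"

text \<open>While \<open>y\<close> runs through the interval from \<open>b\<close> to
  \<open>c\<close>, the value \<open>f y\<close> stays away from \<open>f a\<close>. So the side of
  \<open>f a\<close> on which it lies is uniformly locally constant, and it does not change across
  glued pairs; \<open>interval_connected\<close> applies.\<close>

lemma no_fold:
  assumes f: "emb f" "f \<in> C \<rightarrow> C" "adj_preserving f"
    and a: "a \<in> C" and bc: "b \<in> C" "c \<in> C" "wle b c" and out: "wless a b \<or> wless c a"
  shows "wless (f a) (f b) \<longleftrightarrow> wless (f a) (f c)"
proof -
  have fC: "f x \<in> C" if "x \<in> C" for x using f(2) that by blast
  \<comment> \<open>The end of the interval that is nearer to \<open>a\<close>. A cone around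
    \<open>a\<close> without it misses the interval altogether, as cones are convex.\<close>
  have "\<exists>m. prefix m a \<noteq> prefix m (if wless a b then b else c)"
  proof (rule ccontr)
    assume "\<not> (\<exists>m. prefix m a \<noteq> prefix m (if wless a b then b else c))"
    then have "a = (if wless a b then b else c)" by (intro words_eq_if_prefixes) blast
    then show False using out wless_irrefl by metis
  qed
  then obtain m where m: "prefix m a \<noteq> prefix m (if wless a b then b else c)" by blast
  define w where "w = prefix m a"
  have w: "w \<in> Xs" "length w = m" using a by (auto simp: w_def)
  \<comment> \<open>The image of this cone is a union of cones of length \<open>M\<close>. If
    \<open>f y\<close> shared \<open>M\<close> letters with \<open>f a\<close>, it would lie in that
    image, and injectivity would put \<open>y\<close> into the cone.\<close>
  obtain M where M: "lev M ((f \<star> w) ` C)" using embD(4)[OF f(1) w(1)] unfolding clp_def by blast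
  have ne: "prefix M (f y) \<noteq> prefix M (f a)" if y: "y \<in> C" "wle b y" "wle y c" for y
  proof
    assume eq: "prefix M (f y) = prefix M (f a)"
    have "f a = f (w \<frown> suffix m a)" by (simp add: w_def)
    then have "f a \<in> (f \<star> w) ` C" using a by (rule image_eqI[OF _ suffix_in_C])
    then have "prefix M (f a) \<frown> suffix M (f y) \<in> (f \<star> w) ` C"
      using M suffix_in_C[OF fC[OF y(1)], of M] unfolding lev_def by blast
    then have "f y \<in> (f \<star> w) ` C" unfolding eq[symmetric] by simp
    then obtain z where z: "z \<in> C" "f y = f (w \<frown> z)" by blast
    then have "y = w \<frown> z" using inj_on_eq_iff[OF embD(1)[OF f(1)], of y "w \<frown> z"] y(1) w by simp
    then have py: "prefix m y = prefix m a" using w unfolding w_def by (simp add: prefix_conc_drop)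
    show False
    proof (cases "wless a b")
      case True
      then have "prefix m b = prefix m a"
        using wle_prefix_convex[of a b y m] y(2) py unfolding wle_def by simp
      then show False using m True by simp
    next
      case False
      then have "wless c a" using out by simp
      then have "prefix m c = prefix m y"
        using wle_prefix_convex[of y c a m] y(3) py unfolding wle_def by simp
      then show False using m False py by simp
    qed
  qed
  obtain k where k: "\<And>x y. x \<in> C \<Longrightarrow> y \<in> C \<Longrightarrow> prefix k x = prefix k y \<Longrightarrow> prefix M (f x) = prefix M (f y)"
    using ucontD[OF embD(2)[OF f(1)]] by metis
  have strict: "wless (f a) (f y) \<or> wless (f y) (f a)" if "y \<in> C" "wle b y" "wle y c" for y
  proof -
    have "f a \<noteq> f y" using ne[OF that] by auto
    then show ?thesis using wless_linear fC a that(1) by blast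
  qed
  show ?thesis
  proof (rule interval_connected[where P = "\<lambda>y. wless (f a) (f y)" and b = b and c = c and k = k])
    fix x y assume *: "x \<in> C" "y \<in> C" "wle b x" "wle x c" "wle b y" "wle y c" "prefix k x = prefix k y"
    show "wless (f a) (f x) = wless (f a) (f y)"
      using wless_prefix_cong[OF k[OF *(1,2,7)] ne[OF *(2,5,6)]] .
  next
    fix u i assume u: "u \<in> Xs" "Suc i < n"
    define t s where "t = (u @ [Ltr i]) \<frown> tops" and "s = (u @ [Ltr (Suc i)]) \<frown> zeros"
    assume "wle b ((u @ [Ltr i]) \<frown> tops)" "wle ((u @ [Ltr (Suc i)]) \<frown> zeros) c"
    then have bt: "wle b t" and sc: "wle s c" by (simp_all add: t_def s_def)
    have ts: "wle t s"
      unfolding t_def s_def wle_def using wless_branch[of "Ltr i" "Ltr (Suc i)" u "[]" tops "[]" zeros]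
          by simp
    have C: "t \<in> C" "s \<in> C" using u by (auto simp: t_def s_def)
    have "\<not> (wless (f t) (f a) \<and> wless (f a) (f s)) \<and> \<not> (wless (f s) (f a) \<and> wless (f a) (f t))"
      using f(3) u fC[OF a] unfolding adj_preserving_def t_def s_def by blast
    then have "wless (f a) (f t) = wless (f a) (f s)"
      using strict[OF C(1) bt wle_trans[OF ts sc]] strict[OF C(2) wle_trans[OF bt ts] sc] by blast
    then show "wless (f a) (f ((u @ [Ltr i]) \<frown> tops)) = wless (f a) (f ((u @ [Ltr (Suc i)]) \<frown> zeros))"
      by (simp add: t_def s_def)
  qed (use bc in \<open>auto simp: wle_def\<close>)
qed

text \<open>By \<open>no_fold\<close> the direction of \<open>f\<close> on a pair \<open>x\<close>,
  \<open>y\<close> is that on \<open>x\<close>, \<open>tops\<close>, and this in turn is that on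
  \<open>zeros\<close>, \<open>tops\<close>.\<close>

lemma adj_preserving_monotone:
  assumes f: "emb f" "f \<in> C \<rightarrow> C" "adj_preserving f"
  shows "inc f \<or> dec f"
proof -
  have lin: "wless (f x) (f y) \<or> wless (f y) (f x)" if xy: "x \<in> C" "y \<in> C" "wless x y" for x y
  proof -
    have "x \<noteq> y" using xy by auto
    then have "f x \<noteq> f y" using inj_on_eq_iff[OF embD(1)[OF f(1)]] xy by blast
    moreover have "f x \<in> C" "f y \<in> C" using f(2) xy by blast+
    ultimately show ?thesis using wless_linear by blast
  qed
  have top: "wless (f x) (f y) \<longleftrightarrow> wless (f x) (f tops)" if xy: "x \<in> C" "y \<in> C" "wless x y" for x y
    using no_fold[OF f xy(1,2) zeros_tops_in_C(2) le_tops[OF xy(2)]] xy(3) by blast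
  have bot: "wless (f tops) (f x) \<longleftrightarrow> wless (f tops) (f zeros)" if x: "x \<in> C" "wless x tops" for x
    using no_fold[OF f zeros_tops_in_C(2,1) x(1) zeros_le[OF x(1)]] x(2) by blast
  have xtop: "wless x tops" if "x \<in> C" "y \<in> C" "wless x y" for x y
    using wless_wle[OF that(3) le_tops[OF that(2)]] .
  show ?thesis
  proof (cases "wless (f tops) (f zeros)")
    case True
    have "wless (f y) (f x)" if xy: "x \<in> C" "y \<in> C" "wless x y" for x y
      using lin[OF xy] top[OF xy] bot[OF xy(1) xtop[OF xy]] True wless_asym by blast
    then show ?thesis unfolding dec_def by blast
  next
    case False
    have "wless (f x) (f y)" if xy: "x \<in> C" "y \<in> C" "wless x y" for x y
      using lin[OF xy(1) zeros_tops_in_C(2) xtop[OF xy]] top[OF xy] bot[OF xy(1) xtop[OF xy]] False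
          by blast
    then show ?thesis unfolding inc_def by blast
  qed
qed

section \<open>The relation \<simeq> in terms of the order\<close>

definition covers :: "letter word set \<Rightarrow> letter word \<Rightarrow> letter word \<Rightarrow> bool" where
  "covers A x y \<longleftrightarrow> x \<in> A \<and> y \<in> A \<and> wless x y \<and> (\<forall>z\<in>A. \<not> (wless x z \<and> wless z y))"

lemma D_letter: "x \<in> Cr r \<Longrightarrow> 0 < k \<Longrightarrow> x k \<in> X"
  unfolding D_iff by (drule spec[of _ k]) simp

lemma wless_linear_dots: "x \<in> Cr r \<Longrightarrow> y \<in> Cr r \<Longrightarrow> x \<noteq> y \<Longrightarrow> wless x y \<or> wless y x"
  using wless_linear_D inj_lval(2) .

text \<open>A word strictly in between would have to leave the common part exactly after
  \<open>u\<close>, with a letter strictly between two consecutive ones.\<close>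

lemma covers_branch:
  assumes "(u @ [a]) \<frown> tops \<in> Cr r" "(u @ [b]) \<frown> zeros \<in> Cr r" "lval b = Suc (lval a)"
  shows "covers (Cr r) ((u @ [a]) \<frown> tops) ((u @ [b]) \<frown> zeros)"
proof -
  define x y where "x = (u @ [a]) \<frown> tops" and "y = (u @ [b]) \<frown> zeros"
  have ne: "\<not> (wless x z \<and> wless z y)" if z: "z \<in> Cr r" for z
  proof
    assume *: "wless x z \<and> wless z y"
    obtain k where k: "\<forall>j<k. x j = z j" "lval (x k) < lval (z k)" using * unfolding wless_def by blast
    obtain l where l: "\<forall>j<l. z j = y j" "lval (z l) < lval (y l)" using * unfolding wless_def by blast
    have k_le: "k \<le> length u"
    proof (rule ccontr)
      assume "\<not> k \<le> length u"
      then have "x k = Ltr (n - 1)" unfolding x_def by simp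
      moreover have "z k \<in> X" using D_letter[OF z, of k] \<open>\<not> k \<le> length u\<close> by simp
      ultimately show False using k(2) lval_X[of "z k"] by simp
    qed
    have l_le: "l \<le> length u"
    proof (rule ccontr)
      assume "\<not> l \<le> length u"
      then have "y l = Ltr 0" unfolding y_def by simp
      then show False using l(2) by simp
    qed
    have eq: "x j = y j" if "j < length u" for j
      using that by (simp add: x_def y_def nth_append)
    have at: "x (length u) = a" "y (length u) = b" by (simp_all add: x_def y_def)
    consider "k < length u" | "l < length u" | "k = length u" "l = length u" using k_le l_le by linarith
    then show False
    proof cases
      case 1
      then have "lval (y k) < lval (z k)" using k eq by simp
      moreover have "\<forall>j<k. y j = z j" using k(1) eq 1 by auto
      ultimately have "wless y z" by (intro wlessI[of k]) auto
      then show False using * wless_asym by blast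
    next
      case 2
      then have "lval (z l) < lval (x l)" using l eq by simp
      moreover have "\<forall>j<l. z j = x j" using l(1) eq 2 by auto
      ultimately have "wless z x" by (intro wlessI[of l]) auto
      then show False using * wless_asym by blast
    next
      case 3
      then show False using k(2) l(2) at assms(3) by simp
    qed
  qed
  have "wless x y" unfolding x_def y_def
    using wless_branch[of a b u "[]" tops "[]" zeros] assms(3) by simp
  then show ?thesis using assms(1,2) ne unfolding covers_def x_def y_def by blast
qed

text \<open>Apart from the pair that closes the circle, \<simeq> is determined by the order. If
  \<open>x\<close> is covered by \<open>y\<close> and they branch after \<open>u\<close>, then the
  largest word below the letter of \<open>x\<close> and the smallest below the letter of
  \<open>y\<close> must be \<open>x\<close> and \<open>y\<close> themselves.\<close>

lemma circ_rel_covers: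
  assumes r: "1 \<le> r"
  shows "circ_rel n r x y \<longleftrightarrow> x \<in> Cr r \<and> y \<in> Cr r \<and>
    (x = y \<or> covers (Cr r) x y \<or> covers (Cr r) y x \<or>
     {x, y} = {[Dot 0] \<frown> zeros, [Dot (r - 1)] \<frown> tops})"
    (is "_ \<longleftrightarrow> ?R")
proof
  assume c: "circ_rel n r x y"
  then have D: "x \<in> Cr r" "y \<in> Cr r" unfolding circ_rel_def topspace_cantor by auto
  consider "x = y"
    | w i where "w \<in> Xr_plus n r" "0 < i" "i \<le> n - 1"
        "{x, y} = {(w @ [Ltr i]) \<frown> zeros, (w @ [Ltr (i - 1)]) \<frown> tops}"
    | a where "0 < a" "a \<le> r - 1" "{x, y} = {[Dot a] \<frown> zeros, [Dot (a - 1)] \<frown> tops}"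
    | "{x, y} = {[Dot 0] \<frown> zeros, [Dot (r - 1)] \<frown> tops}"
    using c unfolding circ_rel_def Let_def by blast
  then show ?R
  proof cases
    case (2 w i)
    have "(w @ [Ltr (i - 1)]) \<frown> tops \<in> Cr r" "(w @ [Ltr i]) \<frown> zeros \<in> Cr r"
    proof -
      have "(w @ [Ltr (i - 1)]) \<frown> tops \<in> {x, y}" "(w @ [Ltr i]) \<frown> zeros \<in> {x, y}" unfolding 2(4)
          by blast+
      then show "(w @ [Ltr (i - 1)]) \<frown> tops \<in> Cr r" "(w @ [Ltr i]) \<frown> zeros \<in> Cr r"
        using D by (auto simp only:)
    qed
    from covers_branch[OF this] show ?thesis using 2 D by (auto simp: doubleton_eq_iff)
  next
    case (3 a)
    have "([] @ [Dot (a - 1)]) \<frown> tops \<in> Cr r" "([] @ [Dot a]) \<frown> zeros \<in> Cr r"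
      using 3 r by auto
    from covers_branch[OF this] show ?thesis using 3 D by (auto simp: doubleton_eq_iff)
  qed (use D in blast)+
next
  have cov: "circ_rel n r x y \<and> circ_rel n r y x" if c: "covers (Cr r) x y" for x y
  proof -
    have D: "x \<in> Cr r" "y \<in> Cr r" and xy: "wless x y"
      and no: "\<And>z. z \<in> Cr r \<Longrightarrow> wless x z \<Longrightarrow> wless z y \<Longrightarrow> False"
      using c unfolding covers_def by blast+
    obtain k where k: "\<forall>j<k. x j = y j" "lval (x k) < lval (y k)" using xy unfolding wless_def by blast
    define u where "u = prefix k x"
    have uy: "u = prefix k y" unfolding u_def using k(1) prefix_eq_iff by blast
    have xs: "prefix (Suc k) x = u @ [x k]" "prefix (Suc k) y = u @ [y k]"
      by (simp add: u_def, simp add: uy)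
    have x_eq: "x = (u @ [x k]) \<frown> suffix (Suc k) x" unfolding xs(1)[symmetric] by (rule prefix_suffix)
    have y_eq: "y = (u @ [y k]) \<frown> suffix (Suc k) y" unfolding xs(2)[symmetric] by (rule prefix_suffix)
    have sC: "suffix (Suc k) x \<in> C" "suffix (Suc k) y \<in> C" using suffix_D_in_C D by simp_all
    have W: "u @ [x k] \<in> W (dots r)" "u @ [y k] \<in> W (dots r)"
      unfolding xs[symmetric] using prefix_in_W D by blast+
    have tD: "(u @ [x k]) \<frown> tops \<in> Cr r" "(u @ [y k]) \<frown> zeros \<in> Cr r"
      using W D_conc_iff[of "u @ [x k]" tops "dots r"] D_conc_iff[of "u @ [y k]" zeros "dots r"] by auto
    have "wle x ((u @ [x k]) \<frown> tops)"
      by (subst x_eq) (simp only: wle_conc le_tops[OF sC(1)])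
    moreover have "wless ((u @ [x k]) \<frown> tops) y"
      using wless_branch[of "x k" "y k" u "[]" tops "[]" "suffix (Suc k) y"] k(2) y_eq by simp
    ultimately have x: "x = (u @ [x k]) \<frown> tops" using no[OF tD(1)] unfolding wle_def by blast
    have "wle ((u @ [y k]) \<frown> zeros) y"
      by (subst (2) y_eq) (simp only: wle_conc zeros_le[OF sC(2)])
    moreover have "wless x ((u @ [y k]) \<frown> zeros)"
      using wless_branch[of "x k" "y k" u "[]" "suffix (Suc k) x" "[]" zeros] k(2) x_eq by simp
    ultimately have y: "y = (u @ [y k]) \<frown> zeros" using no[OF tD(2)] unfolding wle_def by auto
    \<comment> \<open>The letter following that of \<open>x\<close>, of the kind proper to position
      \<open>k\<close>. If it were not the letter of \<open>y\<close>, a word through it would lie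
      between \<open>x\<close> and \<open>y\<close>.\<close>
    define c where "c = (if k = 0 then Dot (Suc (lval (x k))) else Ltr (Suc (lval (x k))))"
    have letters: "x k \<in> (if k = 0 then dots r else X)" "y k \<in> (if k = 0 then dots r else X)"
      using D unfolding D_iff by blast+
    have c: "c \<in> (if k = 0 then dots r else X)" "lval c = Suc (lval (x k))"
      using letters k(2) by (auto simp: c_def dots_def Xn_def split: if_splits)
    have lv: "lval (y k) = Suc (lval (x k))"
    proof (rule ccontr)
      assume "lval (y k) \<noteq> Suc (lval (x k))"
      then have lt: "lval c < lval (y k)" using k(2) c by simp
      define z where "z = (u @ [c]) \<frown> zeros"
      have "u @ [c] \<in> W (dots r)"
        using W(1) c(1) by (cases u) (auto simp: u_def append_in_W split: if_splits)
      then have "z \<in> Cr r" unfolding z_def using D_conc_iff[of "u @ [c]" zeros "dots r"] by simp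
      moreover have "wless x z" unfolding z_def
        using wless_branch[of "x k" c u "[]" "suffix (Suc k) x" "[]" zeros] c(2) x_eq by simp
      moreover have "wless z y" unfolding z_def
        using wless_branch[of c "y k" u "[]" zeros "[]" "suffix (Suc k) y"] lt y_eq by simp
      ultimately show False using no by blast
    qed
    show ?thesis
    proof (cases "k = 0")
      case True
      then obtain a b where ab: "x k = Dot a" "y k = Dot b" "b < r" using letters
          by (auto simp: dots_def)
      then have b: "b = Suc a" using lv by simp
      have "x = [Dot (b - 1)] \<frown> tops" "y = [Dot b] \<frown> zeros"
        using x y ab b True by (simp_all add: u_def)
      moreover have "0 < b" "b \<le> r - 1" using b ab by auto
      ultimately show ?thesis using D unfolding circ_rel_def topspace_cantor Let_def by blast
    next
      case False
      then obtain a b where ab: "x k = Ltr a" "y k = Ltr b" "b < n" using letters by (auto simp: Xn_def)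
      then have b: "b = Suc a" using lv by simp
      have "u \<in> Xr_plus n r" unfolding Xr_plus_eq u_def using prefix_in_W[OF D(1)] False by simp
      moreover have "x = (u @ [Ltr (b - 1)]) \<frown> tops" "y = (u @ [Ltr b]) \<frown> zeros"
        using x y ab b by simp_all
      moreover have "0 < b" "b \<le> n - 1" using b ab by auto
      ultimately show ?thesis using D unfolding circ_rel_def topspace_cantor Let_def by blast
    qed
  qed
  assume R: ?R
  then consider "x = y" | "covers (Cr r) x y" | "covers (Cr r) y x" | "{x, y} = {[Dot 0] \<frown> zeros, [Dot
      (r - 1)] \<frown> tops}"
    by blast
  then show "circ_rel n r x y"
  proof cases
    case 4
    then show ?thesis using R unfolding circ_rel_def topspace_cantor Let_def by simp
  qed (use cov R in \<open>simp_all add: circ_rel_def topspace_cantor Let_def\<close>)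
qed

subsection \<open>Realizing classes by homeomorphisms\<close>

text \<open>A partition of \<open>Cr r\<close> into cones listed in increasing order. Splitting the
  first cone into its \<open>n\<close> subcones adds \<open>n - 1\<close> cones and keeps the list
  increasing.\<close>

lemma ordered_code:
  assumes r: "1 \<le> r"
  shows "\<exists>\<mu>. (\<forall>j<r + s * (n - 1). \<mu> j \<in> W (dots r) \<and> \<mu> j \<noteq> []) \<and>
    (\<forall>x\<in>Cr r. \<exists>j<r + s * (n - 1). \<exists>z\<in>C. x = \<mu> j \<frown> z) \<and>
    (\<forall>i j. i < j \<longrightarrow> j < r + s * (n - 1) \<longrightarrow> (\<forall>y\<in>C. \<forall>z\<in>C. wless (\<mu> i \<frown> y) (\<mu> j \<frown> z)))"
proof (induction s)
  case 0
  have "\<exists>j<r. \<exists>z\<in>C. x = [Dot j] \<frown> z" if "x \<in> Cr r" for x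
    using that by (rule D_cases) (auto simp: dots_def)
  then show ?case
    by (intro exI[of _ "\<lambda>j. [Dot j]"]) (auto intro: wless_first_letter)
next
  case (Suc s)
  then obtain \<mu> where \<mu>0: "(\<forall>j<r + s * (n - 1). \<mu> j \<in> W (dots r) \<and> \<mu> j \<noteq> []) \<and>
    (\<forall>x\<in>Cr r. \<exists>j<r + s * (n - 1). \<exists>z\<in>C. x = \<mu> j \<frown> z) \<and>
    (\<forall>i j. i < j \<longrightarrow> j < r + s * (n - 1) \<longrightarrow> (\<forall>y\<in>C. \<forall>z\<in>C. wless (\<mu> i \<frown> y) (\<mu> j \<frown> z)))" ..
  then have \<mu>: "\<And>j. j < r + s * (n - 1) \<Longrightarrow> \<mu> j \<in> W (dots r) \<and> \<mu> j \<noteq> []"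
    "\<And>x. x \<in> Cr r \<Longrightarrow> \<exists>j<r + s * (n - 1). \<exists>z\<in>C. x = \<mu> j \<frown> z"
    "\<And>i j y z. i < j \<Longrightarrow> j < r + s * (n - 1) \<Longrightarrow> y \<in> C \<Longrightarrow> z \<in> C \<Longrightarrow> wless (\<mu> i \<frown> y) (\<mu> j \<frown> z)"
    by simp_all
  define \<nu> where "\<nu> j = (if j < n then \<mu> 0 @ [Ltr j] else \<mu> (j - (n - 1)))" for j
  define m where "m = r + s * (n - 1)"
  have eq: "r + Suc s * (n - 1) = m + (n - 1)" by (simp add: m_def)
  have m0: "0 < m" using r by (simp add: m_def)
  show ?case unfolding eq
  proof (intro exI[of _ \<nu>] conjI allI impI ballI)
    fix j assume j: "j < m + (n - 1)"
    show "\<nu> j \<in> W (dots r)" "\<nu> j \<noteq> []"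
      using \<mu>(1)[of 0] \<mu>(1)[of "j - (n - 1)"] j m0 two_le unfolding \<nu>_def m_def[symmetric]
      by (auto simp: append_in_W)
  next
    fix x assume "x \<in> Cr r"
    then obtain j z where j: "j < m" "z \<in> C" "x = \<mu> j \<frown> z" using \<mu>(2) unfolding m_def by blast
    show "\<exists>j<m + (n - 1). \<exists>z\<in>C. x = \<nu> j \<frown> z"
    proof (cases "j = 0")
      case True
      obtain i z' where i: "i < n" "z' \<in> C" "z = [Ltr i] \<frown> z'" using C_cases[OF j(2)] by blast
      have "x = \<nu> i \<frown> z'" using j True i by (simp add: \<nu>_def)
      moreover have "i < m + (n - 1)" using i m0 by linarith
      ultimately show ?thesis using i by blast
    next
      case False
      then have "\<not> j + (n - 1) < n" using two_le by linarith
      then have "x = \<nu> (j + (n - 1)) \<frown> z" unfolding \<nu>_def using j by simp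
      moreover have "j + (n - 1) < m + (n - 1)" using j by simp
      ultimately show ?thesis using j(2) by blast
    qed
  next
    fix i j y z assume ij: "i < j" "j < m + (n - 1)" and y: "y \<in> C" and z: "z \<in> C"
    consider "j < n" | "i < n" "n \<le> j" | "n \<le> i" using ij by linarith
    then show "wless (\<nu> i \<frown> y) (\<nu> j \<frown> z)"
    proof cases
      case 1
      then show ?thesis using wless_branch[of "Ltr i" "Ltr j" "\<mu> 0" "[]" y "[]" z] ij
          by (simp add: \<nu>_def)
    next
      case 2
      have "wless (\<mu> 0 \<frown> ([Ltr i] \<frown> y)) (\<mu> (j - (n - 1)) \<frown> z)"
        using 2 ij y z two_le by (intro \<mu>(3)) (auto simp: m_def)
      then show ?thesis using 2 by (simp add: \<nu>_def)
    next
      case 3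
      have "wless (\<mu> (i - (n - 1)) \<frown> y) (\<mu> (j - (n - 1)) \<frown> z)"
        using 3 ij y z two_le by (intro \<mu>(3)) (auto simp: m_def)
      then show ?thesis using 3 ij by (simp add: \<nu>_def)
    qed
  qed
qed

lemma wless_tails:
  assumes "length u = length v" "wless (u \<frown> x) (v \<frown> x)" shows "wless (u \<frown> y) (v \<frown> z)"
proof -
  obtain k where k: "\<forall>j<k. (u \<frown> x) j = (v \<frown> x) j" "lval ((u \<frown> x) k) < lval ((v \<frown> x) k)"
    using assms(2) unfolding wless_def by blast
  have "k < length u" using k(2) assms(1) by (rule_tac ccontr) simp
  then show ?thesis using k assms(1) by (intro wlessI[of k]) (auto simp: conc_def)
qed

text \<open>This yields synchronization of the inverse of a newly constructed \<open>h\<close>,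
  before \<open>Bh r h\<close> is known. On a cone the inverse emits a word and continues with some
  \<open>q\<close>; it is a right inverse of \<open>f\<close> modulo \<open>sim\<close>, and
  therefore equivalent to \<open>g\<close>.\<close>

lemma inverse_locally:
  assumes h: "bij_betw h (Cr r) (Cr r)" "ucont (Cr r) h"
    and f: "locally r h f" and g: "N g" "sim (f \<circ> g) id" "sim (g \<circ> f) id"
  shows "locally r (inv_into (Cr r) h) g"
  unfolding locally_def
proof (intro conjI allI impI)
  show "N g" by (rule g)
  define h' where "h' = inv_into (Cr r) h"
  have inv: "bij_betw h' (Cr r) (Cr r)" unfolding h'_def using bij_betw_inv_into[OF h(1)] .
  have h': "inj_on h' (Cr r)" "h' \<in> Cr r \<rightarrow> Cr r" "ucont (Cr r) h'"
    using inv bij_betw_imp_funcset[OF inv] ucont_inverse[OF h] unfolding h'_def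
        by (auto simp: bij_betw_def)
  have hinj: "inj_on h (Cr r)" using h by (simp add: bij_betw_def)
  have Nf: "N f" using f unfolding locally_def by blast
  fix b assume b: "b < r"
  define e where "e = (h' \<star> [Dot b])"
  have v: "[Dot b] \<in> W (dots r)" "[Dot b] \<noteq> []" using b by auto
  have einj: "inj_on e C" unfolding e_def using inj_on_D_conc[OF h'(1) v] .
  have euc: "ucont C e" unfolding e_def using ucont_D_conc[OF h'(3) v] .
  \<comment> \<open>Long enough for the inverse to have emitted its dotted letter.\<close>
  obtain k where k: "\<And>w. w \<in> Xs \<Longrightarrow> k \<le> length w \<Longrightarrow> 1 \<le> length (pre (e \<star> w))"
    using ucont_pre_long[OF euc einj] by metis
  have "sim e g"
  proof (rule sim_local[OF ND(3)[OF g(1)]])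
    fix w assume w: "w \<in> Xs" "length w = k"
    have wi: "inj_on (e \<star> w) C" using inj_on_conc[OF einj w(1)] .
    define a q where "a = pre (e \<star> w)" and "q = nrm (e \<star> w)"
    have eq: "e (w \<frown> y) = a \<frown> q y" if "y \<in> C" for y
      unfolding a_def q_def using pre_nrm[OF inj_on_nc[OF wi] that] .
    have ne: "a \<noteq> []" using k[OF w(1)] w(2) unfolding a_def by auto
    have aq: "a \<in> W (dots r) \<and> q y \<in> C" if y: "y \<in> C" for y
    proof -
      have "[Dot b] \<frown> (w \<frown> y) \<in> Cr r" using b w y by simp
      then have "e (w \<frown> y) \<in> Cr r" unfolding e_def using h'(2) by blast
      then show ?thesis unfolding eq[OF y] using D_conc_iff[OF ne] by blast
    qed
    have a: "a \<in> W (dots r)" using aq C_nonempty by blast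
    have qC: "q \<in> C \<rightarrow> C" using aq by blast
    have qinj: "inj_on q C" unfolding q_def using inj_on_nrm[OF wi] .
    have "ucont C (e \<circ> (\<lambda>y. w \<frown> y))"
      using w by (intro ucont_comp[where D' = C] ucont_conc euc) auto
    then have quc: "ucont C q"
      by (rule ucont_unshift[of _ a]) (simp only: comp_def eq)
    have hq: "h (a \<frown> q y) = (Dot b # w) \<frown> y" if y: "y \<in> C" for y
    proof -
      have "(Dot b # w) \<frown> y \<in> Cr r" using b w y by simp
      then have "h (h' ((Dot b # w) \<frown> y)) = (Dot b # w) \<frown> y"
        unfolding h'_def by (rule bij_betw_inv_into_right[OF h(1)])
      then show ?thesis using eq[OF y] by (simp add: e_def)
    qed
    have fq: "sim (f \<circ> q) id"
    proof -
      have "sim (f \<circ> q) ((h \<star> a) \<circ> q)"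
        using locally_sim[OF locally_syncI[OF f] f a ne] ND(4)[OF Nf] inj_on_D_conc[OF hinj a ne] qC
            qinj quc
        by (rule sim_comp_right)
      also have "sim ((h \<star> a) \<circ> q) (\<lambda>y. (Dot b # w) \<frown> y)"
        by (rule sim_cong_on) (simp only: comp_def hq)
      also have "sim (\<lambda>y. (Dot b # w) \<frown> y) id" by (rule sim_id_conc)
      finally show ?thesis .
    qed
    have fqC: "f \<circ> q \<in> C \<rightarrow> C" using ND(1)[OF Nf] qC by auto
    have fqi: "inj_on (f \<circ> q) C"
      using comp_inj_on[OF qinj inj_on_subset[OF ND(4)[OF Nf]]] qC by blast
    have fqu: "ucont C (f \<circ> q)" using ucont_comp[OF quc ND(5)[OF Nf] qC] .
    \<comment> \<open>The composite of \<open>q\<close>, \<open>f\<close> and \<open>g\<close> is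
      bracketed in two ways: it is equivalent to \<open>g\<close> by \<open>fq\<close> and to
      \<open>q\<close> because \<open>g\<close> is a left inverse of \<open>f\<close>.\<close>
    have "sim (g \<circ> (f \<circ> q)) (g \<circ> id)"
      by (rule sim_comp_left[OF fq fqC fqi fqu _ _ ND(4)[OF g(1)] ND(3)[OF g(1)]]) auto
    then have gfq: "sim ((g \<circ> f) \<circ> q) g" by (simp add: comp_assoc)
    have gfq': "sim ((g \<circ> f) \<circ> q) (id \<circ> q)"
      by (rule sim_comp_right[OF g(3) ND(4)[OF N_comp[OF Nf g(1)]] _ qC qinj quc]) simp
    have "sim q g" using sim_trans[OF sim_sym[OF gfq'] gfq] by simp
    moreover have "sim (e \<star> w) q" unfolding q_def using sim_sym[OF sim_nrm[OF wi]] .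
    ultimately show "sim (e \<star> w) g" by (rule sim_trans[rotated])
  qed
  then show "sim g (\<lambda>y. inv_into (Cr r) h ([Dot b] \<frown> y))"
    unfolding e_def h'_def by (rule sim_sym)
qed

lemma wless_Dot_iff: "wless ([Dot a] \<frown> x) ([Dot b] \<frown> y) \<longleftrightarrow> a < b \<or> a = b \<and> wless x y"
proof (cases a b rule: linorder_cases)
  case less
  then show ?thesis using wless_first_letter[of "Dot a" "Dot b" "[]" x "[]" y] by simp
next
  case greater
  then show ?thesis using wless_first_letter[of "Dot b" "Dot a" "[]" y "[]" x] wless_asym by auto
qed simp

lemma least_greatest:
  assumes r: "1 \<le> r" and x: "x \<in> Cr r"
  shows "wle ([Dot 0] \<frown> zeros) x" "wle x ([Dot (r - 1)] \<frown> tops)"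
proof -
  obtain i y where iy: "i \<in> dots r" "y \<in> C" "x = [i] \<frown> y" using x by (rule D_cases)
  then obtain a where a: "i = Dot a" "a < r" by (auto simp: dots_def)
  show "wle ([Dot 0] \<frown> zeros) x"
    unfolding iy(3) a(1) wle_def wless_Dot_iff using zeros_le[OF iy(2)] unfolding wle_def
        by (cases "a = 0") auto
  show "wle x ([Dot (r - 1)] \<frown> tops)"
    unfolding iy(3) a(1) wle_def wless_Dot_iff using le_tops[OF iy(2)] a(2) unfolding wle_def
        by (cases "a = r - 1") auto
qed

text \<open>By \<open>circ_rel_covers\<close> it is enough that a monotone bijection maps covering
  pairs to covering pairs and the two extreme points to each other or to themselves.\<close>

lemma monotone_circ_rel:
  assumes r: "1 \<le> r" and h: "bij_betw h (Cr r) (Cr r)"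
    and mono: "(\<forall>x\<in>Cr r. \<forall>y\<in>Cr r. wless x y \<longrightarrow> wless (h x) (h y)) \<or>
      (\<forall>x\<in>Cr r. \<forall>y\<in>Cr r. wless x y \<longrightarrow> wless (h y) (h x))"
    and c: "circ_rel n r x y"
  shows "circ_rel n r (h x) (h y)"
proof -
  define bot top where "bot = [Dot 0] \<frown> zeros" and "top = [Dot (r - 1)] \<frown> tops"
  have bt: "bot \<in> Cr r" "top \<in> Cr r" using r by (auto simp: bot_def top_def)
  have hD: "h x \<in> Cr r" if "x \<in> Cr r" for x using bij_betwE[OF h] that by blast
  have surj: "\<exists>z'\<in>Cr r. z = h z'" if "z \<in> Cr r" for z using h that unfolding bij_betw_def by blast
  have least: "\<not> wless z bot" if "z \<in> Cr r" for z
    using least_greatest(1)[OF r that] wless_wle[of z bot z] wless_irrefl unfolding bot_def by blast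
  have greatest: "\<not> wless top z" if "z \<in> Cr r" for z
    using least_greatest(2)[OF r that] wle_wless[of z top z] wless_irrefl unfolding top_def by blast
  have D: "x \<in> Cr r" "y \<in> Cr r" using c circ_rel_covers[OF r] by blast+
  have cases: "x = y \<or> covers (Cr r) x y \<or> covers (Cr r) y x \<or> {x, y} = {bot, top}"
    using c circ_rel_covers[OF r] unfolding bot_def top_def by blast
  have ends: "{h bot, h top} = {bot, top} \<and> (\<forall>x y. covers (Cr r) x y \<longrightarrow>
      covers (Cr r) (h x) (h y) \<or> covers (Cr r) (h y) (h x))"
    using mono
  proof
    assume m: "\<forall>x\<in>Cr r. \<forall>y\<in>Cr r. wless x y \<longrightarrow> wless (h x) (h y)"
    have refl: "wless x y" if "x \<in> Cr r" "y \<in> Cr r" "wless (h x) (h y)" for x y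
      using m wless_linear_dots[OF that(1,2)] that wless_asym wless_irrefl by metis
    have "h bot = bot" if "bot = h z" "z \<in> Cr r" for z
      using m least hD wless_linear_dots[OF bt(1) that(2)] that bt by metis
    moreover have "h top = top" if "top = h z" "z \<in> Cr r" for z
      using m greatest hD wless_linear_dots[OF bt(2) that(2)] that bt by metis
    moreover have "covers (Cr r) (h x) (h y)" if "covers (Cr r) x y" for x y
      using that m hD surj refl unfolding covers_def by metis
    ultimately show ?thesis using surj bt by metis
  next
    assume m: "\<forall>x\<in>Cr r. \<forall>y\<in>Cr r. wless x y \<longrightarrow> wless (h y) (h x)"
    have refl: "wless x y" if "x \<in> Cr r" "y \<in> Cr r" "wless (h y) (h x)" for x y
      using m wless_linear_dots[OF that(1,2)] that wless_asym wless_irrefl by metis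
    have "h top = bot" if "bot = h z" "z \<in> Cr r" for z
      using m least hD greatest wless_linear_dots[OF bt(2) that(2)] that bt by metis
    moreover have "h bot = top" if "top = h z" "z \<in> Cr r" for z
      using m greatest hD least wless_linear_dots[OF bt(1) that(2)] that bt by metis
    moreover have "covers (Cr r) (h y) (h x)" if "covers (Cr r) x y" for x y
      using that m hD surj refl unfolding covers_def by metis
    ultimately show ?thesis using surj bt by (metis insert_commute)
  qed
  have "{h x, h y} = {h bot, h top}" if "{x, y} = {bot, top}" using that
      by (metis image_empty image_insert)
  then show ?thesis using cases ends hD[OF D(1)] hD[OF D(2)]
    unfolding circ_rel_covers[OF r] bot_def[symmetric] top_def[symmetric] by metis
qed

text \<open>Let \<open>f ` C\<close> be the union of \<open>p\<close> cones. Then \<open>r * p\<close> is congruent to \<open>r\<close>, so \<open>Cr r\<close> is a union of \<open>r * p\<close>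
  cones, and \<open>h\<close> applies \<open>f\<close> below each dotted letter and then exchanges prefixes in the lexicographic order
  (in the reverse order of the dotted letters when \<open>f\<close> is decreasing).\<close>

lemma realize:
  assumes r: "1 \<le> r" and f: "U f" and m: "[r * mult_const f = r] (mod (n - 1))"
  shows "\<exists>h\<in>B_set n r. locally r h f \<and>
    (inc f \<or> dec f \<longrightarrow> (\<forall>x y. circ_rel n r x y \<longrightarrow> circ_rel n r (h x) (h y)))"
proof -
  obtain g where g: "N g" "sim (f \<circ> g) id" "sim (g \<circ> f) id" and Nf: "N f" using f unfolding U_def
      by blast
  note fN = ND[OF Nf]
  have fC: "f y \<in> C" if "y \<in> C" for y using fN(1) that by blast
  define A where "A = f ` C"
  obtain k where k: "lev k A" using embD(5)[OF fN(2)] unfolding A_def clp_def by blast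
  have AC: "A \<subseteq> C" unfolding A_def using fC by blast
  define P where "P = prefix k ` A"
  have "prefix k x \<in> Xs" if "x \<in> A" for x using AC that prefix_in_Xs by blast
  then have P: "finite P" "P \<subseteq> Xs" "\<And>u. u \<in> P \<Longrightarrow> length u = k"
    unfolding P_def using finite_prefix_image[OF AC] by blast+ auto
  define p where "p = card P"
  have "A \<noteq> {}" unfolding A_def using C_nonempty by blast
  then have p0: "0 < p" unfolding p_def using P(1) by (simp add: card_gt_0_iff P_def)
  \<comment> \<open>An order on cones; it is total on \<open>P\<close>, whose words all have length
    \<open>k\<close>.\<close>
  define R where "R u v \<longleftrightarrow> (\<forall>y\<in>C. \<forall>z\<in>C. wless (u \<frown> y) (v \<frown> z))" for u v
  have "transp_on P R" unfolding transp_on_def R_def using wless_trans C_nonempty by blast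
  moreover have "totalp_on P R" unfolding totalp_on_def
  proof (intro ballI impI)
    fix u v assume uv: "u \<in> P" "v \<in> P" "u \<noteq> v"
    have l: "length u = length v" using uv P(3) by simp
    then have "u \<frown> zeros \<noteq> v \<frown> zeros" using uv conc_inject by blast
    moreover have "u \<frown> zeros \<in> C" "v \<frown> zeros \<in> C" using uv P(2) by auto
    ultimately have "wless (u \<frown> zeros) (v \<frown> zeros) \<or> wless (v \<frown> zeros) (u \<frown> zeros)"
        by (intro wless_linear)
    then show "R u v \<or> R v u" unfolding R_def using wless_tails[OF l] wless_tails[OF l[symmetric]]
        by blast
  qed
  ultimately obtain \<kappa> where \<kappa>: "bij_betw \<kappa> {..<p} P" "\<And>i j. i < j \<Longrightarrow> j < p \<Longrightarrow> R (\<kappa> i) (\<kappa> j)"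
    using increasing_enumeration[OF P(1), of R] unfolding p_def by blast
  define idx where "idx = inv_into {..<p} \<kappa>"
  have idx: "idx u < p" "\<kappa> (idx u) = u" if "u \<in> P" for u
    using bij_betwE[OF bij_betw_inv_into[OF \<kappa>(1)]] bij_betw_inv_into_right[OF \<kappa>(1)] that
        unfolding idx_def by auto
  have idx_less: "idx u < idx v" if "u \<in> P" "v \<in> P" "R u v" for u v
  proof (rule ccontr)
    assume "\<not> idx u < idx v"
    then have "R v u \<or> u = v" using \<kappa>(2)[of "idx v" "idx u"] idx that by (metis linorder_neqE_nat)
    then show False using that(3) C_nonempty wless_asym wless_irrefl unfolding R_def by blast
  qed
  \<comment> \<open>The codes of \<open>ordered_code\<close> have sizes of this form; the congruence
    \<open>m\<close> is used to make \<open>r * p\<close> one of them.\<close>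
  obtain s where s: "r * p = r + s * (n - 1)"
  proof -
    have "[mult_const f = p] (mod (n - 1))"
      using mass_cong[OF k] unfolding mult_const_def A_def p_def P_def .
    then have "[r * p = r * mult_const f] (mod (n - 1))" by (intro cong_scalar_left) (rule cong_sym)
    then have "[r * p = r] (mod (n - 1))" using m by (rule cong_trans)
    moreover have "r \<le> r * p" using p0 by simp
    ultimately obtain s where "r * p = s * (n - 1) + r" using cong_le_nat[of r "r * p" "n - 1"] by blast
    then show ?thesis using that[of s] by simp
  qed
  obtain \<mu> where "(\<forall>j<r * p. \<mu> j \<in> W (dots r) \<and> \<mu> j \<noteq> []) \<and>
    (\<forall>x\<in>Cr r. \<exists>j<r * p. \<exists>z\<in>C. x = \<mu> j \<frown> z) \<and>
    (\<forall>i j. i < j \<longrightarrow> j < r * p \<longrightarrow> (\<forall>y\<in>C. \<forall>z\<in>C. wless (\<mu> i \<frown> y) (\<mu> j \<frown> z)))"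
    using ordered_code[OF r, of s] unfolding s[symmetric] ..
  then have \<mu>: "\<And>j. j < r * p \<Longrightarrow> \<mu> j \<in> W (dots r) \<and> \<mu> j \<noteq> []"
    "\<And>x. x \<in> Cr r \<Longrightarrow> \<exists>j<r * p. \<exists>z\<in>C. x = \<mu> j \<frown> z"
    "\<And>i j y z. i < j \<Longrightarrow> j < r * p \<Longrightarrow> y \<in> C \<Longrightarrow> z \<in> C \<Longrightarrow> wless (\<mu> i \<frown> y) (\<mu> j \<frown> z)"
    by simp_all
  define \<sigma> where "\<sigma> a = (if dec f then r - 1 - a else a)" for a
  have \<sigma>: "\<sigma> a < r" "\<sigma> (\<sigma> a) = a" if "a < r" for a using that by (auto simp: \<sigma>_def)
  define pc where "pc y = prefix k (f y)" for y
  have pcP: "pc y \<in> P" if "y \<in> C" for y unfolding pc_def P_def A_def using that by blast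
  \<comment> \<open>The \<open>r * p\<close> target cones form \<open>r\<close> consecutive blocks
    of size \<open>p\<close>. The dotted letter selects the block, the rank of the cone containing
    \<open>f y\<close> the place in it.\<close>
  define ind where "ind a y = \<sigma> a * p + idx (pc y)" for a y
  have ind: "ind a y < r * p" if "a < r" "y \<in> C" for a y
  proof -
    have "ind a y < Suc (\<sigma> a) * p" unfolding ind_def using idx(1)[OF pcP[OF that(2)]] by simp
    also have "\<dots> \<le> r * p" using \<sigma>(1)[OF that(1)] by (intro mult_le_mono1) simp
    finally show ?thesis .
  qed
  define h where "h = restrict (\<lambda>x. \<mu> (ind (lval (x 0)) (suffix 1 x)) \<frown> suffix k (f (suffix 1 x)))
      (Cr r)"
  have h: "h ([Dot a] \<frown> y) = \<mu> (ind a y) \<frown> suffix k (f y)" if "a < r" "y \<in> C" for a y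
  proof -
    have "suffix 1 ([Dot a] \<frown> y) = y" using suffix_conc_length[of "[Dot a]" y] by simp
    moreover have "([Dot a] \<frown> y) 0 = Dot a" by simp
    ultimately show ?thesis unfolding h_def using that by (simp del: suffix_conc_snd)
  qed
  have Dc: "\<exists>a y. a < r \<and> y \<in> C \<and> x = [Dot a] \<frown> y" if "x \<in> Cr r" for x
    using that by (rule D_cases) (auto simp: dots_def)
  have sufC: "suffix k (f y) \<in> C" if "y \<in> C" for y using fC[OF that] by simp
  \<comment> \<open>Together with \<open>ord2\<close> this settles monotonicity, and also
    injectivity of \<open>h\<close>, since distinct points are comparable.\<close>
  have ord1: "wless (h ([Dot a] \<frown> y)) (h ([Dot b] \<frown> z))"
    if "a < r" "b < r" "y \<in> C" "z \<in> C" "\<sigma> a < \<sigma> b" for a b y z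
  proof -
    have "ind a y < Suc (\<sigma> a) * p" unfolding ind_def using idx(1)[OF pcP[OF that(3)]] by simp
    also have "\<dots> \<le> \<sigma> b * p" using that(5) by (intro mult_le_mono1) simp
    also have "\<dots> \<le> ind b z" by (simp add: ind_def)
    finally show ?thesis unfolding h[OF that(1,3)] h[OF that(2,4)]
      using ind[OF that(2,4)] sufC that by (intro \<mu>(3)) auto
  qed
  have ord2: "wless (h ([Dot a] \<frown> y)) (h ([Dot a] \<frown> z))"
    if a: "a < r" and y: "y \<in> C" and z: "z \<in> C" and yz: "wless (f y) (f z)" for a y z
  proof -
    have fy: "f y = pc y \<frown> suffix k (f y)" and fz: "f z = pc z \<frown> suffix k (f z)"
      unfolding pc_def by (rule prefix_suffix)+
    show ?thesis
    proof (cases "pc y = pc z")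
      case True
      have "wless (pc z \<frown> suffix k (f y)) (pc z \<frown> suffix k (f z))" using yz fy fz True by metis
      then have "wless (suffix k (f y)) (suffix k (f z))" by (simp only: wless_conc)
      then show ?thesis unfolding h[OF a y] h[OF a z] ind_def True by (simp only: wless_conc)
    next
      case False
      have R: "R (pc y) (pc z) \<or> R (pc z) (pc y)"
        using \<open>totalp_on P R\<close> pcP[OF y] pcP[OF z] False unfolding totalp_on_def by blast
      have "\<not> R (pc z) (pc y)"
      proof
        assume "R (pc z) (pc y)"
        then have "wless (pc z \<frown> suffix k (f z)) (pc y \<frown> suffix k (f y))" unfolding R_def
            using sufC y z by blast
        then have "wless (f z) (f y)" using fy fz by metis
        then show False using yz wless_asym by blast
      qed
      then have "idx (pc y) < idx (pc z)" using R idx_less pcP y z by blast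
      then show ?thesis unfolding h[OF a y] h[OF a z]
        using ind[OF a z] sufC y z by (intro \<mu>(3)) (auto simp: ind_def)
    qed
  qed
  have hD: "h x \<in> Cr r" if x: "x \<in> Cr r" for x
  proof -
    obtain a y where "a < r" "y \<in> C" "x = [Dot a] \<frown> y" using Dc[OF x] by blast
    then show ?thesis using h[of a y] \<mu>(1)[OF ind[of a y]] sufC[of y] D_conc_iff by metis
  qed
  have "inj_on h (Cr r)"
  proof (rule inj_onI, rule ccontr)
    fix x x' assume x: "x \<in> Cr r" "x' \<in> Cr r" and eq: "h x = h x'" and ne: "x \<noteq> x'"
    obtain a y where y: "a < r" "y \<in> C" "x = [Dot a] \<frown> y" using Dc[OF x(1)] by blast
    obtain b z where z: "b < r" "z \<in> C" "x' = [Dot b] \<frown> z" using Dc[OF x(2)] by blast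
    show False
    proof (cases "a = b")
      case True
      then have "f y \<noteq> f z" using ne y z inj_on_eq_iff[OF fN(4) y(2) z(2)] by auto
      then have "wless (f y) (f z) \<or> wless (f z) (f y)" using wless_linear fC y(2) z(2) by blast
      then show False using ord2[OF y(1,2) z(2)] ord2[OF y(1) z(2) y(2)] eq y z True by auto
    next
      case False
      then have "\<sigma> a < \<sigma> b \<or> \<sigma> b < \<sigma> a" using \<sigma>(2) y(1) z(1) by (metis linorder_neqE_nat)
      then show False using ord1[OF y(1) z(1) y(2) z(2)] ord1[OF z(1) y(1) z(2) y(2)] eq y z by auto
    qed
  qed
  moreover have "Cr r \<subseteq> h ` Cr r"
  proof
    fix x assume "x \<in> Cr r"
    then obtain i z where i: "i < r * p" "z \<in> C" "x = \<mu> i \<frown> z" using \<mu>(2) by blast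
    define a where "a = \<sigma> (i div p)"
    have d: "i div p < r" using i(1) by (simp add: less_mult_imp_div_less)
    have a: "a < r" "\<sigma> a = i div p" using \<sigma>[OF d] by (auto simp: a_def)
    have im: "i mod p < p" using p0 by simp
    have u: "\<kappa> (i mod p) \<in> P" using bij_betwE[OF \<kappa>(1)] im by blast
    then obtain x0 where x0: "x0 \<in> A" "\<kappa> (i mod p) = prefix k x0" unfolding P_def by blast
    then have "\<kappa> (i mod p) \<frown> z \<in> A" using k i(2) unfolding lev_def by simp
    then obtain y where y: "y \<in> C" "f y = \<kappa> (i mod p) \<frown> z" unfolding A_def by auto
    have l: "length (\<kappa> (i mod p)) = k" using P(3)[OF u] .
    have pcy: "pc y = \<kappa> (i mod p)" unfolding pc_def y(2) using prefix_conc_length[of "\<kappa> (i mod p)" z] l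
        by simp
    have sfy: "suffix k (f y) = z" unfolding y(2) using suffix_conc_length[of "\<kappa> (i mod p)" z] l by simp
    have "idx (pc y) = i mod p" unfolding pcy idx_def using bij_betw_inv_into_left[OF \<kappa>(1)] im by simp
    then have "ind a y = i" unfolding ind_def a(2) by simp
    then have "x = h ([Dot a] \<frown> y)" using h[OF a(1) y(1)] i(3) sfy by simp
    moreover have "[Dot a] \<frown> y \<in> Cr r" using a y by simp
    ultimately show "x \<in> h ` Cr r" by (rule image_eqI)
  qed
  ultimately have bij: "bij_betw h (Cr r) (Cr r)" unfolding bij_betw_def using hD by blast
  have uc: "ucont (Cr r) h" unfolding ucont_def
  proof
    fix m
    obtain K where K: "\<And>x y. x \<in> C \<Longrightarrow> y \<in> C \<Longrightarrow> prefix K x = prefix K y \<Longrightarrow>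
        prefix (k + m) (f x) = prefix (k + m) (f y)"
      using ucontD[OF fN(5)] by metis
    show "\<exists>k. \<forall>x\<in>Cr r. \<forall>y\<in>Cr r. prefix k x = prefix k y \<longrightarrow> prefix m (h x) = prefix m (h y)"
    proof (intro exI[of _ "Suc K"] ballI impI)
      fix x x' assume x: "x \<in> Cr r" "x' \<in> Cr r" and eq: "prefix (Suc K) x = prefix (Suc K) x'"
      obtain a y where y: "a < r" "y \<in> C" "x = [Dot a] \<frown> y" using Dc[OF x(1)] by blast
      obtain b z where z: "b < r" "z \<in> C" "x' = [Dot b] \<frown> z" using Dc[OF x(2)] by blast
      have at: "x j = x' j" if "j < Suc K" for j using eq that unfolding prefix_eq_iff by blast
      have ab: "a = b" using at[of 0] unfolding y z by simp
      have "y j = z j" if "j < K" for j using at[of "Suc j"] that unfolding y z by simp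
      then have fyz: "prefix (k + m) (f y) = prefix (k + m) (f z)"
        by (intro K y z) (simp only: prefix_eq_iff, blast)
      have "pc y = pc z" unfolding pc_def using fyz by (rule prefix_eq_mono) simp
      then have "ind a y = ind b z" by (simp add: ind_def ab)
      moreover have "(v \<frown> suffix k (f y)) j = (v \<frown> suffix k (f z)) j" if "j < m" for v j
      proof (cases "j < length v")
        case False
        then have "k + (j - length v) < k + m" using that by simp
        then have "f y (k + (j - length v)) = f z (k + (j - length v))" using fyz
            unfolding prefix_eq_iff by blast
        then show ?thesis using False by simp
      qed simp
      ultimately show "prefix m (h x) = prefix m (h x')"
        unfolding y(3) z(3) h[OF y(1,2)] h[OF z(1,2)] prefix_eq_iff by simp
    qed
  qed
  have loc: "locally r h f" unfolding locally_def
  proof (intro conjI allI impI Nf)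
    fix a assume a: "a < r"
    \<comment> \<open>From here on \<open>f\<close> has emitted at least \<open>k\<close> letters,
      so the prefix that \<open>h\<close> exchanges lies entirely within the fixed output and does
      not affect the local action.\<close>
    obtain K where K: "\<And>w. w \<in> Xs \<Longrightarrow> K \<le> length w \<Longrightarrow> k \<le> length (pre (f \<star> w))"
      using ucont_pre_long[OF fN(5,4)] by metis
    show "sim f (h \<star> [Dot a])" unfolding sim_def
    proof (intro exI[of _ K] ballI impI)
      fix w assume w: "w \<in> Xs" "K \<le> length w"
      define c t where "c = pre (f \<star> w)" and "t = nrm (f \<star> w)"
      have inj: "inj_on (f \<star> w) C" using inj_on_conc[OF fN(4) w(1)] .
      have ft: "f (w \<frown> y) = c \<frown> t y" if "y \<in> C" for y
        unfolding c_def t_def using pre_nrm[OF inj_on_nc[OF inj] that] .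
      have lc: "k \<le> length c" using K[OF w] unfolding c_def .
      have ht: "h ([Dot a] \<frown> (w \<frown> y)) = (\<mu> (\<sigma> a * p + idx (take k c)) @ drop k c) \<frown> t y" if y: "y \<in> C"
          for y
      proof -
        have wy: "w \<frown> y \<in> C" using w y by simp
        have "pc (w \<frown> y) = take k c" unfolding pc_def ft[OF y] using prefix_conc_drop[OF lc] .
        moreover have "suffix k (c \<frown> t y) = drop k c \<frown> t y" using suffix_conc_fst[OF lc] .
        ultimately show ?thesis unfolding h[OF a wy] ind_def ft[OF y] by simp
      qed
      show "nrm (f \<star> w) = nrm (\<lambda>y. h ([Dot a] \<frown> w \<frown> y))"
        by (rule nrm_eqI[OF inj_on_nc[OF inj_on_nrm[OF inj]], folded t_def, OF ft ht])
    qed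
  qed
  have "Bh r h" unfolding Bh_def
    using bij uc locally_syncI[OF loc] locally_syncI[OF inverse_locally[OF bij uc loc g]] by blast
  then have "h \<in> B_set n r" using B_set_iff[OF r] by (simp add: h_def)
  moreover have "circ_rel n r (h x) (h y)" if f: "inc f \<or> dec f" and c: "circ_rel n r x y" for x y
  proof (rule monotone_circ_rel[OF r bij _ c])
    show "(\<forall>x\<in>Cr r. \<forall>y\<in>Cr r. wless x y \<longrightarrow> wless (h x) (h y)) \<or>
      (\<forall>x\<in>Cr r. \<forall>y\<in>Cr r. wless x y \<longrightarrow> wless (h y) (h x))"
    proof (cases "dec f")
      case True
      have "wless (h x') (h x)" if x: "x \<in> Cr r" "x' \<in> Cr r" and xx': "wless x x'" for x x'
      proof -
        obtain a y where y: "a < r" "y \<in> C" "x = [Dot a] \<frown> y" using Dc[OF x(1)] by blast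
        obtain b z where z: "b < r" "z \<in> C" "x' = [Dot b] \<frown> z" using Dc[OF x(2)] by blast
        from xx' have "a < b \<or> a = b \<and> wless y z" unfolding y z wless_Dot_iff .
        then show ?thesis
        proof
          assume "a < b"
          then have "\<sigma> b < \<sigma> a" using True y z by (simp add: \<sigma>_def)
          then show ?thesis unfolding y(3) z(3) using y z by (intro ord1)
        next
          assume ab: "a = b \<and> wless y z"
          then have "wless (f z) (f y)" using True y z unfolding dec_def by blast
          then show ?thesis unfolding y(3) z(3) using y z ab by (auto intro: ord2)
        qed
      qed
      then show ?thesis by blast
    next
      case False
      then have inc: "inc f" using f by blast
      have "wless (h x) (h x')" if x: "x \<in> Cr r" "x' \<in> Cr r" and xx': "wless x x'" for x x'
      proof -
        obtain a y where y: "a < r" "y \<in> C" "x = [Dot a] \<frown> y" using Dc[OF x(1)] by blast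
        obtain b z where z: "b < r" "z \<in> C" "x' = [Dot b] \<frown> z" using Dc[OF x(2)] by blast
        from xx' have "a < b \<or> a = b \<and> wless y z" unfolding y z wless_Dot_iff .
        then show ?thesis
        proof
          assume "a < b"
          then have "\<sigma> a < \<sigma> b" using False by (simp add: \<sigma>_def)
          then show ?thesis unfolding y(3) z(3) using y z by (intro ord1)
        next
          assume ab: "a = b \<and> wless y z"
          then have "wless (f y) (f z)" using inc y z unfolding inc_def by blast
          then show ?thesis unfolding y(3) z(3) using y z ab by (auto intro: ord2)
        qed
      qed
      then show ?thesis by blast
    qed
  qed
  ultimately show ?thesis using loc by blast
qed

text \<open>On a small cone \<open>h\<close> is a fixed word \<open>b\<close> followed by a map
  \<open>q\<close>. Glued pairs below the cone are covering pairs of \<open>Cr r\<close>, so their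
  images are equal or again adjacent, and \<open>q\<close> inherits this.\<close>

lemma circ_preserving_monotone:
  assumes r: "1 \<le> r" and h: "Bh r h" and f: "locally r h f"
    and circ: "\<And>x y. circ_rel n r x y \<Longrightarrow> circ_rel n r (h x) (h y)"
  shows "\<exists>f'. N f' \<and> sim f f' \<and> (inc f' \<or> dec f')"
proof -
  have v0: "[Dot 0] \<in> W (dots r)" "[Dot 0] \<noteq> []" using r by auto
  obtain w where w: "w \<in> Xs" "1 < length (pre (h \<star> ([Dot 0] @ w)))"
    "pre (h \<star> ([Dot 0] @ w)) \<in> W (dots r)" "N (nrm (h \<star> ([Dot 0] @ w)))"
    "sim (nrm (h \<star> ([Dot 0] @ w))) (h \<star> [Dot 0])"
    \<comment> \<open>The bound 1 gives \<open>b\<close> at least two letters, which is needed to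
      exclude the pair closing the circle.\<close>
    using Bh_local_N[OF h v0, of 1] by blast
  define v where "v = [Dot 0] @ w"
  have v: "v \<in> W (dots r)" "v \<noteq> []" using w r by (auto simp: v_def)
  define b where "b = pre (h \<star> v)"
  define q where "q = nrm (h \<star> v)"
  have b: "b \<in> W (dots r)" "1 < length b" and q: "N q" "sim q (h \<star> [Dot 0])"
    using w unfolding b_def q_def v_def by blast+
  have hq: "h (v \<frown> y) = b \<frown> q y" if "y \<in> C" for y
    unfolding b_def q_def using pre_nrm[OF embD(3)[OF Bh_emb[OF h v]] that] .
  have bD: "b \<frown> y \<in> Cr r" if "y \<in> C" for y
  proof -
    have "b \<noteq> []" using b(2) by auto
    then show ?thesis using b(1) that D_conc_iff by blast
  qed
  have "adj_preserving q" unfolding adj_preserving_def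
  proof (intro ballI allI impI)
    fix u i z assume u: "u \<in> Xs" "Suc i < n" and z: "z \<in> C"
    define x y where "x = (u @ [Ltr i]) \<frown> tops" and "y = (u @ [Ltr (Suc i)]) \<frown> zeros"
    have xy: "x \<in> C" "y \<in> C" using u by (auto simp: x_def y_def)
    have "covers (Cr r) (((v @ u) @ [Ltr i]) \<frown> tops) (((v @ u) @ [Ltr (Suc i)]) \<frown> zeros)"
      using u v by (intro covers_branch) (auto simp: D_conc_iff append_in_W)
    then have "covers (Cr r) (v \<frown> x) (v \<frown> y)" by (simp add: x_def y_def)
    then have "circ_rel n r (v \<frown> x) (v \<frown> y)" unfolding circ_rel_covers[OF r] covers_def by blast
    then have "circ_rel n r (b \<frown> q x) (b \<frown> q y)" using circ hq xy by metis
    then consider "b \<frown> q x = b \<frown> q y" | "covers (Cr r) (b \<frown> q x) (b \<frown> q y)"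
      | "covers (Cr r) (b \<frown> q y) (b \<frown> q x)" | "{b \<frown> q x, b \<frown> q y} = {[Dot 0] \<frown> zeros, [Dot
          (r - 1)] \<frown> tops}"
      unfolding circ_rel_covers[OF r] by blast
    then have "\<not> (wless (q x) z \<and> wless z (q y)) \<and> \<not> (wless (q y) z \<and> wless z (q x))"
    proof cases
      case 1
      then have "q x = q y" by simp
      then show ?thesis using wless_asym by metis
    next
      case 2
      then have "wless (q x) (q y)" "\<not> (wless (q x) z \<and> wless z (q y))"
        using bD[OF z] unfolding covers_def by auto
      then show ?thesis using wless_trans wless_asym by blast
    next
      case 3
      then have "wless (q y) (q x)" "\<not> (wless (q y) z \<and> wless z (q x))"
        using bD[OF z] unfolding covers_def by auto
      then show ?thesis using wless_trans wless_asym by blast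
    next
      case 4
      \<comment> \<open>Both images have the second letter of \<open>b\<close>, whereas the two ends
        of the circle have second letters \<open>Ltr 0\<close> and
        \<open>Ltr (n - 1)\<close>.\<close>
      have at: "(b \<frown> q x) 1 = b ! 1" "(b \<frown> q y) 1 = b ! 1" using b(2) by simp_all
      have "([Dot 0] \<frown> zeros) 1 = Ltr 0" "([Dot (r - 1)] \<frown> tops) 1 = Ltr (n - 1)" by simp_all
      moreover have "([Dot 0] \<frown> zeros) 1 = ([Dot (r - 1)] \<frown> tops) 1"
        using 4 at unfolding doubleton_eq_iff by metis
      ultimately show ?thesis using two_le by simp
    qed
    then show "\<not> (wless (q ((u @ [Ltr i]) \<frown> tops)) z \<and> wless z (q ((u @ [Ltr (Suc i)]) \<frown> zeros))) \<and>
     \<not> (wless (q ((u @ [Ltr (Suc i)]) \<frown> zeros)) z \<and> wless z (q ((u @ [Ltr i]) \<frown> tops)))"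
      unfolding x_def y_def .
  qed
  then have "inc q \<or> dec q" using adj_preserving_monotone ND(1,2)[OF q(1)] by blast
  moreover have "sim f q" using f q(2) r sim_trans sim_sym unfolding locally_def
    by (metis One_nat_def Suc_le_eq)
  ultimately show ?thesis using q(1) by blast
qed

subsection \<open>The groups\<close>

text \<open>The congruence is stable under conjugation, because \<^const>\<open>mult_const\<close> is multiplicative with
  values in a commutative monoid; this is the reason for normality.\<close>

definition UO :: "nat \<Rightarrow> (letter word \<Rightarrow> letter word) set" where
  "UO r = {f. U f \<and> [r * mult_const f = r] (mod (n - 1))}"

definition UTO :: "nat \<Rightarrow> (letter word \<Rightarrow> letter word) set" where
  "UTO r = {f \<in> UO r. \<exists>f'. N f' \<and> sim f f' \<and> (inc f' \<or> dec f')}"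

lemma O_set_eq:
  assumes r: "1 \<le> r" shows "O_set n r = Cl ` UO r"
proof (intro equalityI subsetI)
  fix c assume "c \<in> O_set n r"
  then obtain h where h: "h \<in> B_set n r" "c = Core n r h" unfolding O_set_def by blast
  then have B: "Bh r h" using B_set_iff[OF r] by blast
  obtain f where f: "locally r h f" using Bh_locally_ex[OF r B] by blast
  show "c \<in> Cl ` UO r"
    using Core_locally[OF r B f] locally_U[OF r B f] locally_mult_const[OF B f] h(2) unfolding UO_def
        by blast
next
  fix c assume "c \<in> Cl ` UO r"
  then obtain f where f: "U f" "[r * mult_const f = r] (mod (n - 1))" "c = Cl f" unfolding UO_def
      by blast
  obtain h where h: "h \<in> B_set n r" "locally r h f" using realize[OF r f(1,2)] by blast
  then have "Bh r h" using B_set_iff[OF r] by blast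
  then show "c \<in> O_set n r" using Core_locally[OF r _ h(2)] h(1) f(3) unfolding O_set_def by blast
qed

text \<open>A monotone \<open>f'\<close> equivalent to \<open>f\<close> has the same inverse modulo
  \<open>sim\<close> and the same cone count, so \<open>realize\<close> applies to \<open>f'\<close>
  in place of \<open>f\<close>.\<close>

lemma TO_set_eq:
  assumes r: "1 \<le> r" shows "TO_set n r = Cl ` UTO r"
proof (intro equalityI subsetI)
  fix c assume "c \<in> TO_set n r"
  then obtain h where h: "h \<in> B_set n r" "\<And>x y. circ_rel n r x y \<Longrightarrow> circ_rel n r (h x) (h y)"
      "c = Core n r h"
    unfolding TO_set_def TB_set_def by blast
  then have B: "Bh r h" using B_set_iff[OF r] by blast
  obtain f where f: "locally r h f" using Bh_locally_ex[OF r B] by blast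
  have "f \<in> UTO r"
    using locally_U[OF r B f] locally_mult_const[OF B f] circ_preserving_monotone[OF r B f h(2)]
    unfolding UTO_def UO_def by blast
  then show "c \<in> Cl ` UTO r" using Core_locally[OF r B f] h(3) by blast
next
  fix c assume "c \<in> Cl ` UTO r"
  then obtain f f' where f: "U f" "[r * mult_const f = r] (mod (n - 1))" "c = Cl f"
    and f': "N f'" "sim f f'" "inc f' \<or> dec f'" unfolding UTO_def UO_def by blast
  obtain g where Nf: "N f" and g: "N g" "sim (f \<circ> g) id" "sim (g \<circ> f) id" using f(1) unfolding U_def
      by blast
  have "sim (f' \<circ> g) id" "sim (g \<circ> f') id"
    using sim_trans[OF N_comp_sim_right[OF f'(1) Nf g(1) sim_sym[OF f'(2)]] g(2)]
      sim_trans[OF N_comp_sim_left[OF f'(1) Nf g(1) sim_sym[OF f'(2)]] g(3)] .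
  then have "U f'" unfolding U_def using f'(1) g(1) by blast
  moreover have "[r * mult_const f' = r] (mod (n - 1))"
    using cong_trans[OF cong_scalar_left[OF cong_sym[OF mult_const_sim[OF Nf f'(1,2)]]] f(2)] .
  ultimately obtain h where h: "h \<in> B_set n r" "locally r h f'"
    "\<forall>x y. circ_rel n r x y \<longrightarrow> circ_rel n r (h x) (h y)"
    using realize[OF r] f'(3) by blast
  then have "Bh r h" "h \<in> TB_set n r" using B_set_iff[OF r] unfolding TB_set_def by blast+
  moreover have "c = Cl f'" using f(3) Cl_sim[OF f'(2)] by simp
  ultimately show "c \<in> TO_set n r" using Core_locally[OF r _ h(2)] unfolding TO_set_def by blast
qed

text \<open>Subgroups at the level of maps, where inverses are available only modulo
  \<open>sim\<close>.\<close>

definition subgrouplike :: "(letter word \<Rightarrow> letter word) set \<Rightarrow> bool" where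
  "subgrouplike H \<longleftrightarrow> H \<subseteq> {f. U f} \<and> id \<in> H \<and> (\<forall>f\<in>H. \<forall>g\<in>H. g \<circ> f \<in> H) \<and>
     (\<forall>f\<in>H. \<exists>g\<in>H. sim (f \<circ> g) id \<and> sim (g \<circ> f) id)"

lemma UO_cong:
  assumes "f \<in> UO r" "g \<in> UO r" shows "g \<circ> f \<in> UO r"
proof -
  have f: "U f" "N f" "[r * mult_const f = r] (mod (n - 1))" and g: "U g" "N g"
      "[r * mult_const g = r] (mod (n - 1))"
    using assms unfolding UO_def U_def by blast+
  have "[r * mult_const (g \<circ> f) = r * (mult_const f * mult_const g)] (mod (n - 1))"
    by (intro cong_scalar_left mult_const_comp f g)
  also have "[r * (mult_const f * mult_const g) = r * mult_const g] (mod (n - 1))"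
    using cong_scalar_right[OF f(3), of "mult_const g"] by (simp add: mult.assoc)
  also note g(3)
  finally show ?thesis using U_comp[OF f(1) g(1)] unfolding UO_def by blast
qed

lemma mult_const_inverse:
  assumes "N f" "N g" "sim (f \<circ> g) id"
  shows "[mult_const f * mult_const g = 1] (mod (n - 1))"
proof -
  have "[mult_const g * mult_const f = mult_const (f \<circ> g)] (mod (n - 1))"
    by (rule cong_sym[OF mult_const_comp[OF assms(2,1)]])
  also have "[mult_const (f \<circ> g) = mult_const id] (mod (n - 1))"
    by (rule mult_const_sim[OF N_comp[OF assms(2,1)] N_id assms(3)])
  also note mult_const_id
  finally show ?thesis by (simp add: mult.commute)
qed

lemma UO_inverse:
  assumes f: "f \<in> UO r" and g: "U g" "sim (f \<circ> g) id" shows "g \<in> UO r"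
proof -
  have f': "N f" "[r * mult_const f = r] (mod (n - 1))" and Ng: "N g" using f g(1)
      unfolding UO_def U_def by blast+
  have "[r * mult_const g = r * mult_const f * mult_const g] (mod (n - 1))"
    using cong_scalar_right[OF cong_sym[OF f'(2)]] .
  also have "[r * mult_const f * mult_const g = r * 1] (mod (n - 1))"
    unfolding mult.assoc by (intro cong_scalar_left mult_const_inverse f' Ng g)
  finally show ?thesis using g(1) unfolding UO_def by simp
qed

lemma subgrouplike_UO: "subgrouplike (UO r)"
  unfolding subgrouplike_def
proof (intro conjI ballI)
  show "UO r \<subseteq> {f. U f}" unfolding UO_def by blast
  show "id \<in> UO r" unfolding UO_def using U_id cong_scalar_left[OF mult_const_id, of r] by simp
  show "g \<circ> f \<in> UO r" if "f \<in> UO r" "g \<in> UO r" for f g using UO_cong[OF that] .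
  fix f assume f: "f \<in> UO r"
  then have "U f" unfolding UO_def by blast
  then obtain g where g: "U g" "sim (f \<circ> g) id" "sim (g \<circ> f) id" using U_inverse by blast
  then show "\<exists>g\<in>UO r. sim (f \<circ> g) id \<and> sim (g \<circ> f) id" using UO_inverse[OF f g(1,2)] by blast
qed

lemma monotone_comp:
  assumes "f \<in> C \<rightarrow> C" "inc f \<or> dec f" "inc g \<or> dec g" shows "inc (g \<circ> f) \<or> dec (g \<circ> f)"
proof -
  have fC: "f x \<in> C" if "x \<in> C" for x using assms(1) that by blast
  show ?thesis using assms(2,3) fC unfolding inc_def dec_def comp_def by blast
qed

text \<open>If \<open>f (g (w \<frown> y)) = a \<frown> y\<close> and \<open>f\<close> is monotone, then so is \<open>g\<close> on the cone of \<open>w\<close>.\<close>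

lemma monotone_inverse:
  assumes f: "N f" "inc f \<or> dec f" and g: "N g" "sim (f \<circ> g) id"
  shows "\<exists>g'. N g' \<and> sim g g' \<and> (inc g' \<or> dec g')"
proof -
  obtain K where K: "\<And>w. w \<in> Xs \<Longrightarrow> K \<le> length w \<Longrightarrow> nrm (\<lambda>y. (f \<circ> g) (w \<frown> y)) = nrm (id \<star> w)"
    using g(2) unfolding sim_def by blast
  obtain w where w: "w \<in> Xs" "length w = K" using Xs_length_ex by blast
  define g' where "g' = (g \<star> w)"
  have Ng': "N g'" unfolding g'_def using N_conc[OF g(1) w(1)] .
  have gC: "g' y \<in> C" if "y \<in> C" for y using ND(1)[OF Ng'] that by blast
  have "nrm (\<lambda>y. w \<frown> y) = nrm id"
    using ND(6)[OF N_id] by (intro nrm_shift[of id _ w]) auto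
  moreover have "nrm (\<lambda>y. f (g' y)) = nrm (\<lambda>y. w \<frown> y)" using K[of w] w by (simp add: g'_def)
  moreover have "nc (\<lambda>y. f (g' y))" using ND(6)[OF N_comp[OF Ng' f(1)]] by (simp add: comp_def)
  ultimately have fg: "f (g' y) = pre (\<lambda>y. f (g' y)) \<frown> nrm id y" if "y \<in> C" for y
    using pre_nrm[of "\<lambda>y. f (g' y)" y] that by simp
  have idn: "y = pre id \<frown> nrm id y" if "y \<in> C" for y
    using pre_nrm[OF ND(6)[OF N_id] that] by simp
  have key: "wless (f (g' x)) (f (g' y))" if xy: "x \<in> C" "y \<in> C" "wless x y" for x y
  proof -
    have "wless (pre id \<frown> nrm id x) (pre id \<frown> nrm id y)" using xy idn by metis
    then have "wless (nrm id x) (nrm id y)" by (simp only: wless_conc)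
    then show ?thesis unfolding fg[OF xy(1)] fg[OF xy(2)] by (simp only: wless_conc)
  qed
  have lin: "wless (g' x) (g' y) \<or> wless (g' y) (g' x)" if xy: "x \<in> C" "y \<in> C" "wless x y" for x y
  proof -
    have "g' x \<noteq> g' y" using key[OF xy] wless_irrefl by metis
    then show ?thesis using wless_linear gC xy by blast
  qed
  from f(2) have "inc g' \<or> dec g'"
  proof
    assume i: "inc f"
    have "wless (g' x) (g' y)" if xy: "x \<in> C" "y \<in> C" "wless x y" for x y
      using lin[OF xy] key[OF xy] i gC xy wless_asym unfolding inc_def by blast
    then show ?thesis unfolding inc_def by blast
  next
    assume d: "dec f"
    have "wless (g' y) (g' x)" if xy: "x \<in> C" "y \<in> C" "wless x y" for x y
      using lin[OF xy] key[OF xy] d gC xy wless_asym unfolding dec_def by blast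
    then show ?thesis unfolding dec_def by blast
  qed
  moreover have "sim g g'" unfolding g'_def using sim_sym[OF syn_sim_conc[OF ND(3)[OF g(1)] w(1)]] .
  ultimately show ?thesis using Ng' by blast
qed

lemma subgrouplike_UTO: "subgrouplike (UTO r)"
  unfolding subgrouplike_def
proof (intro conjI ballI)
  note UO = subgrouplike_UO[of r, unfolded subgrouplike_def]
  show "UTO r \<subseteq> {f. U f}" using UO unfolding UTO_def by blast
  have "inc id" unfolding inc_def by simp
  then show "id \<in> UTO r" unfolding UTO_def using UO N_id sim_refl by blast
next
  fix f g assume f: "f \<in> UTO r" and g: "g \<in> UTO r"
  obtain f' where f': "N f'" "sim f f'" "inc f' \<or> dec f'" using f unfolding UTO_def by blast
  obtain g' where g': "N g'" "sim g g'" "inc g' \<or> dec g'" using g unfolding UTO_def by blast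
  have N: "N f" "N g" "f \<in> UO r" "g \<in> UO r" using f g unfolding UTO_def UO_def U_def by blast+
  show "g \<circ> f \<in> UTO r" unfolding UTO_def
    using UO_cong[OF N(3,4)] N_comp[OF f'(1) g'(1)] N_comp_sim[OF N(1) f'(1) N(2) g'(1) f'(2) g'(2)]
      monotone_comp[OF ND(1)[OF f'(1)] f'(3) g'(3)] by blast
next
  fix f assume f: "f \<in> UTO r"
  then have fO: "f \<in> UO r" "N f" unfolding UTO_def UO_def U_def by blast+
  obtain g where g: "g \<in> UO r" "sim (f \<circ> g) id" "sim (g \<circ> f) id"
    using subgrouplike_UO[of r] fO(1) unfolding subgrouplike_def by blast
  have Ng: "N g" using g(1) unfolding UO_def U_def by blast
  obtain f' where f': "N f'" "sim f f'" "inc f' \<or> dec f'" using f unfolding UTO_def by blast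
  have "sim (f' \<circ> g) id"
    using sim_trans[OF N_comp_sim_right[OF f'(1) fO(2) Ng sim_sym[OF f'(2)]] g(2)] .
  then have "g \<in> UTO r" using monotone_inverse[OF f'(1,3) Ng] g(1) unfolding UTO_def by blast
  then show "\<exists>g\<in>UTO r. sim (f \<circ> g) id \<and> sim (g \<circ> f) id" using g by blast
qed

section \<open>Passage from maps to groups of cores\<close>

definition core_group :: "(letter word \<Rightarrow> letter word) set \<Rightarrow> nat transducer set monoid" where
  "core_group H = (O_group n)\<lparr>carrier := Cl ` H\<rparr>"

lemma core_group_simps [simp]:
  "carrier (core_group H) = Cl ` H" "x \<otimes>\<^bsub>core_group H\<^esub> y = core_mult n x y"
  "\<one>\<^bsub>core_group H\<^esub> = iso_class (id_transducer n)"
  by (simp_all add: core_group_def O_group_def)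

text \<open>The local actions of the identity all equal the normalized identity, so its core has a
  single state.\<close>

lemma one_Cl: "iso_class (id_transducer n) = Cl id"
  unfolding Cl_def
proof (rule iso_class_eqI)
  have nid: "nrm (\<lambda>y. w \<frown> y) = nrm id" for w
    using ND(6)[OF N_id] by (intro nrm_shift[of id _ w]) auto
  \<comment> \<open>The words \<open>zeros\<close> and \<open>tops\<close> differ in their first
    letter, so \<open>C\<close> has no common prefix.\<close>
  have preid: "pre id = []"
  proof -
    have *: "id y = pre id \<frown> nrm id y" if "y \<in> C" for y using pre_nrm[OF ND(6)[OF N_id] that] .
    have "zeros 0 = tops 0" if "pre id \<noteq> []"
    proof -
      have l: "0 < length (pre id)" using that by simp
      have "id zeros 0 = pre id ! 0" "id tops 0 = pre id ! 0"
        using *[OF zeros_tops_in_C(1)] *[OF zeros_tops_in_C(2)] conc_fst[OF l] by metis+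
      then show ?thesis by simp
    qed
    then show ?thesis using two_le by auto
  qed
  define e where "e = nrm id"
  have e: "e = restrict id C" unfolding e_def using nrm_normalized[OF preid] .
  have "\<exists>w\<in>Xs. K \<le> length w" for K using Xs_length_ex[of K] by auto
  then have Q: "Q id = {e}" unfolding Q_def e_def id_apply nid by auto
  have prec: "pre (e \<star> [i]) = [i]" "nrm (e \<star> [i]) = e" if i: "i \<in> X" for i
  proof -
    have *: "e ([i] \<frown> y) = [i] \<frown> id y" if "y \<in> C" for y using that i by (simp add: e)
    show "pre (e \<star> [i]) = [i]" using pre_shift[OF ND(6)[OF N_id] *] preid by (simp only: append_Nil2)
    show "nrm (e \<star> [i]) = e" using nrm_shift[OF ND(6)[OF N_id] *] by (simp only: e_def)
  qed
  show "transducer_iso (id_transducer n) (Bst (Pair C ` Q id))"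
    unfolding transducer_iso_def Q
    by (intro exI[of _ "\<lambda>_. (C, e)"]) (auto simp: id_transducer_def bij_betw_def prec)
qed (auto simp: id_transducer_def)

lemma group_core_group:
  assumes H: "subgrouplike H" shows "group (core_group H)"
proof (rule groupI)
  have N: "N f" if "f \<in> H" for f using H that unfolding subgrouplike_def U_def by blast
  fix x y assume "x \<in> carrier (core_group H)" "y \<in> carrier (core_group H)"
  then obtain f g where fg: "f \<in> H" "g \<in> H" "x = Cl f" "y = Cl g" by auto
  then have "x \<otimes>\<^bsub>core_group H\<^esub> y = Cl (g \<circ> f)" using core_mult_Cl[OF N N] by simp
  moreover have "g \<circ> f \<in> H" using H fg unfolding subgrouplike_def by blast
  ultimately show "x \<otimes>\<^bsub>core_group H\<^esub> y \<in> carrier (core_group H)" by simp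
  fix z assume "z \<in> carrier (core_group H)"
  then obtain h where h: "h \<in> H" "z = Cl h" by auto
  show "x \<otimes>\<^bsub>core_group H\<^esub> y \<otimes>\<^bsub>core_group H\<^esub> z = x \<otimes>\<^bsub>core_group H\<^esub> (y \<otimes>\<^bsub>core_group H\<^esub> z)"
    using fg h N N_comp by (simp add: core_mult_Cl comp_assoc)
next
  show "\<one>\<^bsub>core_group H\<^esub> \<in> carrier (core_group H)"
    using H unfolding subgrouplike_def by (simp add: one_Cl)
next
  fix x assume "x \<in> carrier (core_group H)"
  then obtain f where f: "f \<in> H" "x = Cl f" by auto
  have Nf: "N f" using H f unfolding subgrouplike_def U_def by blast
  show "\<one>\<^bsub>core_group H\<^esub> \<otimes>\<^bsub>core_group H\<^esub> x = x"
    using core_mult_Cl[OF N_id Nf] f by (simp add: one_Cl)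
  obtain g where g: "g \<in> H" "sim (f \<circ> g) id" using H f unfolding subgrouplike_def by blast
  have Ng: "N g" using H g unfolding subgrouplike_def U_def by blast
  have "Cl g \<otimes>\<^bsub>core_group H\<^esub> x = \<one>\<^bsub>core_group H\<^esub>"
    using core_mult_Cl[OF Ng Nf] Cl_sim[OF g(2)] f by (simp add: one_Cl)
  then show "\<exists>y\<in>carrier (core_group H). y \<otimes>\<^bsub>core_group H\<^esub> x = \<one>\<^bsub>core_group H\<^esub>"
    using g(1) by auto
qed

text \<open>The hypothesis \<open>conj\<close> is conjugation by \<open>Cl g\<close>, written in the
  reversed order of composition; \<open>g'\<close> stands for an inverse modulo
  \<open>sim\<close>.\<close>

lemma normal_core_group:
  assumes H: "subgrouplike H" and K: "subgrouplike K" and HK: "H \<subseteq> K"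
    and conj: "\<And>f g g'. f \<in> H \<Longrightarrow> g \<in> K \<Longrightarrow> g' \<in> K \<Longrightarrow> sim (g \<circ> g') id \<Longrightarrow> g' \<circ> (f \<circ> g) \<in> H"
  shows "Cl ` H \<lhd> core_group K"
proof -
  interpret G: group "core_group K" using group_core_group[OF K] .
  have N: "N f" if "f \<in> K" for f using K that unfolding subgrouplike_def U_def by blast
  have inv: "inv\<^bsub>core_group K\<^esub> (Cl g) = Cl g'" if g: "g \<in> K" "g' \<in> K" "sim (g \<circ> g') id" for g g'
    using core_mult_Cl[OF N[OF g(2)] N[OF g(1)]] Cl_sim[OF g(3)] g
        by (intro G.inv_equality) (simp_all add: one_Cl)
  have ex_inv: "\<exists>g'\<in>L. sim (g \<circ> g') id" if "g \<in> L" "subgrouplike L" for g L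
    using that unfolding subgrouplike_def by blast
  show ?thesis unfolding G.normal_inv_iff
  proof (intro conjI ballI)
    show "subgroup (Cl ` H) (core_group K)"
    proof (rule G.subgroupI)
      show "Cl ` H \<subseteq> carrier (core_group K)" using HK by auto
      show "Cl ` H \<noteq> {}" using H unfolding subgrouplike_def by blast
      fix a assume "a \<in> Cl ` H"
      then obtain f where f: "f \<in> H" "a = Cl f" by auto
      obtain f' where f': "f' \<in> H" "sim (f \<circ> f') id" using ex_inv[OF f(1) H] by blast
      show "inv\<^bsub>core_group K\<^esub> a \<in> Cl ` H" using inv[of f f'] f f' HK by auto
      fix b assume "b \<in> Cl ` H"
      then obtain g where g: "g \<in> H" "b = Cl g" by auto
      have "g \<circ> f \<in> H" using H f g unfolding subgrouplike_def by blast
      moreover have "a \<otimes>\<^bsub>core_group K\<^esub> b = Cl (g \<circ> f)" using core_mult_Cl[of f g] N f g HK by auto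
      ultimately show "a \<otimes>\<^bsub>core_group K\<^esub> b \<in> Cl ` H" by simp
    qed
    fix x a assume "x \<in> carrier (core_group K)" "a \<in> Cl ` H"
    then obtain g f where gf: "g \<in> K" "x = Cl g" "f \<in> H" "a = Cl f" by auto
    obtain g' where g': "g' \<in> K" "sim (g \<circ> g') id" using ex_inv[OF gf(1) K] by blast
    have Ns: "N g" "N g'" "N f" using N gf g' HK by auto
    have "x \<otimes>\<^bsub>core_group K\<^esub> a \<otimes>\<^bsub>core_group K\<^esub> inv\<^bsub>core_group K\<^esub> x = Cl (g' \<circ> (f \<circ> g))"
      using inv[OF gf(1) g'] Ns N_comp by (simp add: gf core_mult_Cl)
    then show "x \<otimes>\<^bsub>core_group K\<^esub> a \<otimes>\<^bsub>core_group K\<^esub> inv\<^bsub>core_group K\<^esub> x \<in> Cl ` H"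
      using conj[OF gf(3,1) g'] by simp
  qed
qed

text \<open>For \<open>r = n - 1\<close> both sides of the congruence vanish.\<close>

lemma UO_top: "UO (n - 1) = {f. U f}"
  unfolding UO_def by (simp add: cong_def)

lemma UO_conj:
  assumes f: "f \<in> UO r" and g: "U g" "U g'" "sim (g \<circ> g') id"
  shows "g' \<circ> (f \<circ> g) \<in> UO r"
proof -
  have Ns: "N f" "N g" "N g'" "U f" "[r * mult_const f = r] (mod (n - 1))" using f g
      unfolding UO_def U_def by blast+
  have "[mult_const (g' \<circ> (f \<circ> g)) = mult_const (f \<circ> g) * mult_const g'] (mod (n - 1))"
    by (rule mult_const_comp[OF N_comp[OF Ns(2,1)] Ns(3)])
  also have "[mult_const (f \<circ> g) * mult_const g' = mult_const g * mult_const f * mult_const g'] (mod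
      (n - 1))"
    by (rule cong_scalar_right[OF mult_const_comp[OF Ns(2,1)]])
  also have "mult_const g * mult_const f * mult_const g' = mult_const f * (mult_const g * mult_const g')"
    by simp
  also have "[mult_const f * (mult_const g * mult_const g') = mult_const f * 1] (mod (n - 1))"
    by (intro cong_scalar_left mult_const_inverse Ns g)
  finally have "[r * mult_const (g' \<circ> (f \<circ> g)) = r * mult_const f] (mod (n - 1))"
    unfolding mult_1_right by (rule cong_scalar_left)
  then have "[r * mult_const (g' \<circ> (f \<circ> g)) = r] (mod (n - 1))" using Ns(5) by (rule cong_trans)
  moreover have "U (g' \<circ> (f \<circ> g))" using U_comp[OF U_comp[OF g(1) Ns(4)] g(2)] .
  ultimately show ?thesis unfolding UO_def by blast
qed

lemma O_normal:
  assumes r: "1 \<le> r" shows "O_set n r \<lhd> O_group n"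
proof -
  have "(\<Union>s\<in>{1..n - 1}. O_set n s) = Cl ` {f. U f}"
  proof -
    have "n - 1 \<in> {1..n - 1}" using two_le by auto
    moreover have "O_set n (n - 1) = Cl ` {f. U f}" using O_set_eq[of "n - 1"] UO_top two_le by simp
    moreover have "O_set n s \<subseteq> Cl ` {f. U f}" if "s \<in> {1..n - 1}" for s
      using that O_set_eq[of s] unfolding UO_def by auto
    ultimately show ?thesis by blast
  qed
  then have G: "O_group n = core_group (UO (n - 1))"
    unfolding core_group_def UO_top by (simp add: O_group_def)
  have "Cl ` UO r \<lhd> core_group (UO (n - 1))"
  proof (rule normal_core_group[OF subgrouplike_UO subgrouplike_UO])
    show "UO r \<subseteq> UO (n - 1)" unfolding UO_top by (auto simp: UO_def)
    show "g' \<circ> (f \<circ> g) \<in> UO r" if "f \<in> UO r" "g \<in> UO (n - 1)" "g' \<in> UO (n - 1)" "sim (g \<circ> g') id"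
        for f g g'
      using that UO_conj[of f r g g'] unfolding UO_top by blast
  qed
  then show ?thesis using O_set_eq[OF r] G by simp
qed

text \<open>A conjugate lies in \<open>UTO (n - 1)\<close> because that is closed under composition,
  and in \<open>UO r\<close> by \<open>UO_conj\<close>; the intersection of the two is
  \<open>UTO r\<close>.\<close>

lemma TO_normal:
  assumes r: "1 \<le> r" shows "TO_set n r \<lhd> TO_group n"
proof -
  have "TO_set n (n - 1) = Cl ` UTO (n - 1)" using TO_set_eq[of "n - 1"] two_le by simp
  then have G: "TO_group n = core_group (UTO (n - 1))"
    unfolding TO_group_def core_group_def by simp
  have sub: "UTO s \<subseteq> UTO (n - 1)" for s unfolding UTO_def UO_top unfolding UO_def by blast
  have "Cl ` UTO r \<lhd> core_group (UTO (n - 1))"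
  proof (rule normal_core_group[OF subgrouplike_UTO subgrouplike_UTO sub])
    fix f g g' assume f: "f \<in> UTO r" and g: "g \<in> UTO (n - 1)" and g': "g' \<in> UTO (n - 1)"
        and gg': "sim (g \<circ> g') id"
    have "g' \<circ> (f \<circ> g) \<in> UTO (n - 1)"
      using subgrouplike_UTO[of "n - 1"] sub f g g' unfolding subgrouplike_def by blast
    moreover have "g' \<circ> (f \<circ> g) \<in> UO r"
      using UO_conj[of f r g g'] f g g' gg' unfolding UTO_def UO_top by blast
    ultimately show "g' \<circ> (f \<circ> g) \<in> UTO r" unfolding UTO_def by blast
  qed
  then show ?thesis using TO_set_eq[OF r] G by simp
qed

end

theorem theorem1p6:
  fixes n r :: nat
  assumes "n \<ge> 2" and "1 \<le> r" and "r \<le> n - 1"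
  shows "TO_set n r \<lhd> TO_group n \<and> O_set n r \<lhd> O_group n"
proof -
  interpret alphabet n by unfold_locales (rule assms(1))
  show ?thesis using O_normal[OF assms(2)] TO_normal[OF assms(2)] by blast
qed

end
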